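(* Let $G$ be a closed graph on the vertex set $[n]$, labeled by a closed labeling, and suppose $G$ is $K_4$-free (no four vertices of $G$ induce a complete graph $K_4$). Let $e$ be the number of edges of $G$ and $t$ the number of triangles (3-cycles) of $G$. Let $J_G\subset R=\mathbb{K}[x_1,\dots,x_n,y_1,\dots,y_n]$ be the binomial edge ideal of $G$ and let $\operatorname{in}_{\mathrm{lex}}(J_G)$ be its lexicographic initial ideal. Then for all integers $m\geq 1$ and $i\geq 0$, \[ \beta_{i,2m+i}\left(J_G^m\right)=\beta_{i,2m+i}\left((\operatorname{in}_{\mathrm{lex}}(J_G))^m\right)=\binom{e+m-i-1}{m-i}\binom{2t}{i}. \]
   Context: $\mathbb{K}$ is a field, and graphs are finite and simple. A graph $G$ is closed if its vertices admit a labeling by $[n]=\{1,\dots,n\}$ (a closed labeling) such that for all distinct edges $\{i,j\}$ and $\{k,l\}$ with $i<j$ and $k<l$: if $i=k$ then $\{j,l\}\in E(G)$, and if $j=l$ then $\{i,k\}\in E(G)$. The binomial edge ideal of $G$ is $J_G=(x_iy_j-x_jy_i : \{i,j\}\in E(G),\ i<j)\subset R=\mathbb{K}[x_1,\dots,x_n,y_1,\dots,y_n]$, where $R$ is standard graded. $\operatorname{in}_{\mathrm{lex}}(I)$ is the ideal generated by the leading monomials of the elements of $I$ with respect to the lexicographic order with $x_1>\cdots>x_n>y_1>\cdots>y_n$. For a finitely generated graded $R$-module $M$, the graded Betti number $\beta_{i,j}(M)$ is the number of summands $R(-j)$ in the $i$-th free module $F_i$ of a minimal graded free resolution $\cdots\to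 F_1\to F_0\to M\to 0$. Ideals are resolved as modules, so $\beta_{0,j}(I)$ counts the minimal generators of $I$ of degree $j$. Convention: $\binom{a}{b}=0$ if $b<0$, and $\binom{a}{0}=1$ for every integer $a$. *)

theory Defs
  imports
    "HOL-Library.Poly_Mapping"
    "Jordan_Normal_Form.Matrix_Kernel"
begin

section \<open>The polynomial ring\<close>

text \<open>
  A finite linearly ordered type \<open>'n\<close> plays the role of \<open>[n]\<close>; every finite nonempty
  linear order is uniquely isomorphic to some \<open>{1 < \<dots> < n}\<close>.  The type \<open>('n var, 'k) mpoly\<close> is the
  ring \<open>k[x\<^sub>1,\<dots>,x\<^sub>n,y\<^sub>1,\<dots>,y\<^sub>n]\<close>, whose commutative ring structure comes from
  \<open>Poly_Mapping\<close> (convolution product).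
\<close>

datatype 'n var = X 'n | Y 'n

type_synonym ('v, 'k) mpoly = "('v \<Rightarrow>\<^sub>0 nat) \<Rightarrow>\<^sub>0 'k"

definition xvar :: "'n \<Rightarrow> ('n var, 'k::comm_ring_1) mpoly" where
  "xvar i = Poly_Mapping.single (Poly_Mapping.single (X i) 1) 1"

definition yvar :: "'n \<Rightarrow> ('n var, 'k::comm_ring_1) mpoly" where
  "yvar i = Poly_Mapping.single (Poly_Mapping.single (Y i) 1) 1"

text \<open>
  Variables are enumerated as \<open>X 1, \<dots>, X n, Y 1, \<dots>, Y n\<close>; a variable that comes earlier
  is smaller as an index.  The order that \<open>Poly_Mapping\<close> puts on the exponent vectors
  \<open>'n var \<Rightarrow>\<^sub>0 nat\<close> compares two vectors at the smallest index at which they differ, so it is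
  the lexicographic monomial order with \<open>x\<^sub>1 > \<dots> > x\<^sub>n > y\<^sub>1 > \<dots> > y\<^sub>n\<close>
  (see \<open>less_exponent_iff\<close> and \<open>lex_variables\<close> below).
\<close>

instantiation var :: (linorder) linorder
begin

fun less_eq_var :: "'a var \<Rightarrow> 'a var \<Rightarrow> bool" where
  "X i \<le> X j \<longleftrightarrow> i \<le> j"
| "X i \<le> Y j \<longleftrightarrow> True"
| "Y i \<le> X j \<longleftrightarrow> False"
| "Y i \<le> Y j \<longleftrightarrow> i \<le> j"

definition less_var :: "'a var \<Rightarrow> 'a var \<Rightarrow> bool" where
  "less_var u v \<longleftrightarrow> u \<le> v \<and> \<not> v \<le> u"

instance
proof
  fix u v w :: "'a var"
  show "u < v \<longleftrightarrow> u \<le> v \<and> \<not> v \<le> u"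
    by (rule less_var_def)
  show "u \<le> u"
    by (cases u) auto
  show "u \<le> v \<Longrightarrow> v \<le> w \<Longrightarrow> u \<le> w"
    by (cases u; cases v; cases w) auto
  show "u \<le> v \<Longrightarrow> v \<le> u \<Longrightarrow> u = v"
    by (cases u; cases v) auto
  show "u \<le> v \<or> v \<le> u"
    by (cases u; cases v) auto
qed

end

lemma less_var_simps [simp]:
  "X i < X j \<longleftrightarrow> i < j"  "X i < Y j"  "\<not> Y i < X j"  "Y i < Y j \<longleftrightarrow> i < j"
  for i j :: "'a::linorder"
  by (auto simp: less_var_def)

lemma less_exponent_iff:
  fixes s t :: "'v::linorder \<Rightarrow>\<^sub>0 nat"
  shows "s < t \<longleftrightarrow> (\<exists>v. Poly_Mapping.lookup s v < Poly_Mapping.lookup t v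
                \<and> (\<forall>u<v. Poly_Mapping.lookup s u = Poly_Mapping.lookup t u))"
  by (simp add: less_poly_mapping.rep_eq less_fun_def)

lemma lex_variables:
  fixes u v :: "'v::linorder"
  shows "Poly_Mapping.single v (1::nat) < Poly_Mapping.single u 1 \<longleftrightarrow> u < v"
proof
  assume "Poly_Mapping.single v (1::nat) < Poly_Mapping.single u 1"
  then obtain w where w: "(1 when v = w) < ((1::nat) when u = w)"
      "\<forall>w'<w. (1 when v = w') = ((1::nat) when u = w')"
    by (auto simp: less_exponent_iff lookup_single)
  have uw: "u = w" "v \<noteq> w"
    using w(1) by (auto simp: when_def split: if_splits)
  have "\<not> v < w"
    using w(2)[rule_format, of v] uw by (auto simp: when_def)
  then show "u < v"
    using uw by auto
next
  assume "u < v"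
  then show "Poly_Mapping.single v (1::nat) < Poly_Mapping.single u 1"
    by (auto simp: less_exponent_iff lookup_single when_def intro!: exI[of _ u])
qed

definition mono_deg :: "('v \<Rightarrow>\<^sub>0 nat) \<Rightarrow> nat" where
  "mono_deg s = (\<Sum>v\<in>Poly_Mapping.keys s. Poly_Mapping.lookup s v)"

text \<open>
  The component \<open>R\<^sub>j\<close> of the standard grading; it contains \<open>0\<close>, and equals \<open>{0}\<close> for \<open>j < 0\<close>.
\<close>

definition homog_comp :: "int \<Rightarrow> ('v, 'k::comm_ring_1) mpoly set" where
  "homog_comp j = {p. \<forall>s\<in>Poly_Mapping.keys p. int (mono_deg s) = j}"

section \<open>Ideals\<close>

lemma module_times: "Modules.module ((*) :: 'a::comm_ring_1 \<Rightarrow> 'a \<Rightarrow> 'a)"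
  by unfold_locales (auto simp: algebra_simps)

definition ideal_gen :: "'a::comm_ring_1 set \<Rightarrow> 'a set" where
  "ideal_gen = Modules.module.span (*)"

fun ideal_power :: "'a::comm_ring_1 set \<Rightarrow> nat \<Rightarrow> 'a set" where
  "ideal_power I 0 = UNIV"
| "ideal_power I (Suc m) = ideal_gen {a * b | a b. a \<in> I \<and> b \<in> ideal_power I m}"

definition initial_ideal_lex :: "('v::linorder, 'k::comm_ring_1) mpoly set \<Rightarrow> ('v, 'k) mpoly set" where
  "initial_ideal_lex I =
     ideal_gen {Poly_Mapping.single (Max (Poly_Mapping.keys p)) 1 | p. p \<in> I \<and> p \<noteq> 0}"

section \<open>Graded Betti numbers\<close>

text \<open>
  Let \<open>M\<close> be a graded \<open>R\<close>-module with scalar multiplication \<open>scale\<close> and homogeneous components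
  \<open>gr j\<close>.  A complex \<open>\<dots> \<rightarrow> F\<^sub>1 \<rightarrow> F\<^sub>0 \<rightarrow> M\<close> of finitely generated graded free modules and
  homogeneous maps of degree \<open>0\<close> is given by

    \<^item> the lists \<open>d i\<close> of shifts: \<open>F\<^sub>i = R(-d\<^sub>i\<^sub>,\<^sub>0) \<oplus> R(-d\<^sub>i\<^sub>,\<^sub>1) \<oplus> \<dots>\<close>, whose elements are the
      vectors of length \<open>length (d i)\<close> over \<open>R\<close>;
    \<^item> the matrices \<open>A i\<close> of the differentials \<open>F\<^sub>i\<^sub>+\<^sub>1 \<rightarrow> F\<^sub>i\<close>: the degree \<open>0\<close> homogeneous maps
      \<open>R(-b) \<rightarrow> R(-a)\<close> are the multiplications by elements of \<open>R\<close> of degree \<open>b - a\<close>;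
    \<^item> the images \<open>g c \<in> M\<close> of the basis vectors of \<open>F\<^sub>0\<close>.

  It is minimal if every differential maps \<open>F\<^sub>i\<^sub>+\<^sub>1\<close> into \<open>\<mm> F\<^sub>i\<close>, where \<open>\<mm>\<close> is the ideal of
  the polynomials with constant term \<open>0\<close>.
\<close>

definition minimal_graded_free_resolution ::
  "(('v, 'k::comm_ring_1) mpoly \<Rightarrow> 'b::ab_group_add \<Rightarrow> 'b) \<Rightarrow> 'b set \<Rightarrow> (int \<Rightarrow> 'b set) \<Rightarrow>
   (nat \<Rightarrow> int list) \<Rightarrow> (nat \<Rightarrow> ('v, 'k) mpoly mat) \<Rightarrow> (nat \<Rightarrow> 'b) \<Rightarrow> bool" where
  "minimal_graded_free_resolution scale M gr d A g \<longleftrightarrow>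
     (let F = (\<lambda>i. carrier_vec (length (d i)) :: ('v, 'k) mpoly vec set);
          aug = (\<lambda>v. \<Sum>c<length (d 0). scale (v $ c) (g c))
      in (\<forall>c<length (d 0). g c \<in> gr (d 0 ! c)) \<and>
         (\<forall>i. A i \<in> carrier_mat (length (d i)) (length (d (Suc i)))) \<and>
         (\<forall>i. \<forall>r<length (d i). \<forall>c<length (d (Suc i)).
            A i $$ (r, c) \<in> homog_comp (d (Suc i) ! c - d i ! r)) \<and>
         aug ` F 0 = M \<and>
         {v \<in> F 0. aug v = 0} = (\<lambda>w. A 0 *\<^sub>v w) ` F 1 \<and>
         (\<forall>i. mat_kernel (A i) = (\<lambda>w. A (Suc i) *\<^sub>v w) ` F (Suc (Suc i))) \<and>
         (\<forall>i. \<forall>r<length (d i). \<forall>c<length (d (Suc i)).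
            Poly_Mapping.lookup (A i $$ (r, c)) 0 = 0))"

definition graded_betti ::
  "(('v, 'k::comm_ring_1) mpoly \<Rightarrow> 'b::ab_group_add \<Rightarrow> 'b) \<Rightarrow> 'b set \<Rightarrow> (int \<Rightarrow> 'b set) \<Rightarrow>
   nat \<Rightarrow> int \<Rightarrow> nat" where
  "graded_betti scale M gr i j =
     (THE b. \<exists>d A g. minimal_graded_free_resolution scale M gr d A g \<and> b = count_list (d i) j)"

definition ideal_betti :: "nat \<Rightarrow> int \<Rightarrow> ('v, 'k::comm_ring_1) mpoly set \<Rightarrow> nat" where
  "ideal_betti i j I = graded_betti (*) I (\<lambda>k. I \<inter> homog_comp k) i j"

section \<open>Graphs and binomial edge ideals\<close>

text \<open>A graph on the vertex set \<open>UNIV :: 'n set\<close> is given by its set of edges.\<close>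

definition simple_graph :: "'n set set \<Rightarrow> bool" where
  "simple_graph E \<longleftrightarrow> (\<forall>e\<in>E. card e = 2)"

text \<open>The labeling is the identity: the vertices are their own labels.\<close>

definition closed_labeled :: "'n::linorder set set \<Rightarrow> bool" where
  "closed_labeled E \<longleftrightarrow>
     (\<forall>i j k l. {i, j} \<in> E \<and> {k, l} \<in> E \<and> {i, j} \<noteq> {k, l} \<and> i < j \<and> k < l \<longrightarrow>
        (i = k \<longrightarrow> {j, l} \<in> E) \<and> (j = l \<longrightarrow> {i, k} \<in> E))"

definition is_clique :: "'n set set \<Rightarrow> 'n set \<Rightarrow> bool" where
  "is_clique E S \<longleftrightarrow> (\<forall>i\<in>S. \<forall>j\<in>S. i \<noteq> j \<longrightarrow> {i, j} \<in> E)"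

definition K4_free :: "'n set set \<Rightarrow> bool" where
  "K4_free E \<longleftrightarrow> \<not> (\<exists>S. card S = 4 \<and> is_clique E S)"

definition triangles :: "'n set set \<Rightarrow> 'n set set" where
  "triangles E = {S. card S = 3 \<and> is_clique E S}"

definition binomial_edge_ideal :: "'n::linorder set set \<Rightarrow> ('n var, 'k::comm_ring_1) mpoly set" where
  "binomial_edge_ideal E =
     ideal_gen {xvar i * yvar j - xvar j * yvar i | i j. {i, j} \<in> E \<and> i < j}"

section \<open>Binomial coefficients\<close>

text \<open>\<open>rat\<close>-valued because \<open>gchoose\<close> is available over fields of characteristic 0 only.\<close>

definition binom :: "int \<Rightarrow> int \<Rightarrow> rat" where
  "binom a b = (if b < 0 then 0 else of_int a gchoose nat b)"

lemma binom_zero: "binom a 0 = 1"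
  by (simp add: binom_def)

lemma binom_of_nat: "binom (int a) (int b) = of_nat (a choose b)"
  by (simp add: binom_def binomial_gbinomial)

end

theory Submission
  imports Defs "HOL-Library.Function_Algebras"
begin

text \<open>
  Let \<open>I\<close> be a homogeneous ideal living in degrees \<open>\<ge> D\<close>.  In every minimal resolution of \<open>I\<close> the
  generators of degree \<open>D + i\<close> of the \<open>i\<close>-th module form a basis of the kernel of the Koszul
  differential \<open>\<Lambda>\<^sup>i V \<otimes> I\<^sub>D \<rightarrow> \<Lambda>\<^sup>i\<^sup>-\<^sup>1 V \<otimes> R\<^sub>D\<^sub>+\<^sub>1\<close>, \<open>V\<close> being the space of linear forms.  For \<open>J\<^sub>G\<^sup>m\<close>, and for
  \<open>in(J\<^sub>G)\<^sup>m\<close>, the component \<open>I\<^sub>2\<^sub>m\<close> is spanned by the products of \<open>m\<close> of the \<open>e\<close> generators, and these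
  products have distinct leading monomials because the edges \<open>X i - Y j\<close> form a disjoint union of
  paths.  Each triangle yields two linear syzygies, and the wedge products of \<open>i\<close> of these \<open>2t\<close> syzygies
  with products of \<open>m - i\<close> generators lie in the kernel.  Order pairs (wedge of variables, monomial) by
  their total monomial, breaking ties by the wedge part: the wedge products of syzygies have
  distinct leading pairs, and exchanging one variable at a time shows that every element of the
  kernel has one of these leading pairs.
\<close>

text \<open>Why a Koszul kernel: it and the span of the generators in question both compute Tor_i(I,
  K) in degree D + i, where no boundaries occur because I vanishes below D. The comparison is made
  by hand: reading off the linear coefficients of successive differentials sends a generator to an
  alternating function. As \<open>graded_betti\<close> is a definite description, the count is made
  in an arbitrary minimal resolution, and one has to be constructed as well.

  What K4-freeness buys: in a closed graph the upper neighbours of a vertex form a clique, so there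
  are at most two of them. Hence a triangle i < j < k is determined by i, and also by j, and its two
  syzygies can be indexed by the variables \<open>X i\<close> and \<open>Y j\<close> at which they
  lead: x_i f_jk - x_j f_ik + x_k f_ij and y_j f_ik - y_k f_ij - y_i f_jk for the binomials. They
  lead with distinct edges, so i of them mark i different factors of a product of m generators; this
  is the source of the two binomial coefficients.

  Both ideals follow from one argument for the generators x_i y_j - \<delta> x_j y_i, where \<delta>
  is 1 or 0.\<close>

abbreviation lookup :: "('a \<Rightarrow>\<^sub>0 'b::zero) \<Rightarrow> 'a \<Rightarrow> 'b" where
  "lookup \<equiv> Poly_Mapping.lookup"

abbreviation single :: "'a \<Rightarrow> 'b::zero \<Rightarrow> 'a \<Rightarrow>\<^sub>0 'b" where
  "single \<equiv> Poly_Mapping.single"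

abbreviation keys :: "('a \<Rightarrow>\<^sub>0 'b::zero) \<Rightarrow> 'a set" where
  "keys \<equiv> Poly_Mapping.keys"

section \<open>Exponent vectors and their degrees\<close>

lemma mono_deg_eq_sum_UNIV: "mono_deg (s :: 'v::finite \<Rightarrow>\<^sub>0 nat) = (\<Sum>v\<in>UNIV. lookup s v)"
  unfolding mono_deg_def by (rule sum.mono_neutral_left) (auto simp: in_keys_iff)

lemma mono_deg_0 [simp]: "mono_deg 0 = 0"
  by (simp add: mono_deg_def)

lemma mono_deg_add: "mono_deg (s + t) = mono_deg s + mono_deg (t :: 'v::finite \<Rightarrow>\<^sub>0 nat)"
  by (simp add: mono_deg_eq_sum_UNIV lookup_add sum.distrib)

lemma mono_deg_single [simp]: "mono_deg (single v n) = n"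
  by (simp add: mono_deg_def)

lemma mono_deg_eq_0_iff [simp]: "mono_deg s = 0 \<longleftrightarrow> s = 0"
proof
  assume "mono_deg s = 0"
  then show "s = 0"
    by (intro poly_mapping_eqI) (auto simp: mono_deg_def in_keys_iff)
qed simp

lemma mono_deg_eq_1_iff:
  "mono_deg (s :: 'v::finite \<Rightarrow>\<^sub>0 nat) = 1 \<longleftrightarrow> (\<exists>v. s = single v 1)"
proof
  assume a: "mono_deg s = 1"
  then obtain v where v: "lookup s v \<noteq> 0"
    by (metis mono_deg_eq_0_iff one_neq_zero poly_mapping_eqI lookup_zero)
  have "mono_deg s = lookup s v + (\<Sum>w\<in>UNIV - {v}. lookup s w)"
    unfolding mono_deg_eq_sum_UNIV by (rule sum.remove) auto
  with a v have 1: "lookup s v = 1" and 0: "(\<Sum>w\<in>UNIV - {v}. lookup s w) = 0"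
    by linarith+
  have "lookup s w = 0" if "w \<noteq> v" for w
    using 0 that by simp
  with 1 have "s = single v 1"
    by (intro poly_mapping_eqI) (auto simp: lookup_single when_def)
  then show "\<exists>v. s = single v 1" ..
qed auto

lemma finite_mono_deg: "finite {s :: 'v::finite \<Rightarrow>\<^sub>0 nat. mono_deg s \<le> n}"
proof -
  have "finite {f :: 'v \<Rightarrow> nat. f ` UNIV \<subseteq> {..n}}"
    using finite_set_of_finite_funs[of "UNIV :: 'v set" "{..n}" 0]
    by (simp add: image_subset_iff)
  moreover have "lookup ` {s :: 'v \<Rightarrow>\<^sub>0 nat. mono_deg s \<le> n} \<subseteq> {f. f ` UNIV \<subseteq> {..n}}"
  proof clarsimp
    fix s :: "'v \<Rightarrow>\<^sub>0 nat" and v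
    assume "mono_deg s \<le> n"
    moreover have "lookup s v \<le> mono_deg s"
      unfolding mono_deg_eq_sum_UNIV by (intro member_le_sum) auto
    ultimately show "lookup s v \<le> n" by simp
  qed
  ultimately have "finite (lookup ` {s :: 'v \<Rightarrow>\<^sub>0 nat. mono_deg s \<le> n})"
    by (rule rev_finite_subset)
  then show ?thesis
    by (rule finite_imageD) (auto intro: inj_onI poly_mapping_eqI)
qed

subsection \<open>Dickson's lemma\<close>

text \<open>A monotone subsequence always exists; a decreasing one is constant from the place where
  it takes its least value, so a tail of it is nondecreasing too.\<close>

lemma nat_seq_mono_subseq:
  fixes f :: "nat \<Rightarrow> nat"
  obtains g :: "nat \<Rightarrow> nat" where "strict_mono g" "mono (f \<circ> g)"
proof -
  obtain g :: "nat \<Rightarrow> nat" where g: "strict_mono g" "monoseq (\<lambda>n. f (g n))"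
    using seq_monosub by blast
  show ?thesis
  proof (cases "incseq (\<lambda>n. f (g n))")
    case True
    then show ?thesis using that[of g] g by (simp add: comp_def)
  next
    case False
    then have dec: "decseq (\<lambda>n. f (g n))"
      using g by (auto simp: monoseq_iff)
    obtain N where N: "f (g N) = (LEAST x. \<exists>n. x = f (g n))"
      using LeastI_ex[of "\<lambda>x. \<exists>n. x = f (g n)"] by metis
    have le: "f (g N) \<le> f (g n)" for n
      unfolding N by (rule Least_le) auto
    have const: "f (g n) = f (g N)" if "n \<ge> N" for n
      using decseqD[OF dec that] le[of n] by simp
    show ?thesis
    proof (rule that[of "\<lambda>n. g (N + n)"])
      show "strict_mono (\<lambda>n. g (N + n))"
        using g by (simp add: strict_mono_def)
      show "mono (f \<circ> (\<lambda>n. g (N + n)))"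
        using const[OF le_add1] by (simp add: mono_def comp_def)
    qed
  qed
qed

text \<open>Coordinates are treated one at a time; a coordinate that is already monotone stays so on
  a further subsequence.\<close>

lemma nat_fun_seq_mono_subseq:
  fixes f :: "nat \<Rightarrow> 'v \<Rightarrow> nat"
  assumes "finite V"
  shows "\<exists>g :: nat \<Rightarrow> nat. strict_mono g \<and> (\<forall>v\<in>V. mono (\<lambda>n. f (g n) v))"
  using assms
proof (induction V)
  case empty
  show ?case by (rule exI[of _ id]) (simp add: strict_mono_def)
next
  case (insert v V)
  then obtain g :: "nat \<Rightarrow> nat" where g: "strict_mono g" "\<forall>v\<in>V. mono (\<lambda>n. f (g n) v)"
    by blast
  obtain h :: "nat \<Rightarrow> nat" where h: "strict_mono h" "mono ((\<lambda>n. f (g n) v) \<circ> h)"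
    using nat_seq_mono_subseq by blast
  have "strict_mono (\<lambda>n. g (h n))"
    using g h by (simp add: strict_mono_def)
  moreover have "mono (\<lambda>n. f (g (h n)) w)" if "w \<in> insert v V" for w
  proof (cases "w = v")
    case True
    then show ?thesis using h(2) by (simp add: comp_def)
  next
    case False
    then have "mono (\<lambda>n. f (g n) w)" using that g(2) by blast
    then show ?thesis
      using strict_mono_mono[OF h(1)] by (simp add: mono_def)
  qed
  ultimately show ?case by blast
qed

text \<open>Otherwise elements could be chosen forever, each a multiple of none of the earlier ones;
  but a subsequence that is monotone in every coordinate contains a later multiple of an earlier
  element.\<close>

lemma Dickson:
  fixes T :: "('v::finite \<Rightarrow>\<^sub>0 nat) set"
  obtains B where "finite B" "B \<subseteq> T" "\<And>t. t \<in> T \<Longrightarrow> \<exists>b\<in>B. \<exists>u. t = b + u"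
proof -
  have "\<exists>B. finite B \<and> B \<subseteq> T \<and> (\<forall>t\<in>T. \<exists>b\<in>B. \<exists>u. t = b + u)"
  proof (rule ccontr)
    assume neg: "\<nexists>B. finite B \<and> B \<subseteq> T \<and> (\<forall>t\<in>T. \<exists>b\<in>B. \<exists>u. t = b + u)"
    define next_elem where "next_elem B = (SOME t. t \<in> T \<and> (\<forall>b\<in>B. \<forall>u. t \<noteq> b + u))" for B
    have nx: "next_elem B \<in> T" "\<forall>b\<in>B. \<forall>u. next_elem B \<noteq> b + u" if "finite B" "B \<subseteq> T" for B
    proof -
      have "\<exists>t. t \<in> T \<and> (\<forall>b\<in>B. \<forall>u. t \<noteq> b + u)"
      proof (rule ccontr)
        assume "\<nexists>t. t \<in> T \<and> (\<forall>b\<in>B. \<forall>u. t \<noteq> b + u)"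
        then have *: "finite B \<and> B \<subseteq> T \<and> (\<forall>t\<in>T. \<exists>b\<in>B. \<exists>u. t = b + u)"
          using that by simp
        show False
          by (rule notE[OF neg], rule exI[of _ B]) (rule *)
      qed
      then have "next_elem B \<in> T \<and> (\<forall>b\<in>B. \<forall>u. next_elem B \<noteq> b + u)"
        unfolding next_elem_def by (rule someI_ex)
      then show "next_elem B \<in> T" "\<forall>b\<in>B. \<forall>u. next_elem B \<noteq> b + u" by auto
    qed
    \<comment> \<open>\<open>S n\<close> collects the first n choices, and \<open>a n\<close> is the
      choice made after them.\<close>
    define S where "S = rec_nat {} (\<lambda>_ B. insert (next_elem B) B)"
    have S: "finite (S n) \<and> S n \<subseteq> T" for n
      by (induction n) (auto simp: S_def nx)
    define a where "a n = next_elem (S n)" for n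
    have Sa: "a k \<in> S n" if "k < n" for k n
      using that by (induction n) (auto simp: S_def a_def less_Suc_eq)
    obtain g :: "nat \<Rightarrow> nat" where g: "strict_mono g" "\<forall>v\<in>UNIV. mono (\<lambda>n. lookup (a (g n)) v)"
      using nat_fun_seq_mono_subseq[of "UNIV :: 'v set" "\<lambda>n. lookup (a n)"] by auto
    have "g 0 < g 1" using g(1) by (simp add: strict_mono_def)
    then have "\<forall>u. a (g 1) \<noteq> a (g 0) + u"
      using nx(2)[of "S (g 1)"] S Sa[of "g 0" "g 1"] unfolding a_def[of "g 1"] by blast
    moreover have "a (g 1) = a (g 0) + (a (g 1) - a (g 0))"
    proof (rule poly_mapping_eqI)
      fix v
      have "lookup (a (g 0)) v \<le> lookup (a (g 1)) v"
        using g(2) by (auto simp: mono_def)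
      then show "lookup (a (g 1)) v = lookup (a (g 0) + (a (g 1) - a (g 0))) v"
        by (simp add: lookup_add lookup_minus)
    qed
    ultimately show False by blast
  qed
  then show ?thesis using that by blast
qed

subsection \<open>Homogeneous components\<close>

text \<open>Degrees are integers because shifts will be subtracted from them; components of negative
  degree are 0.\<close>

lift_definition hc :: "int \<Rightarrow> ('v, 'k::comm_ring_1) mpoly \<Rightarrow> ('v, 'k) mpoly" is
  "\<lambda>j p s. if int (mono_deg s) = j then p s else 0"
  by (rule finite_subset[rotated]) auto

lemma lookup_hc: "lookup (hc j p) s = (if int (mono_deg s) = j then lookup p s else 0)"
  by transfer simp

lemma hc_zero [simp]: "hc j 0 = 0"
  by (rule poly_mapping_eqI) (simp add: lookup_hc)

lemma hc_add: "hc j (p + q) = hc j p + hc j q"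
  by (rule poly_mapping_eqI) (simp add: lookup_hc lookup_add)

lemma hc_sum: "hc j (sum f A) = (\<Sum>a\<in>A. hc j (f a))"
  by (induction A rule: infinite_finite_induct) (auto simp: hc_add)

lemma hc_in_homog_comp [simp]: "hc j p \<in> homog_comp j"
  by (auto simp: homog_comp_def in_keys_iff lookup_hc split: if_splits)

lemma homog_compD: "p \<in> homog_comp j \<Longrightarrow> lookup p s \<noteq> 0 \<Longrightarrow> int (mono_deg s) = j"
  by (auto simp: homog_comp_def in_keys_iff)

lemma homog_compI: "(\<And>s. lookup p s \<noteq> 0 \<Longrightarrow> int (mono_deg s) = j) \<Longrightarrow> p \<in> homog_comp j"
  by (auto simp: homog_comp_def in_keys_iff)

lemma hc_homog: "p \<in> homog_comp i \<Longrightarrow> hc j p = (if i = j then p else 0)"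
  by (rule poly_mapping_eqI) (auto simp: lookup_hc dest: homog_compD)

lemma homog_comp_zero [simp]: "0 \<in> homog_comp j"
  by (auto intro: homog_compI)

lemma homog_comp_add: "p \<in> homog_comp j \<Longrightarrow> q \<in> homog_comp j \<Longrightarrow> p + q \<in> homog_comp j"
  by (rule homog_compI) (metis add.right_neutral homog_compD lookup_add)

lemma homog_comp_uminus: "p \<in> homog_comp j \<Longrightarrow> - p \<in> homog_comp j"
  by (rule homog_compI) (auto dest: homog_compD)

lemma homog_comp_diff: "p \<in> homog_comp j \<Longrightarrow> q \<in> homog_comp j \<Longrightarrow> p - q \<in> homog_comp j"
  using homog_comp_add[of p j "- q"] homog_comp_uminus by auto

lemma homog_comp_sum: "(\<And>a. a \<in> A \<Longrightarrow> f a \<in> homog_comp j) \<Longrightarrow> sum f A \<in> homog_comp j"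
  by (induction A rule: infinite_finite_induct) (auto simp: homog_comp_add)

lemma lookup_mult_nonzeroE:
  assumes "lookup (p * q) s \<noteq> (0 :: 'k::comm_ring_1)"
  obtains a b where "s = a + b" "lookup p a \<noteq> 0" "lookup q b \<noteq> 0"
  using keys_mult[of p q] assms by (fastforce simp: in_keys_iff subset_iff)

lemma homog_comp_mult:
  fixes p q :: "('v::finite, 'k::comm_ring_1) mpoly"
  shows "p \<in> homog_comp i \<Longrightarrow> q \<in> homog_comp j \<Longrightarrow> p * q \<in> homog_comp (i + j)"
  by (rule homog_compI, erule lookup_mult_nonzeroE) (auto simp: mono_deg_add dest: homog_compD)

lemma homog_comp_single: "int (mono_deg s) = j \<Longrightarrow> single s c \<in> homog_comp j"
  by (rule homog_compI) (auto simp: lookup_single when_def split: if_splits)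

lemma homog_comp_neg: "j < 0 \<Longrightarrow> p \<in> homog_comp j \<Longrightarrow> p = 0"
  by (rule poly_mapping_eqI) (metis homog_compD lookup_zero not_less of_nat_0_le_iff)

lemma sum_hc:
  fixes p :: "('v, 'k::comm_ring_1) mpoly"
  assumes "finite A" "\<And>s. lookup p s \<noteq> 0 \<Longrightarrow> int (mono_deg s) \<in> A"
  shows "(\<Sum>j\<in>A. hc j p) = p"
proof (rule poly_mapping_eqI)
  fix s
  have "lookup (\<Sum>j\<in>A. hc j p) s = (\<Sum>j\<in>A. if j = int (mono_deg s) then lookup p s else 0)"
    unfolding lookup_sum by (intro sum.cong) (auto simp: lookup_hc)
  also have "\<dots> = lookup p s"
    using assms by (auto simp: sum.delta)
  finally show "lookup (\<Sum>j\<in>A. hc j p) s = lookup p s" .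
qed

lemma eq_sum_hc:
  fixes p :: "('v, 'k::comm_ring_1) mpoly"
  obtains A where "finite A" "p = (\<Sum>j\<in>A. hc j p)"
proof (rule that)
  show "finite ((\<lambda>s. int (mono_deg s)) ` keys p)" by simp
  show "p = (\<Sum>j\<in>(\<lambda>s. int (mono_deg s)) ` keys p. hc j p)"
    by (rule sum_hc[symmetric]) (auto simp: in_keys_iff)
qed

lemma hc_mult:
  fixes p q :: "('v::finite, 'k::comm_ring_1) mpoly"
  assumes "p \<in> homog_comp i"
  shows "hc j (p * q) = p * hc (j - i) q"
proof -
  obtain A where A: "finite A" "q = (\<Sum>k\<in>A. hc k q)" by (rule eq_sum_hc)
  have "hc j (p * q) = (\<Sum>k\<in>A. hc j (p * hc k q))"
    by (subst A(2)) (simp add: sum_distrib_left hc_sum)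
  also have "\<dots> = (\<Sum>k\<in>A. p * (hc (j - i) (hc k q)))"
  proof (rule sum.cong)
    fix k
    have "p * hc k q \<in> homog_comp (i + k)" using assms by (simp add: homog_comp_mult)
    then show "hc j (p * hc k q) = p * (hc (j - i) (hc k q))"
      by (auto simp: hc_homog[where i="i+k"] hc_homog[OF hc_in_homog_comp])
  qed simp
  also have "\<dots> = p * hc (j - i) q"
    by (subst (2) A(2)) (simp add: sum_distrib_left hc_sum)
  finally show ?thesis .
qed

lemma hc_mult':
  fixes p q :: "('v::finite, 'k::comm_ring_1) mpoly"
  assumes "q \<in> homog_comp i"
  shows "hc j (p * q) = hc (j - i) p * q"
  using hc_mult[OF assms, of j p] by (simp add: mult.commute)

section \<open>Scalars, variables and module structures\<close>

definition cst :: "'k::comm_ring_1 \<Rightarrow> ('v, 'k) mpoly" where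
  "cst c = single 0 c"

lemma lookup_cst: "lookup (cst c) s = (if s = 0 then c else 0)"
  by (simp add: cst_def lookup_single when_def)

lemma cst_0 [simp]: "cst 0 = 0" and cst_1 [simp]: "cst 1 = 1"
  by (simp_all add: cst_def)

lemma cst_add: "cst (a + b) = cst a + cst b"
  by (simp add: cst_def single_add)

lemma cst_mult: "cst (a * b) = cst a * cst b"
  by (simp add: cst_def mult_single)

lemma cst_uminus: "cst (- a) = - cst a"
  by (simp add: cst_def single_uminus)

lemma cst_sum: "cst (sum f A) = (\<Sum>a\<in>A. cst (f a))"
  by (induction A rule: infinite_finite_induct) (auto simp: cst_add)

lemma lookup_cst_mult [simp]: "lookup (cst c * p) s = c * lookup p s"
  unfolding cst_def mult_map_scale_conv_mult[symmetric] by (simp add: map.rep_eq when_def)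

lemma cst_in_homog_comp [simp]: "cst c \<in> homog_comp 0"
  by (auto simp: cst_def intro: homog_comp_single)

lemma hc_0_eq: "hc 0 p = cst (lookup p 0)"
  by (rule poly_mapping_eqI) (auto simp: lookup_hc lookup_cst)

lemma homog_comp_0_eq: "p \<in> homog_comp 0 \<Longrightarrow> p = cst (lookup p 0)"
  using hc_0_eq[of p] hc_homog[of p 0 0] by simp

definition pvar :: "'v \<Rightarrow> ('v, 'k::comm_ring_1) mpoly" where
  "pvar v = single (single v 1) 1"

lemma pvar_in_homog_comp [simp]: "pvar v \<in> homog_comp 1"
  by (auto simp: pvar_def intro: homog_comp_single)

interpretation R: module "(*) :: 'a::comm_ring_1 \<Rightarrow> 'a \<Rightarrow> 'a"
  by (rule module_times)

text \<open>Vectors are functions on all of \<open>nat\<close>, so that free modules of every rank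
  share one type; a bound on the support plays the part of the rank.\<close>

interpretation fm: module "\<lambda>(p::'a::comm_ring_1) (w::nat \<Rightarrow> 'a) r. p * w r"
proof (unfold_locales, goal_cases)
  case (1 a x y)
  show ?case by (rule ext) (simp only: plus_fun_apply distrib_left)
next
  case (2 a b x)
  show ?case by (rule ext) (simp only: plus_fun_apply distrib_right)
next
  case (3 a b x)
  show ?case by (simp only: mult.assoc)
next
  case (4 x)
  show ?case by (simp only: mult_1_left)
qed

lemma ideal_gen_eq: "ideal_gen = R.span"
  by (simp add: ideal_gen_def)

definition hom_closed :: "('v, 'k::comm_ring_1) mpoly set \<Rightarrow> bool" where
  "hom_closed I \<longleftrightarrow> (\<forall>p\<in>I. \<forall>j. hc j p \<in> I)"

lemma hom_closedD: "hom_closed I \<Longrightarrow> p \<in> I \<Longrightarrow> hc j p \<in> I"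
  by (simp add: hom_closed_def)

lemma lookup_single_mult_nonzeroE:
  fixes p :: "('v, 'k::comm_ring_1) mpoly"
  assumes "lookup (single u c * p) s \<noteq> 0"
  obtains t where "s = u + t" "lookup p t \<noteq> 0"
  using assms
  by (rule lookup_mult_nonzeroE) (auto simp: lookup_single when_def split: if_splits)

lemma lookup_single_mult [simp]:
  fixes p :: "('v, 'k::comm_ring_1) mpoly"
  shows "lookup (single u c * p) (u + s) = c * lookup p s"
proof -
  \<comment> \<open>Without its term at \<open>s\<close> the factor cannot contribute to
    \<open>u + s\<close>, because exponents cancel.\<close>
  define q where "q = p - single s (lookup p s)"
  have "lookup (single u c * q) (u + s) = 0"
  proof (rule ccontr)
    assume "lookup (single u c * q) (u + s) \<noteq> 0"
    then obtain t where "u + s = u + t" "lookup q t \<noteq> 0"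
      by (rule lookup_single_mult_nonzeroE)
    then show False by (simp add: q_def lookup_minus)
  qed
  moreover have "p = single s (lookup p s) + q" by (simp add: q_def)
  then have "single u c * p =
      single (u + s) (c * lookup p s) + single u c * q"
    by (metis distrib_left mult_single)
  ultimately show ?thesis by (simp add: lookup_add)
qed

section \<open>Leading monomials and finite generation\<close>

lemma Max_keys:
  fixes p :: "('v::linorder, 'k::comm_ring_1) mpoly"
  assumes "p \<noteq> 0"
  shows "lookup p (Max (keys p)) \<noteq> 0"
proof -
  have "Max (keys p) \<in> keys p" using assms by (intro Max_in) auto
  then show ?thesis by (simp add: in_keys_iff)
qed

lemma Max_keys_ge: "lookup p s \<noteq> 0 \<Longrightarrow> s \<le> Max (keys p)"
  for p :: "('v::linorder, 'k::comm_ring_1) mpoly"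
  by (rule Max_ge) (auto simp: in_keys_iff)

text \<open>Hilbert's argument by leading monomials: Dickson's lemma supplies finitely many
  homogeneous elements whose leading monomials divide those of all homogeneous elements, and
  division by them ends at 0. Homogeneity keeps the remainders in one degree, where there are only
  finitely many monomials.\<close>

theorem homogeneous_ideal_finitely_generated:
  fixes I :: "('v::{finite,linorder}, 'k::field) mpoly set"
  assumes I: "R.subspace I" and h: "hom_closed I"
  obtains G where "finite G" "G \<subseteq> I" "\<And>g. g \<in> G \<Longrightarrow> \<exists>j. g \<in> homog_comp j" "I = R.span G"
proof -
  define H where "H = {p \<in> I. p \<noteq> 0 \<and> (\<exists>j. p \<in> homog_comp j)}"
  define T where "T = (\<lambda>p. Max (keys p)) ` H"
  obtain B where B: "finite B" "B \<subseteq> T" "\<And>t. t \<in> T \<Longrightarrow> \<exists>b\<in>B. \<exists>u. t = b + u"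
    using Dickson[of T] by blast
  obtain G where G: "G \<subseteq> H" "finite G" "B = (\<lambda>p. Max (keys p)) ` G"
    using finite_subset_image[OF B(1) B(2)[unfolded T_def]] by blast
  have hom: "p \<in> R.span G" if "p \<in> I" "p \<in> homog_comp j" for p j
  proof -
    have "finite {s :: 'v \<Rightarrow>\<^sub>0 nat. int (mono_deg s) = j}" (is "finite ?D")
      by (rule finite_subset[OF _ finite_mono_deg[of "nat j"]]) auto
    \<comment> \<open>Measure of the descent: cancelling the leading term removes at least the old
      leading monomial from this set.\<close>
    define N where "N p = card {s. int (mono_deg s) = j \<and> s \<le> Max (keys p)}" for p :: "('v, 'k) mpoly"
    show ?thesis using that
    proof (induction "N p" arbitrary: p rule: less_induct)
      case less
      show ?case
      proof (cases "p = 0")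
        case True
        then show ?thesis by (simp add: R.span_zero)
      next
        case False
        let ?m = "Max (keys p)"
        have "?m \<in> T" using False less.prems by (auto simp: T_def H_def)
        then obtain g u where g: "g \<in> G" and mu: "?m = Max (keys g) + u"
          using B(3) G(3) by blast
        have gH: "g \<in> I" "g \<noteq> 0" using g G(1) by (auto simp: H_def)
        obtain a where a: "g \<in> homog_comp a" using g G(1) by (auto simp: H_def)
        define c where "c = lookup p ?m / lookup g (Max (keys g))"
        define q where "q = p - single u c * g"
        have lg: "lookup g (Max (keys g)) \<noteq> 0" by (rule Max_keys) fact
        have lp: "lookup p ?m \<noteq> 0" by (rule Max_keys) fact
        have dm: "int (mono_deg ?m) = j" using lp less.prems by (auto dest: homog_compD)
        have "int (mono_deg (Max (keys g))) = a" using lg a by (auto dest: homog_compD)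
        then have "int (mono_deg u) + a = j" using dm mu by (simp add: mono_deg_add)
        then have "single u c * g \<in> homog_comp j"
          using homog_comp_mult[OF homog_comp_single[OF refl, of u c] a] by simp
        then have qj: "q \<in> homog_comp j" using less.prems by (simp add: q_def homog_comp_diff)
        have qI: "q \<in> I" unfolding q_def
          using less.prems gH by (intro R.subspace_diff[OF I] R.subspace_scale[OF I]) auto
        have "q \<in> R.span G"
        proof (cases "q = 0")
          case True
          then show ?thesis by (simp add: R.span_zero)
        next
          case q0: False
          have q_le: "s < ?m" if s: "lookup q s \<noteq> 0" for s
          proof -
            have "lookup q ?m = 0"
              using lg lookup_single_mult[of u c g "Max (keys g)"] mu
              by (simp add: q_def lookup_minus c_def add.commute)
            with s have ne: "s \<noteq> ?m" by auto
            from s have "lookup p s \<noteq> 0 \<or> lookup (single u c * g) s \<noteq> 0"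
              by (auto simp: q_def lookup_minus)
            then have "s \<le> ?m"
            proof
              assume "lookup p s \<noteq> 0"
              then show ?thesis by (rule Max_keys_ge)
            next
              assume "lookup (single u c * g) s \<noteq> 0"
              then obtain t where t: "s = u + t" "lookup g t \<noteq> 0"
                by (rule lookup_single_mult_nonzeroE)
              show ?thesis unfolding t(1) mu add.commute[of u]
                by (rule add_right_mono[OF Max_keys_ge[OF t(2)]])
            qed
            with ne show ?thesis by simp
          qed
          have "Max (keys q) < ?m" by (rule q_le[OF Max_keys[OF q0]])
          then have "{s. int (mono_deg s) = j \<and> s \<le> Max (keys q)} \<subseteq> {s. int (mono_deg s) = j \<and> s \<le> ?m}"
              "?m \<in> {s. int (mono_deg s) = j \<and> s \<le> ?m}" "?m \<notin> {s. int (mono_deg s) = j \<and> s \<le> Max (keys q)}"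
            using dm by auto
          then have "{s. int (mono_deg s) = j \<and> s \<le> Max (keys q)} \<subset> {s. int (mono_deg s) = j \<and> s \<le> ?m}"
            by blast
          moreover have "finite {s. int (mono_deg s) = j \<and> s \<le> ?m}"
            using \<open>finite ?D\<close> by (rule rev_finite_subset) auto
          ultimately have "N q < N p" unfolding N_def by (intro psubset_card_mono)
          then show ?thesis using less.hyps qI qj by blast
        qed
        moreover have "single u c * g \<in> R.span G"
          using g by (intro R.span_scale R.span_base)
        ultimately have "q + single u c * g \<in> R.span G" by (rule R.span_add)
        then show ?thesis by (simp add: q_def)
      qed
    qed
  qed
  have "p \<in> R.span G" if p: "p \<in> I" for p
  proof -
    obtain A where A: "finite A" "p = (\<Sum>j\<in>A. hc j p)" by (rule eq_sum_hc)
    have "(\<Sum>j\<in>A. hc j p) \<in> R.span G"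
      by (intro R.span_sum hom[OF hom_closedD[OF h p] hc_in_homog_comp])
    then show ?thesis using A(2) by simp
  qed
  moreover have "R.span G \<subseteq> I" using G(1) I by (intro R.span_minimal) (auto simp: H_def)
  ultimately have "I = R.span G" by blast
  with G show ?thesis using that by (auto simp: H_def)
qed

subsection \<open>Homogeneous submodules of a graded free module\<close>

text \<open>The grading of the direct sum of the modules R(-d r): the shift moves the coordinate
  \<open>r\<close> to degree j - d r.\<close>

definition hcv :: "(nat \<Rightarrow> int) \<Rightarrow> int \<Rightarrow> (nat \<Rightarrow> ('v, 'k::comm_ring_1) mpoly) \<Rightarrow> nat \<Rightarrow> ('v, 'k) mpoly" where
  "hcv d j w = (\<lambda>r. hc (j - d r) (w r))"

definition homog_vec :: "(nat \<Rightarrow> int) \<Rightarrow> int \<Rightarrow> (nat \<Rightarrow> ('v, 'k::comm_ring_1) mpoly) \<Rightarrow> bool" where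
  "homog_vec d j w \<longleftrightarrow> (\<forall>r. w r \<in> homog_comp (j - d r))"

lemma homog_vec_hcv [simp]: "homog_vec d j (hcv d j w)"
  by (simp add: homog_vec_def hcv_def)

lemma sum_fun_apply: "(\<Sum>a\<in>A. f a) r = (\<Sum>a\<in>A. f a r)"
  for f :: "'a \<Rightarrow> 'b \<Rightarrow> 'c::comm_monoid_add"
  by (induction A rule: infinite_finite_induct) auto

text \<open>Induction on the number of coordinates: the last coordinates form a homogeneous ideal;
  its generators are lifted to \<open>M\<close>, and subtracting a combination of the lifts kills
  the last coordinate.\<close>

theorem homogeneous_submodule_finitely_generated:
  fixes M :: "(nat \<Rightarrow> ('v::{finite,linorder}, 'k::field) mpoly) set" and d :: "nat \<Rightarrow> int"
  assumes "fm.subspace M" and "\<And>w j. w \<in> M \<Longrightarrow> hcv d j w \<in> M" and "\<And>w r. w \<in> M \<Longrightarrow> r \<ge> n \<Longrightarrow> w r = 0"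
  shows "\<exists>H. finite H \<and> H \<subseteq> M \<and> (\<forall>h\<in>H. \<exists>j. homog_vec d j h) \<and> M \<subseteq> fm.span H"
  using assms
proof (induction n arbitrary: M)
  case 0
  then have "M \<subseteq> {0}" by (auto simp: fun_eq_iff)
  then have "M \<subseteq> fm.span {}" by auto
  then show ?case by (intro exI[of _ "{}"]) simp
next
  case (Suc n)
  note M = Suc.prems
  let ?L = "(\<lambda>w. w n) ` M"
  have "R.subspace ?L"
  proof (rule R.subspaceI)
    show "0 \<in> ?L" using fm.subspace_0[OF M(1)] by (auto intro!: image_eqI[of _ _ 0])
  next
    fix x y assume "x \<in> ?L" "y \<in> ?L"
    then obtain v w where "v \<in> M" "w \<in> M" "x = v n" "y = w n" by auto
    then show "x + y \<in> ?L" using fm.subspace_add[OF M(1), of v w] by (auto intro!: image_eqI[of _ _ "v + w"])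
  next
    fix c x assume "x \<in> ?L"
    then obtain v where "v \<in> M" "x = v n" by auto
    then show "c * x \<in> ?L" using fm.subspace_scale[OF M(1), of v c] by (auto intro!: image_eqI[of _ _ "\<lambda>r. c * v r"])
  qed
  moreover have "hom_closed ?L"
    unfolding hom_closed_def
  proof clarify
    fix w j assume "w \<in> M"
    then have "hcv d (j + d n) w \<in> M" by (rule M(2))
    then show "hc j (w n) \<in> ?L" by (auto intro!: image_eqI[of _ _ "hcv d (j + d n) w"] simp: hcv_def)
  qed
  ultimately obtain G where G: "finite G" "G \<subseteq> ?L" "\<And>g. g \<in> G \<Longrightarrow> \<exists>j. g \<in> homog_comp j" "?L = R.span G"
    by (rule homogeneous_ideal_finitely_generated) blast
  have "\<exists>w. w \<in> M \<and> (\<exists>j. homog_vec d j w) \<and> w n = g" if gG: "g \<in> G" for g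
  proof -
    obtain v where v: "v \<in> M" "g = v n" using gG G(2) by auto
    obtain a where a: "g \<in> homog_comp a" using gG G(3) by blast
    \<comment> \<open>A suitable homogeneous component of an arbitrary preimage is still a preimage,
      so the lift can be taken homogeneous.\<close>
    have "hcv d (a + d n) v n = g" using a v by (simp add: hcv_def hc_homog)
    then show ?thesis using M(2)[OF v(1)] homog_vec_hcv by blast
  qed
  then obtain l where l: "\<And>g. g \<in> G \<Longrightarrow> l g \<in> M" "\<And>g. g \<in> G \<Longrightarrow> \<exists>j. homog_vec d j (l g)"
      "\<And>g. g \<in> G \<Longrightarrow> l g n = g"
    by metis
  let ?M = "{w \<in> M. w n = 0}"
  have "fm.subspace ?M"
    using fm.subspace_0[OF M(1)] fm.subspace_add[OF M(1)] fm.subspace_scale[OF M(1)]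
    by (intro fm.subspaceI) auto
  moreover have "hcv d j w \<in> ?M" if "w \<in> ?M" for w j
    using that M(2) by (auto simp: hcv_def)
  moreover have "w r = 0" if "w \<in> ?M" "r \<ge> n" for w r
    using that M(3)[of w r] by (cases "r = n") auto
  ultimately obtain H where H: "finite H" "H \<subseteq> ?M" "\<forall>h\<in>H. \<exists>j. homog_vec d j h" "?M \<subseteq> fm.span H"
    using Suc.IH[of ?M] by blast
  have "w \<in> fm.span (H \<union> l ` G)" if w: "w \<in> M" for w
  proof -
    have "w n \<in> R.span G" using w G(4) by blast
    then obtain q where q: "w n = (\<Sum>g\<in>G. q g * g)"
      using R.span_finite[OF G(1)] by auto
    define v where "v = (\<Sum>g\<in>G. (\<lambda>r. q g * l g r))"
    have vM: "v \<in> M" unfolding v_def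
      by (intro fm.subspace_sum[OF M(1)] fm.subspace_scale[OF M(1)] l)
    have "v n = w n" unfolding q v_def sum_fun_apply using l(3) by (intro sum.cong) auto
    then have "w - v \<in> ?M" using fm.subspace_diff[OF M(1) w vM] by simp
    then have "w - v \<in> fm.span (H \<union> l ` G)" using H(4) fm.span_mono[of H "H \<union> l ` G"] by blast
    moreover have "v \<in> fm.span (H \<union> l ` G)" unfolding v_def
      by (intro fm.span_sum fm.span_scale fm.span_base) auto
    ultimately have "(w - v) + v \<in> fm.span (H \<union> l ` G)" by (rule fm.span_add)
    then show ?thesis by simp
  qed
  then have "M \<subseteq> fm.span (H \<union> l ` G)" by (rule subsetI)
  moreover have "finite (H \<union> l ` G)" using G(1) H(1) by simp
  moreover have "H \<union> l ` G \<subseteq> M" using H(2) l(1) by blast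
  moreover have "\<forall>h\<in>H \<union> l ` G. \<exists>j. homog_vec d j h" using H(3) l(2) by (simp add: ball_Un)
  ultimately show ?case by (intro exI[of _ "H \<union> l ` G"] conjI)
qed

lemma hcv_sum_scaled:
  fixes h :: "'a \<Rightarrow> nat \<Rightarrow> ('v::finite, 'k::comm_ring_1) mpoly"
  assumes "\<And>a. a \<in> A \<Longrightarrow> homog_vec d (\<delta> a) (h a)"
  shows "hcv d j (\<lambda>r. \<Sum>a\<in>A. p a * h a r) = (\<lambda>r. \<Sum>a\<in>A. hc (j - \<delta> a) (p a) * h a r)"
proof (rule ext)
  fix r
  have "hc (j - d r) (p a * h a r) = hc (j - \<delta> a) (p a) * h a r" if "a \<in> A" for a
  proof -
    have "h a r \<in> homog_comp (\<delta> a - d r)" using assms[OF that] by (simp only: homog_vec_def)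
    from hc_mult'[OF this, of "j - d r" "p a"] show ?thesis by simp
  qed
  then show "hcv d j (\<lambda>r. \<Sum>a\<in>A. p a * h a r) r = (\<Sum>a\<in>A. hc (j - \<delta> a) (p a) * h a r)"
    by (simp add: hcv_def hc_sum)
qed

text \<open>Graded Nakayama: among homogeneous generating sets take one of least size; a relation in
  which some coefficient has a nonzero constant term would make that generator redundant. The last
  conclusion later becomes minimality of the resolution.\<close>

theorem homogeneous_submodule_minimal_generators:
  fixes M :: "(nat \<Rightarrow> ('v::{finite,linorder}, 'k::field) mpoly) set" and d :: "nat \<Rightarrow> int"
  assumes "fm.subspace M" and "\<And>w j. w \<in> M \<Longrightarrow> hcv d j w \<in> M" and "\<And>w r. w \<in> M \<Longrightarrow> r \<ge> n \<Longrightarrow> w r = 0"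
  obtains H where "finite H" "H \<subseteq> M" "\<And>h. h \<in> H \<Longrightarrow> \<exists>j. homog_vec d j h" "M = fm.span H"
    "\<And>p h. (\<Sum>h\<in>H. (\<lambda>r. p h * h r)) = 0 \<Longrightarrow> h \<in> H \<Longrightarrow> lookup (p h) 0 = 0"
proof -
  define P where "P H \<longleftrightarrow> finite H \<and> H \<subseteq> M \<and> (\<forall>h\<in>H. \<exists>j. homog_vec d j h) \<and> M \<subseteq> fm.span H" for H
  have "\<exists>H. P H" unfolding P_def
    by (rule homogeneous_submodule_finitely_generated[where n = n and d = d and M = M],
        rule assms(1), erule assms(2), erule (1) assms(3))
  then obtain H where H: "P H" and min: "\<And>H'. P H' \<Longrightarrow> card H \<le> card H'"
    using ex_has_least_nat[of P _ card] by blast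
  have fin: "finite H" using H by (simp add: P_def)
  obtain \<delta> where \<delta>: "\<And>h. h \<in> H \<Longrightarrow> homog_vec d (\<delta> h) h" using H unfolding P_def by metis
  have min_gen: "lookup (p g) 0 = 0" if p: "(\<Sum>h\<in>H. (\<lambda>r. p h * h r)) = 0" and g: "g \<in> H" for p g
  proof (rule ccontr)
    assume c: "lookup (p g) 0 \<noteq> 0"
    \<comment> \<open>The component of the relation in the degree of \<open>g\<close>: there the
      coefficient of \<open>g\<close> is its constant term, a scalar that can be inverted.\<close>
    define q where "q h = hc (\<delta> g - \<delta> h) (p h)" for h
    have "(\<lambda>r. \<Sum>h\<in>H. p h * h r) = 0" using p by (auto simp: fun_eq_iff sum_fun_apply)
    then have "(\<lambda>r. \<Sum>h\<in>H. q h * h r) = hcv d (\<delta> g) 0"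
      using hcv_sum_scaled[of H d \<delta> "\<lambda>h. h" "\<delta> g" p] \<delta> by (simp add: q_def)
    then have z: "(\<Sum>h\<in>H. q h * h r) = 0" for r by (simp add: hcv_def fun_eq_iff)
    define c' where "c' = inverse (lookup (p g) 0)"
    have qg: "q g = cst (lookup (p g) 0)" by (simp add: q_def hc_0_eq)
    have "cst c' * q g = 1" unfolding qg cst_mult[symmetric] c'_def using c by simp
    then have 1: "g r = cst c' * (q g * g r)" for r by (simp add: mult.assoc[symmetric])
    have 2: "q g * g r = - (\<Sum>h\<in>H - {g}. q h * h r)" for r
      using z[of r] by (simp add: sum.remove[OF fin g] eq_neg_iff_add_eq_0)
    define w where "w = (\<Sum>h\<in>H - {g}. (\<lambda>r. q h * h r))"
    have "g = - (\<lambda>r. cst c' * w r)"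
    proof (rule ext)
      fix r show "g r = (- (\<lambda>r. cst c' * w r)) r"
        by (subst 1, subst 2) (simp add: w_def sum_fun_apply)
    qed
    also have "\<dots> \<in> fm.span (H - {g})" unfolding w_def
      by (intro fm.span_neg fm.span_scale fm.span_sum fm.span_base) auto
    finally have "g \<in> fm.span (H - {g})" .
    then have "H \<subseteq> fm.span (H - {g})" by (auto intro: fm.span_base)
    then have "fm.span H \<subseteq> fm.span (H - {g})" by (intro fm.span_minimal) auto
    then have "P (H - {g})" using H unfolding P_def by auto
    then have "card H \<le> card (H - {g})" by (rule min)
    then show False using card_Diff1_less[OF fin g] by simp
  qed
  have sub: "H \<subseteq> M" "M \<subseteq> fm.span H" using H by (simp_all only: P_def)
  have "fm.span H \<subseteq> M" using sub(1) assms(1) by (rule fm.span_minimal)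
  with sub(2) have "M = fm.span H" by (rule subset_antisym)
  show ?thesis
  proof (rule that)
    show "finite H" "H \<subseteq> M" "M = fm.span H" by fact+
    show "\<exists>j. homog_vec d j h" if "h \<in> H" for h using \<delta>[OF that] by (rule exI)
    show "lookup (p h) 0 = 0" if "(\<Sum>h\<in>H. (\<lambda>r. p h * h r)) = 0" "h \<in> H" for p h
      using that by (rule min_gen)
  qed
qed

subsection \<open>Existence of minimal graded free resolutions\<close>

text \<open>Extension by 0, the bridge from the vectors of a resolution to the functions on
  \<open>nat\<close> above.\<close>

definition fun_of_vec :: "'a::zero vec \<Rightarrow> nat \<Rightarrow> 'a" where
  "fun_of_vec v = (\<lambda>r. if r < dim_vec v then v $ r else 0)"

lemma fun_of_vec_ge: "v \<in> carrier_vec n \<Longrightarrow> r \<ge> n \<Longrightarrow> fun_of_vec v r = 0"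
  by (simp add: fun_of_vec_def)

lemma fun_of_vec_less: "v \<in> carrier_vec n \<Longrightarrow> r < n \<Longrightarrow> fun_of_vec v r = v $ r"
  by (simp add: fun_of_vec_def)

lemma fun_of_vec_vec: "(\<And>r. r \<ge> n \<Longrightarrow> w r = 0) \<Longrightarrow> fun_of_vec (vec n w) = w"
  by (auto simp: fun_of_vec_def fun_eq_iff)

lemma fun_of_vec_inj: "v \<in> carrier_vec n \<Longrightarrow> w \<in> carrier_vec n \<Longrightarrow> fun_of_vec v = fun_of_vec w \<Longrightarrow> v = w"
  by (rule eq_vecI) (auto simp: fun_of_vec_less[symmetric])

lemma mult_mat_vec_index:
  fixes A :: "'a::comm_ring_1 mat"
  assumes "A \<in> carrier_mat n m" "w \<in> carrier_vec m" "r < n"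
  shows "(A *\<^sub>v w) $ r = (\<Sum>c<m. A $$ (r, c) * w $ c)"
  using assms by (auto simp: scalar_prod_def atLeast0LessThan intro!: sum.cong)

lemma mult_mat_unit_vec_index:
  fixes A :: "'a::comm_ring_1 mat"
  assumes "A \<in> carrier_mat n m" "r < n" "c < m"
  shows "(A *\<^sub>v unit_vec m c) $ r = A $$ (r, c)"
proof -
  have "(A *\<^sub>v unit_vec m c) $ r = (\<Sum>k<m. A $$ (r, k) * unit_vec m c $ k)"
    using assms by (intro mult_mat_vec_index) auto
  also have "\<dots> = (\<Sum>k<m. if k = c then A $$ (r, k) else 0)"
    using assms(3) by (intro sum.cong) auto
  finally show ?thesis using assms(3) by simp
qed

lemma mult_mat_vec_eq_iff:
  fixes A :: "'a::comm_ring_1 mat"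
  assumes "A \<in> carrier_mat n m" "w \<in> carrier_vec m" "v \<in> carrier_vec n"
  shows "v = A *\<^sub>v w \<longleftrightarrow> (\<forall>r<n. v $ r = (\<Sum>c<m. A $$ (r, c) * w $ c))"
proof
  assume "v = A *\<^sub>v w"
  then show "\<forall>r<n. v $ r = (\<Sum>c<m. A $$ (r, c) * w $ c)"
    using mult_mat_vec_index[OF assms(1,2)] by simp
next
  assume "\<forall>r<n. v $ r = (\<Sum>c<m. A $$ (r, c) * w $ c)"
  then show "v = A *\<^sub>v w"
    using mult_mat_vec_index[OF assms(1,2)] assms by (intro eq_vecI) auto
qed

lemma mat_kernel_iff:
  fixes A :: "'a::comm_ring_1 mat"
  assumes "A \<in> carrier_mat n m"
  shows "w \<in> mat_kernel A \<longleftrightarrow> w \<in> carrier_vec m \<and> (\<forall>r<n. (\<Sum>c<m. A $$ (r, c) * w $ c) = 0)"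
proof (cases "w \<in> carrier_vec m")
  case True
  have "0\<^sub>v n = A *\<^sub>v w \<longleftrightarrow> (\<forall>r<n. 0 = (\<Sum>c<m. A $$ (r, c) * w $ c))"
    using mult_mat_vec_eq_iff[OF assms True, of "0\<^sub>v n"] by simp
  then show ?thesis using True unfolding mat_kernel[OF assms] by (metis (lifting) mem_Collect_eq)
qed (simp add: mat_kernel[OF assms])

definition graded_submodule :: "int list \<Rightarrow> (nat \<Rightarrow> ('v, 'k::comm_ring_1) mpoly) set \<Rightarrow> bool" where
  "graded_submodule ds N \<longleftrightarrow> fm.subspace N \<and> (\<forall>w\<in>N. \<forall>j. hcv ((!) ds) j w \<in> N) \<and>
     (\<forall>w\<in>N. \<forall>r\<ge>length ds. w r = 0)"

definition graded_mat :: "int list \<Rightarrow> int list \<Rightarrow> ('v, 'k::comm_ring_1) mpoly mat \<Rightarrow> bool" where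
  "graded_mat ds ds' A \<longleftrightarrow> A \<in> carrier_mat (length ds) (length ds') \<and>
     (\<forall>r<length ds. \<forall>c<length ds'. A $$ (r, c) \<in> homog_comp (ds' ! c - ds ! r))"

text \<open>The columns of the next differential lie in this kernel, so a condition on the kernel of
  one map is the minimality condition for the following one.\<close>

definition minimal_kernel :: "('v, 'k::comm_ring_1) mpoly mat \<Rightarrow> bool" where
  "minimal_kernel A \<longleftrightarrow> (\<forall>w\<in>mat_kernel A. \<forall>c<dim_vec w. lookup (w $ c) 0 = 0)"

text \<open>The degrees of the entries make the matrix a map of degree 0, which commutes with taking
  homogeneous components.\<close>

lemma graded_submodule_mat_kernel:
  fixes A :: "('v::finite, 'k::comm_ring_1) mpoly mat"
  assumes "graded_mat ds ds' A"
  shows "graded_submodule ds' (fun_of_vec ` mat_kernel A)"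
proof -
  let ?n = "length ds" and ?m = "length ds'"
  define K where "K = {u. (\<forall>c\<ge>?m. u c = 0) \<and> (\<forall>r<?n. (\<Sum>c<?m. A $$ (r, c) * u c) = 0)}"
  have A: "A \<in> carrier_mat ?n ?m" using assms by (simp add: graded_mat_def)
  have "u \<in> fun_of_vec ` mat_kernel A" if "u \<in> K" for u
  proof (rule image_eqI)
    show "u = fun_of_vec (vec ?m u)"
      using that by (subst fun_of_vec_vec) (auto simp: K_def)
    have "(\<Sum>c<?m. A $$ (r, c) * vec ?m u $ c) = (\<Sum>c<?m. A $$ (r, c) * u c)" for r
      by (intro sum.cong) auto
    then show "vec ?m u \<in> mat_kernel A"
      using that unfolding mat_kernel_iff[OF A] K_def by simp
  qed
  moreover have "fun_of_vec w \<in> K" if "w \<in> mat_kernel A" for w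
  proof -
    have w: "w \<in> carrier_vec ?m" "\<forall>r<?n. (\<Sum>c<?m. A $$ (r, c) * w $ c) = 0"
      using that unfolding mat_kernel_iff[OF A] by auto
    have "(\<Sum>c<?m. A $$ (r, c) * fun_of_vec w c) = (\<Sum>c<?m. A $$ (r, c) * w $ c)" for r
      using w(1) by (intro sum.cong) (auto simp: fun_of_vec_less)
    then show ?thesis using w by (auto simp: K_def fun_of_vec_ge)
  qed
  ultimately have K: "fun_of_vec ` mat_kernel A = K" by blast
  have "fm.subspace K"
  proof (rule fm.subspaceI)
    show "0 \<in> K" by (simp add: K_def)
  next
    fix x y assume "x \<in> K" "y \<in> K"
    then show "x + y \<in> K" by (simp add: K_def distrib_left sum.distrib)
  next
    fix p x assume x: "x \<in> K"
    have *: "(\<Sum>c<?m. A $$ (r, c) * (p * x c)) = p * (\<Sum>c<?m. A $$ (r, c) * x c)" for r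
      unfolding sum_distrib_left by (intro sum.cong refl) (rule mult.left_commute)
    show "(\<lambda>r. p * x r) \<in> K"
      using x unfolding K_def by (auto simp only: * mem_Collect_eq mult_zero_right)
  qed
  moreover have "hcv ((!) ds') j u \<in> K" if u: "u \<in> K" for u j
  proof -
    have "(\<Sum>c<?m. A $$ (r, c) * hc (j - ds' ! c) (u c)) = 0" if r: "r < ?n" for r
    proof -
      have "A $$ (r, c) * hc (j - ds' ! c) (u c) = hc (j - ds ! r) (A $$ (r, c) * u c)" if "c < ?m" for c
      proof -
        have "A $$ (r, c) \<in> homog_comp (ds' ! c - ds ! r)"
          using assms r that by (simp add: graded_mat_def)
        from hc_mult[OF this, of "j - ds ! r" "u c"] show ?thesis by simp
      qed
      then have "(\<Sum>c<?m. A $$ (r, c) * hc (j - ds' ! c) (u c)) = hc (j - ds ! r) (\<Sum>c<?m. A $$ (r, c) * u c)"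
        by (simp add: hc_sum)
      also have "\<dots> = 0" using u r by (simp add: K_def)
      finally show ?thesis .
    qed
    then show ?thesis using u by (simp add: K_def hcv_def)
  qed
  moreover have "u r = 0" if "u \<in> K" "r \<ge> ?m" for u r using that by (simp add: K_def)
  ultimately show ?thesis unfolding graded_submodule_def K by blast
qed

text \<open>One step of a resolution: minimal generators of \<open>N\<close> become the columns, and
  their degrees the new shifts.\<close>

lemma minimal_cover_exists:
  fixes N :: "(nat \<Rightarrow> ('v::{finite,linorder}, 'k::field) mpoly) set"
  assumes N: "graded_submodule ds N"
  shows "\<exists>ds' A. graded_mat ds ds' A \<and> minimal_kernel A \<and>
    {v \<in> carrier_vec (length ds). fun_of_vec v \<in> N} = (\<lambda>w. A *\<^sub>v w) ` carrier_vec (length ds')"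
proof -
  let ?n = "length ds"
  obtain H where H: "finite H" "H \<subseteq> N" "\<And>h. h \<in> H \<Longrightarrow> \<exists>j. homog_vec ((!) ds) j h" "N = fm.span H"
    "\<And>p h. (\<Sum>h\<in>H. (\<lambda>r. p h * h r)) = 0 \<Longrightarrow> h \<in> H \<Longrightarrow> lookup (p h) 0 = 0"
  proof (rule homogeneous_submodule_minimal_generators[of N "(!) ds" ?n])
    show "fm.subspace N" using N by (simp add: graded_submodule_def)
    show "hcv ((!) ds) j w \<in> N" if "w \<in> N" for w j using N that by (simp add: graded_submodule_def)
    show "w r = 0" if "w \<in> N" "r \<ge> ?n" for w r using N that by (simp add: graded_submodule_def)
  qed blast
  obtain \<delta> where \<delta>: "\<And>h. h \<in> H \<Longrightarrow> homog_vec ((!) ds) (\<delta> h) h" using H(3) by metis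
  obtain hs where hs: "set hs = H" "distinct hs" using finite_distinct_list[OF H(1)] by blast
  define ds' where "ds' = map \<delta> hs"
  let ?m = "length ds'"
  have m: "?m = length hs" by (simp add: ds'_def)
  have bij: "bij_betw ((!) hs) {..<?m} H" using bij_betw_nth[OF hs(2), of "{..<?m}" H] hs(1) m by simp
  define A where "A = mat ?n ?m (\<lambda>(r, c). (hs ! c) r)"
  have A: "A \<in> carrier_mat ?n ?m" by (simp add: A_def)
  have Arc: "A $$ (r, c) = (hs ! c) r" if "r < ?n" "c < ?m" for r c using that by (simp add: A_def)
  have hsH: "hs ! c \<in> H" if "c < ?m" for c using that hs(1) m by auto
  have hN: "h r = 0" if "h \<in> N" "r \<ge> ?n" for h r using that N by (simp add: graded_submodule_def)
  have sum_H: "(\<Sum>h\<in>H. p h * h r) = (\<Sum>c<?m. p (hs ! c) * (hs ! c) r)" for p r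
    using sum.reindex_bij_betw[OF bij, of "\<lambda>h. p h * h r"] by simp
  have "A $$ (r, c) \<in> homog_comp (ds' ! c - ds ! r)" if "r < ?n" "c < ?m" for r c
    using \<delta>[OF hsH[OF that(2)]] that m by (simp add: Arc homog_vec_def ds'_def)
  then have "graded_mat ds ds' A" using A by (simp add: graded_mat_def)
  moreover have "minimal_kernel A"
    unfolding minimal_kernel_def
  proof (intro ballI allI impI)
    fix w c assume w: "w \<in> mat_kernel A" and "c < dim_vec w"
    have w': "w \<in> carrier_vec ?m" "\<forall>r<?n. (\<Sum>c<?m. A $$ (r, c) * w $ c) = 0"
      using w unfolding mat_kernel_iff[OF A] by auto
    with \<open>c < dim_vec w\<close> have c: "c < ?m" by simp
    define p where "p h = w $ (inv_into {..<?m} ((!) hs) h)" for h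
    have p: "p (hs ! c) = w $ c" if "c < ?m" for c
      using bij_betw_inv_into_left[OF bij, of c] that by (simp add: p_def)
    have "(\<Sum>h\<in>H. (\<lambda>r. p h * h r)) = 0"
    proof (rule ext)
      fix r
      have "(\<Sum>h\<in>H. p h * h r) = 0"
      proof (cases "r < ?n")
        case True
        have "(\<Sum>h\<in>H. p h * h r) = (\<Sum>c<?m. A $$ (r, c) * w $ c)"
          unfolding sum_H using True by (intro sum.cong) (auto simp: p Arc mult.commute)
        then show ?thesis using w'(2) True by simp
      next
        case False
        then have "h r = 0" if "h \<in> H" for h using that H(2) hN[of h r] by auto
        then show ?thesis by (intro sum.neutral) simp
      qed
      then show "(\<Sum>h\<in>H. (\<lambda>r. p h * h r)) r = 0 r" by (simp add: sum_fun_apply)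
    qed
    from H(5)[OF this hsH[OF c]] show "lookup (w $ c) 0 = 0" by (simp add: p[OF c])
  qed
  moreover have "{v \<in> carrier_vec ?n. fun_of_vec v \<in> N} = (\<lambda>w. A *\<^sub>v w) ` carrier_vec ?m"
  proof (intro equalityI subsetI)
    fix v assume "v \<in> {v \<in> carrier_vec ?n. fun_of_vec v \<in> N}"
    then have v: "v \<in> carrier_vec ?n" "fun_of_vec v \<in> fm.span H" using H(4) by auto
    then obtain p where p: "fun_of_vec v = (\<Sum>h\<in>H. (\<lambda>r. p h * h r))"
      using fm.span_finite[OF H(1)] by auto
    have "v $ r = (\<Sum>c<?m. A $$ (r, c) * vec ?m (\<lambda>c. p (hs ! c)) $ c)" if r: "r < ?n" for r
    proof -
      have "v $ r = (\<Sum>h\<in>H. p h * h r)"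
        using fun_of_vec_less[OF v(1) r] p by (simp add: sum_fun_apply)
      also have "\<dots> = (\<Sum>c<?m. A $$ (r, c) * vec ?m (\<lambda>c. p (hs ! c)) $ c)"
        unfolding sum_H using r by (intro sum.cong) (auto simp: Arc mult.commute)
      finally show ?thesis .
    qed
    then have "v = A *\<^sub>v vec ?m (\<lambda>c. p (hs ! c))"
      using mult_mat_vec_eq_iff[OF A _ v(1), of "vec ?m (\<lambda>c. p (hs ! c))"] by simp
    then show "v \<in> (\<lambda>w. A *\<^sub>v w) ` carrier_vec ?m" by (rule image_eqI) simp
  next
    fix v assume "v \<in> (\<lambda>w. A *\<^sub>v w) ` carrier_vec ?m"
    then obtain w where w: "w \<in> carrier_vec ?m" "v = A *\<^sub>v w" by auto
    have v: "v \<in> carrier_vec ?n" using w A by simp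
    have "fun_of_vec v = (\<Sum>c<?m. (\<lambda>r. w $ c * (hs ! c) r))"
    proof (rule ext)
      fix r
      show "fun_of_vec v r = (\<Sum>c<?m. (\<lambda>r. w $ c * (hs ! c) r)) r"
      proof (cases "r < ?n")
        case True
        have "(\<Sum>c<?m. A $$ (r, c) * w $ c) = (\<Sum>c<?m. w $ c * (hs ! c) r)"
          using True by (intro sum.cong) (auto simp: Arc mult.commute)
        then show ?thesis
          using fun_of_vec_less[OF v True] mult_mat_vec_index[OF A w(1) True] w(2) by (simp add: sum_fun_apply)
      next
        case False
        then have "(hs ! c) r = 0" if "c < ?m" for c using hsH[OF that] H(2) hN[of "hs ! c" r] by auto
        then have "(\<Sum>c<?m. w $ c * (hs ! c) r) = 0" by (intro sum.neutral) simp
        then show ?thesis using False fun_of_vec_ge[OF v, of r] by (simp add: sum_fun_apply)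
      qed
    qed
    also have "\<dots> \<in> fm.span H"
      by (intro fm.span_sum fm.span_scale fm.span_base hsH) simp
    finally show "v \<in> {v \<in> carrier_vec ?n. fun_of_vec v \<in> N}" using v H(4) by simp
  qed
  ultimately show ?thesis by blast
qed

theorem minimal_graded_free_resolution_exists:
  fixes I :: "('v::{finite,linorder}, 'k::field) mpoly set"
  assumes I: "R.subspace I" and hom: "hom_closed I"
  shows "\<exists>d A g. minimal_graded_free_resolution (*) I (\<lambda>k. I \<inter> homog_comp k) d A g"
proof -
  define P :: "int list \<times> ('v, 'k) mpoly mat \<Rightarrow> bool" where
    "P x \<longleftrightarrow> minimal_kernel (snd x) \<and> (\<exists>ds. graded_mat ds (fst x) (snd x))" for x
  define Q :: "int list \<times> ('v, 'k) mpoly mat \<Rightarrow> int list \<times> ('v, 'k) mpoly mat \<Rightarrow> bool" where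
    "Q x y \<longleftrightarrow> graded_mat (fst x) (fst y) (snd y) \<and>
       mat_kernel (snd x) = (\<lambda>w. snd y *\<^sub>v w) ` carrier_vec (length (fst y))" for x y
  \<comment> \<open>The ideal as a submodule of the free module of rank 1, so that the augmentation
    comes from the same covering lemma as the differentials.\<close>
  define I1 where "I1 = {w :: nat \<Rightarrow> ('v, 'k) mpoly. w 0 \<in> I \<and> (\<forall>r\<ge>1. w r = 0)}"
  have "fm.subspace I1"
  proof (rule fm.subspaceI)
    show "0 \<in> I1" using R.subspace_0[OF I] by (simp add: I1_def)
    show "x + y \<in> I1" if "x \<in> I1" "y \<in> I1" for x y
      using that R.subspace_add[OF I] by (simp add: I1_def)
    show "(\<lambda>r. c * x r) \<in> I1" if "x \<in> I1" for c x
      using that R.subspace_scale[OF I] by (simp add: I1_def)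
  qed
  then have "graded_submodule [0] I1"
    using hom_closedD[OF hom] by (auto simp: graded_submodule_def I1_def hcv_def)
  from minimal_cover_exists[OF this] obtain ds0 A0 where
    0: "graded_mat [0] ds0 A0" "minimal_kernel A0"
       "{v \<in> carrier_vec 1. fun_of_vec v \<in> I1} = (\<lambda>w. A0 *\<^sub>v w) ` carrier_vec (length ds0)"
    by auto
  have A0: "A0 \<in> carrier_mat 1 (length ds0)" using 0(1) by (simp add: graded_mat_def)
  \<comment> \<open>A state is a list of shifts with the matrix into the preceding module. The
    clause for n = 0 pins the start of the dependent choice to the cover of the ideal.\<close>
  have "\<exists>f. \<forall>n. (P (f n) \<and> (n = 0 \<longrightarrow> f n = (ds0, A0))) \<and> Q (f n) (f (Suc n))"
  proof (rule dependent_nat_choice)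
    show "\<exists>x. P x \<and> (0 = 0 \<longrightarrow> x = (ds0, A0))" using 0 by (auto simp: P_def)
  next
    fix x :: "int list \<times> ('v, 'k) mpoly mat" and n :: nat
    assume "P x \<and> (n = 0 \<longrightarrow> x = (ds0, A0))"
    then obtain ds where ds: "graded_mat ds (fst x) (snd x)" by (auto simp: P_def)
    from minimal_cover_exists[OF graded_submodule_mat_kernel[OF ds]] obtain ds' A where
      A: "graded_mat (fst x) ds' A" "minimal_kernel A"
         "{v \<in> carrier_vec (length (fst x)). fun_of_vec v \<in> fun_of_vec ` mat_kernel (snd x)} =
          (\<lambda>w. A *\<^sub>v w) ` carrier_vec (length ds')" by blast
    have "mat_kernel (snd x) \<subseteq> carrier_vec (length (fst x))"
      using ds by (intro mat_kernel_carrier[of _ "length ds"]) (simp add: graded_mat_def)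
    then have "{v \<in> carrier_vec (length (fst x)). fun_of_vec v \<in> fun_of_vec ` mat_kernel (snd x)} = mat_kernel (snd x)"
      using fun_of_vec_inj by blast
    then have "Q x (ds', A)" using A by (simp add: Q_def)
    moreover have "P (ds', A)" using A by (auto simp: P_def)
    ultimately show "\<exists>y. (P y \<and> (Suc n = 0 \<longrightarrow> y = (ds0, A0))) \<and> Q x y" by auto
  qed
  then obtain f where f: "\<And>n. P (f n)" "f 0 = (ds0, A0)" "\<And>n. Q (f n) (f (Suc n))" by blast
  define d where "d i = fst (f i)" for i
  \<comment> \<open>Off by one: the matrix stored in state 0 is the augmentation, so
    \<open>A i\<close> is stored in state \<open>Suc i\<close>.\<close>
  define A where "A i = snd (f (Suc i))" for i
  define g where "g c = A0 $$ (0, c)" for c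
  have d0: "d 0 = ds0" by (simp add: d_def f(2))
  have gm: "graded_mat (d i) (d (Suc i)) (A i)" for i using f(3)[of i] by (simp add: Q_def d_def A_def)
  have AC: "A i \<in> carrier_mat (length (d i)) (length (d (Suc i)))" for i using gm by (simp add: graded_mat_def)
  have ker: "mat_kernel (A i) = (\<lambda>w. A (Suc i) *\<^sub>v w) ` carrier_vec (length (d (Suc (Suc i))))" for i
    using f(3)[of "Suc i"] by (simp add: Q_def d_def A_def)
  have ker0: "mat_kernel A0 = (\<lambda>w. A 0 *\<^sub>v w) ` carrier_vec (length (d (Suc 0)))"
    using f(3)[of 0] f(2) by (simp add: Q_def d_def A_def)
  have min: "minimal_kernel (A i)" for i using f(1)[of "Suc i"] by (simp add: P_def A_def)
  \<comment> \<open>An entry is a coordinate of the image of a unit vector, and that image lies in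
    the kernel of a map with \<open>minimal_kernel\<close>.\<close>
  have const: "lookup (B $$ (r, c)) 0 = 0"
    if B: "B \<in> carrier_mat n (length (d j))" "(\<lambda>w. B *\<^sub>v w) ` carrier_vec (length (d j)) = mat_kernel C" "minimal_kernel C"
       "r < n" "c < length (d j)" for B C n j r c
  proof -
    have "B *\<^sub>v unit_vec (length (d j)) c \<in> mat_kernel C" unfolding B(2)[symmetric] by (intro imageI) simp
    moreover have "r < dim_vec (B *\<^sub>v unit_vec (length (d j)) c)" using B(1,4) by simp
    ultimately have "lookup ((B *\<^sub>v unit_vec (length (d j)) c) $ r) 0 = 0"
      using B(3) unfolding minimal_kernel_def by blast
    then show ?thesis using mult_mat_unit_vec_index[OF B(1,4,5)] by simp
  qed
  have aug: "(\<Sum>c<length (d 0). v $ c * g c) = (A0 *\<^sub>v v) $ 0" if "v \<in> carrier_vec (length (d 0))" for v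
    using mult_mat_vec_index[OF A0, of v 0] that by (simp add: g_def d0 mult.commute)
  have img: "p \<in> I \<longleftrightarrow> (\<exists>v\<in>carrier_vec (length ds0). p = (A0 *\<^sub>v v) $ 0)" for p
  proof
    assume "p \<in> I"
    then have "vec 1 (\<lambda>_. p) \<in> {v \<in> carrier_vec 1. fun_of_vec v \<in> I1}"
      by (auto simp: I1_def fun_of_vec_def)
    then obtain v where "v \<in> carrier_vec (length ds0)" "vec 1 (\<lambda>_. p) = A0 *\<^sub>v v"
      unfolding 0(3) by (elim imageE)
    moreover have "p = vec 1 (\<lambda>_. p) $ 0" by simp
    ultimately show "\<exists>v\<in>carrier_vec (length ds0). p = (A0 *\<^sub>v v) $ 0" by (intro bexI[of _ v]) simp_all
  next
    assume "\<exists>v\<in>carrier_vec (length ds0). p = (A0 *\<^sub>v v) $ 0"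
    then obtain v where v: "v \<in> carrier_vec (length ds0)" "p = (A0 *\<^sub>v v) $ 0" by blast
    then have *: "A0 *\<^sub>v v \<in> {v \<in> carrier_vec 1. fun_of_vec v \<in> I1}" unfolding 0(3) by simp
    then have "fun_of_vec (A0 *\<^sub>v v) 0 \<in> I" by (simp add: I1_def)
    then show "p \<in> I" using v * fun_of_vec_less[of "A0 *\<^sub>v v" 1 0] by simp
  qed
  have "minimal_graded_free_resolution (*) I (\<lambda>k. I \<inter> homog_comp k) d A g"
    unfolding minimal_graded_free_resolution_def Let_def
  proof (intro conjI allI impI)
    fix c assume c: "c < length (d 0)"
    have "g c = (A0 *\<^sub>v unit_vec (length ds0) c) $ 0"
      using mult_mat_unit_vec_index[OF A0, of 0 c] c by (simp add: g_def d0)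
    then have "g c \<in> I" unfolding img by (intro bexI) auto
    moreover have "g c \<in> homog_comp (d 0 ! c)" using 0(1) c by (simp add: graded_mat_def g_def d0)
    ultimately show "g c \<in> I \<inter> homog_comp (d 0 ! c)" by simp
  next
    show "A i \<in> carrier_mat (length (d i)) (length (d (Suc i)))" for i by (rule AC)
    show "A i $$ (r, c) \<in> homog_comp (d (Suc i) ! c - d i ! r)"
      if "r < length (d i)" "c < length (d (Suc i))" for i r c
      using gm[of i] that by (simp add: graded_mat_def)
    show "mat_kernel (A i) = (\<lambda>w. A (Suc i) *\<^sub>v w) ` carrier_vec (length (d (Suc (Suc i))))" for i
      by (rule ker)
  next
    have "(\<lambda>v. \<Sum>c<length (d 0). v $ c * g c) ` carrier_vec (length (d 0)) = (\<lambda>v. (A0 *\<^sub>v v) $ 0) ` carrier_vec (length (d 0))"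
      using aug by (intro image_cong) auto
    also have "\<dots> = I" using img by (auto simp: d0)
    finally show "(\<lambda>v. \<Sum>c<length (d 0). v $ c * g c) ` carrier_vec (length (d 0)) = I" .
  next
    have "v \<in> mat_kernel A0 \<longleftrightarrow> v \<in> carrier_vec (length (d 0)) \<and> (\<Sum>c<length (d 0). v $ c * g c) = 0" for v
      unfolding mat_kernel_iff[OF A0] by (auto simp: g_def d0 mult.commute)
    then have "{v \<in> carrier_vec (length (d 0)). (\<Sum>c<length (d 0). v $ c * g c) = 0} = mat_kernel A0"
      by auto
    then show "{v \<in> carrier_vec (length (d 0)). (\<Sum>c<length (d 0). v $ c * g c) = 0} =
        (\<lambda>w. A 0 *\<^sub>v w) ` carrier_vec (length (d 1))"
      using ker0 by simp
  next
    fix i r c assume "r < length (d i)" "c < length (d (Suc i))"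
    then show "lookup (A i $$ (r, c)) 0 = 0"
    proof (cases i)
      case 0
      then show ?thesis
        using const[OF AC[of 0] ker0[symmetric] \<open>minimal_kernel A0\<close>] \<open>r < length (d i)\<close> \<open>c < length (d (Suc i))\<close> by simp
    next
      case (Suc k)
      then show ?thesis
        using const[OF AC[of "Suc k"] ker[symmetric] min] \<open>r < length (d i)\<close> \<open>c < length (d (Suc i))\<close> by simp
    qed
  qed
  then show ?thesis by blast
qed

subsection \<open>The linear strand\<close>

text \<open>Gaussian elimination, one equation at a time. It replaces dimension theory in the count
  of generators.\<close>

lemma nontrivial_solution:
  fixes M :: "'p \<Rightarrow> 'q \<Rightarrow> 'k::field"
  assumes "finite Q" "finite P" "card Q < card P"
  shows "\<exists>a. (\<exists>p\<in>P. a p \<noteq> 0) \<and> (\<forall>q\<in>Q. (\<Sum>p\<in>P. a p * M p q) = 0)"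
  using assms
proof (induction Q arbitrary: P M rule: finite_induct)
  case empty
  then obtain p where "p \<in> P" by fastforce
  then show ?case by (intro exI[of _ "\<lambda>_. 1"]) auto
next
  case (insert q Q)
  show ?case
  proof (cases "\<forall>p\<in>P. M p q = 0")
    case True
    have "card Q < card P" using insert by simp
    then obtain a where "\<exists>p\<in>P. a p \<noteq> 0" "\<forall>q\<in>Q. (\<Sum>p\<in>P. a p * M p q) = 0"
      using insert.IH[OF insert.prems(1), of M] by blast
    with True show ?thesis by (intro exI[of _ a]) simp
  next
    case False
    then obtain p0 where p0: "p0 \<in> P" "M p0 q \<noteq> 0" by blast
    let ?P = "P - {p0}"
    define M' where "M' p x = M p x - M p q / M p0 q * M p0 x" for p x
    have "card Q < card ?P" using insert p0 by simp
    then obtain a where a: "\<exists>p\<in>?P. a p \<noteq> 0" "\<forall>x\<in>Q. (\<Sum>p\<in>?P. a p * M' p x) = 0"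
      using insert.IH[of ?P M'] insert.prems(1) by auto
    \<comment> \<open>The value at the pivot \<open>p0\<close> is the one forced by the equation
      \<open>q\<close>.\<close>
    define b where "b = a(p0 := - (\<Sum>p\<in>?P. a p * M p q) / M p0 q)"
    have b: "(\<Sum>p\<in>P. b p * M p x) = (\<Sum>p\<in>?P. a p * M p x) - (\<Sum>p\<in>?P. a p * M p q) / M p0 q * M p0 x" for x
    proof -
      have "(\<Sum>p\<in>P. b p * M p x) = b p0 * M p0 x + (\<Sum>p\<in>?P. b p * M p x)"
        using sum.remove[OF insert.prems(1) p0(1)] by simp
      also have "(\<Sum>p\<in>?P. b p * M p x) = (\<Sum>p\<in>?P. a p * M p x)"
        by (intro sum.cong) (auto simp: b_def)
      finally show ?thesis by (simp add: b_def)
    qed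
    have "(\<Sum>p\<in>?P. a p * M' p x) = (\<Sum>p\<in>?P. a p * M p x) - (\<Sum>p\<in>?P. a p * M p q) / M p0 q * M p0 x" for x
      by (simp add: M'_def right_diff_distrib sum_subtractf sum_distrib_right sum_divide_distrib)
    then have "(\<Sum>p\<in>P. b p * M p x) = 0" if "x \<in> insert q Q" for x
      using that a(2) b p0(2) by auto
    moreover have "\<exists>p\<in>P. b p \<noteq> 0" using a(1) by (auto simp: b_def)
    ultimately show ?thesis by blast
  qed
qed

section \<open>Linear and quadratic forms through their coefficients\<close>

definition evar :: "'v \<Rightarrow> 'v \<Rightarrow>\<^sub>0 nat" where
  "evar v = single v 1"

lemma lookup_evar: "lookup (evar v) u = (if u = v then 1 else 0)"
  by (simp add: evar_def lookup_single when_def)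

lemma mono_deg_evar [simp]: "mono_deg (evar v) = 1"
  by (simp add: evar_def)

lemma pvar_eq: "pvar v = single (evar v) 1"
  by (simp add: pvar_def evar_def)

lemma evar_eq_iff [simp]: "evar u = evar v \<longleftrightarrow> u = v"
  by (metis lookup_evar one_neq_zero)

abbreviation lin_coeff :: "'v \<Rightarrow> ('v, 'k::comm_ring_1) mpoly \<Rightarrow> 'k" where
  "lin_coeff v p \<equiv> lookup p (evar v)"

lemma lookup_cst_pvar: "lookup (cst c * pvar v) s = (if s = evar v then c else 0)"
  by (auto simp: pvar_eq lookup_single when_def)

lemma lookup_cst_pvar_pvar:
  "lookup (cst c * (pvar u * pvar v)) s = (if evar u + evar v = s then c else 0)"
  by (auto simp: pvar_eq mult_single lookup_single when_def)

lemma lin_coeff_lin: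
  "lin_coeff u (\<Sum>v\<in>UNIV. cst (a v) * pvar (v::'v::finite)) = a u"
  unfolding lookup_sum lookup_cst_pvar by simp

lemma linear_form_eq:
  fixes p :: "('v::finite, 'k::comm_ring_1) mpoly"
  assumes "p \<in> homog_comp 1"
  shows "p = (\<Sum>v\<in>UNIV. cst (lin_coeff v p) * pvar v)"
proof (rule poly_mapping_eqI)
  fix s
  let ?q = "\<Sum>v\<in>UNIV. cst (lin_coeff v p) * pvar v"
  have q: "?q \<in> homog_comp 1"
    using homog_comp_mult[OF cst_in_homog_comp pvar_in_homog_comp] by (intro homog_comp_sum) simp
  show "lookup p s = lookup ?q s"
  proof (cases "mono_deg s = 1")
    case True
    then obtain v where "s = evar v" unfolding mono_deg_eq_1_iff evar_def ..
    then show ?thesis by (simp only: lin_coeff_lin)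
  next
    case False
    then have "lookup p s = 0" "lookup ?q s = 0"
      using homog_compD[OF assms, of s] homog_compD[OF q, of s] by fastforce+
    then show ?thesis by simp
  qed
qed

lemma evar_add_evar_eq_iff:
  "evar u + evar v = evar a + evar b \<longleftrightarrow> (u = a \<and> v = b) \<or> (u = b \<and> v = a)" (is "?l = ?r \<longleftrightarrow> _")
proof
  assume eq: "?l = ?r"
  have "lookup ?l u \<noteq> 0" by (simp add: lookup_add lookup_evar)
  then have "lookup ?r u \<noteq> 0" by (simp only: eq) simp
  then consider "u = a" | "u = b" by (auto simp: lookup_add lookup_evar split: if_splits)
  then show "(u = a \<and> v = b) \<or> (u = b \<and> v = a)"
  proof cases
    case 1
    then show ?thesis using eq by simp
  next
    case 2
    then show ?thesis using eq by (simp add: add.commute[of "evar a"])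
  qed
qed (auto simp: add.commute)

text \<open>The monomial of u and v collects \<open>B u v\<close> and \<open>B v u\<close> if u and
  v differ, but \<open>B u u\<close> only once. Stating the diagonal separately keeps the result
  valid in characteristic 2. This turns the vanishing of a composite of linear differentials into
  alternation.\<close>

lemma quadratic_form_eq_0_iff:
  fixes B :: "'v::finite \<Rightarrow> 'v \<Rightarrow> 'k::comm_ring_1"
  shows "(\<Sum>u\<in>UNIV. \<Sum>v\<in>UNIV. cst (B u v) * (pvar u * pvar v)) = 0 \<longleftrightarrow>
    (\<forall>u v. u \<noteq> v \<longrightarrow> B u v + B v u = 0) \<and> (\<forall>u. B u u = 0)" (is "?S = 0 \<longleftrightarrow> _")
proof -
  have lk: "lookup ?S s = (\<Sum>(u, v)\<in>{(u, v). evar u + evar v = s}. B u v)" for s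
  proof -
    have "lookup ?S s = (\<Sum>u\<in>UNIV. \<Sum>v\<in>UNIV. if evar u + evar v = s then B u v else 0)"
      unfolding lookup_sum lookup_cst_pvar_pvar by (rule refl)
    also have "\<dots> = (\<Sum>(u, v)\<in>UNIV. if evar u + evar v = s then B u v else 0)"
      by (simp only: sum.cartesian_product UNIV_Times_UNIV)
    also have "\<dots> = (\<Sum>(u, v)\<in>{(u, v). evar u + evar v = s}. B u v)"
      by (intro sum.mono_neutral_cong_right) (auto split: if_splits)
    finally show ?thesis .
  qed
  have set: "{(u, v). evar u + evar v = evar a + evar b} = {(a, b), (b, a)}" for a b :: 'v
    by (auto simp: evar_add_evar_eq_iff)
  have lk2: "lookup ?S (evar a + evar b) = (if a = b then B a a else B a b + B b a)" for a b
    unfolding lk set by auto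
  show ?thesis
  proof
    assume "?S = 0"
    then have "(if a = b then B a a else B a b + B b a) = 0" for a b using lk2[of a b] by simp
    then show "(\<forall>u v. u \<noteq> v \<longrightarrow> B u v + B v u = 0) \<and> (\<forall>u. B u u = 0)" by metis
  next
    assume B: "(\<forall>u v. u \<noteq> v \<longrightarrow> B u v + B v u = 0) \<and> (\<forall>u. B u u = 0)"
    show "?S = 0"
    proof (rule poly_mapping_eqI)
      fix s
      show "lookup ?S s = lookup 0 s"
      proof (cases "\<exists>a b. s = evar a + evar b")
        case True
        then obtain a b where "s = evar a + evar b" by blast
        then show ?thesis using lk2[of a b] B by simp
      next
        case False
        then have "{(u, v). evar u + evar v = s} = {}" by auto
        then show ?thesis unfolding lk by simp
      qed
    qed
  qed
qed

text \<open>
  \<open>strand W i\<close> is the degree \<open>D + i\<close> part of the kernel of the Koszul differential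
  \<open>\<Lambda>\<^sup>i V \<otimes> I \<rightarrow> \<Lambda>\<^sup>i\<^sup>-\<^sup>1 V \<otimes> I\<close> when \<open>W\<close> is the component of lowest degree \<open>D\<close> of \<open>I\<close>; an element
  of \<open>\<Lambda>\<^sup>i V \<otimes> W\<close> is coded as an alternating function on lists of \<open>i\<close> variables, which is \<open>0\<close> on
  lists of other lengths.
\<close>

fun strand :: "('v::finite, 'k::comm_ring_1) mpoly set \<Rightarrow> nat \<Rightarrow> ('v list \<Rightarrow> ('v, 'k) mpoly) \<Rightarrow> bool" where
  "strand W 0 z \<longleftrightarrow> z [] \<in> W \<and> (\<forall>vs. vs \<noteq> [] \<longrightarrow> z vs = 0)"
| "strand W (Suc 0) z \<longleftrightarrow> z [] = 0 \<and> (\<forall>v. strand W 0 (\<lambda>vs. z (v # vs))) \<and>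
     (\<Sum>v\<in>UNIV. pvar v * z [v]) = 0"
| "strand W (Suc (Suc i)) z \<longleftrightarrow> z [] = 0 \<and> (\<forall>v. strand W (Suc i) (\<lambda>vs. z (v # vs))) \<and>
     (\<forall>u v us. z (u # v # us) + z (v # u # us) = 0) \<and> (\<forall>u us. z (u # u # us) = 0)"

lemma strand_SucD:
  "strand W (Suc i) z \<Longrightarrow> z [] = 0" "strand W (Suc i) z \<Longrightarrow> strand W i (\<lambda>vs. z (v # vs))"
  by (cases i; simp)+

definition kspace :: "('v, 'k::comm_ring_1) mpoly set \<Rightarrow> bool" where
  "kspace W \<longleftrightarrow> 0 \<in> W \<and> (\<forall>p\<in>W. \<forall>q\<in>W. p + q \<in> W) \<and> (\<forall>c. \<forall>p\<in>W. cst c * p \<in> W)"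

text \<open>Different spaces are allowed because in \<open>strand_wedge\<close> the first summand
  starts in \<open>W\<close> and is carried to \<open>W'\<close> by the factor
  \<open>l v\<close>.\<close>

lemma strand_lin_comb2:
  fixes W :: "('v::finite, 'k::comm_ring_1) mpoly set"
  assumes W: "\<And>p q. p \<in> W \<Longrightarrow> q \<in> W' \<Longrightarrow> a * p + b * q \<in> W''"
  shows "strand W i x \<Longrightarrow> strand W' i y \<Longrightarrow> strand W'' i (\<lambda>vs. a * x vs + b * y vs)"
proof (induction i arbitrary: x y)
  case 0
  then show ?case using W by simp
next
  case (Suc i)
  note S = strand_SucD[OF Suc.prems(1)] strand_SucD[OF Suc.prems(2)]
  have comp: "strand W'' i (\<lambda>vs. a * x (v # vs) + b * y (v # vs))" for v
    by (rule Suc.IH[OF S(2) S(4)])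
  show ?case
  proof (cases i)
    case 0
    have "(\<Sum>v\<in>UNIV. pvar v * (a * x [v] + b * y [v])) =
        a * (\<Sum>v\<in>UNIV. pvar v * x [v]) + b * (\<Sum>v\<in>UNIV. pvar v * y [v])"
      unfolding sum_distrib_left sum.distrib[symmetric]
      by (intro sum.cong refl) (simp only: distrib_left mult.left_commute)
    also have "\<dots> = 0" using Suc.prems 0 by simp
    finally show ?thesis using comp S 0 by simp
  next
    case (Suc k)
    have xy: "x (u # v # us) + x (v # u # us) = 0" "y (u # v # us) + y (v # u # us) = 0"
        "x (u # u # us) = 0" "y (u # u # us) = 0" for u v us
      using Suc.prems[unfolded Suc] by simp_all
    have "a * x (u # v # us) + b * y (u # v # us) + (a * x (v # u # us) + b * y (v # u # us)) =
        a * (x (u # v # us) + x (v # u # us)) + b * (y (u # v # us) + y (v # u # us))" for u v us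
      by (simp add: distrib_left ac_simps)
    then have "a * x (u # v # us) + b * y (u # v # us) + (a * x (v # u # us) + b * y (v # u # us)) = 0" for u v us
      by (simp only: xy) simp
    then show ?thesis using comp S xy Suc by simp
  qed
qed

lemma strand_zero: "0 \<in> W \<Longrightarrow> strand W i (\<lambda>vs. 0)"
proof (induction i)
  case (Suc i)
  then show ?case by (cases i) auto
qed simp

lemma strand_sum:
  fixes W :: "('v::finite, 'k::comm_ring_1) mpoly set"
  assumes W: "kspace W" and z: "\<And>c. c \<in> C \<Longrightarrow> strand W i (z c)"
  shows "strand W i (\<lambda>vs. \<Sum>c\<in>C. cst (a c) * z c vs)"
  using z
proof (induction C rule: infinite_finite_induct)
  case (insert c C)
  then have "strand W i (\<lambda>vs. cst (a c) * z c vs + 1 * (\<Sum>c\<in>C. cst (a c) * z c vs))"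
    using W by (intro strand_lin_comb2[where W = W and W' = W]) (auto simp: kspace_def)
  then show ?case using insert.hyps by simp
qed (use W in \<open>auto simp: kspace_def intro: strand_zero\<close>)

text \<open>The resolution is arbitrary, since the definite description in
  \<open>graded_betti\<close> demands the same count from every one.\<close>

locale minimal_resolution =
  fixes I :: "('v::{finite,linorder}, 'k::field) mpoly set"
    and d :: "nat \<Rightarrow> int list" and A :: "nat \<Rightarrow> ('v, 'k) mpoly mat" and g :: "nat \<Rightarrow> ('v, 'k) mpoly"
    and D :: int
  assumes res: "minimal_graded_free_resolution (*) I (\<lambda>k. I \<inter> homog_comp k) d A g"
    and ideal: "R.subspace I"
    and low: "\<And>p j. p \<in> I \<Longrightarrow> p \<in> homog_comp j \<Longrightarrow> j < D \<Longrightarrow> p = 0"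
begin

abbreviation rk :: "nat \<Rightarrow> nat" where "rk i \<equiv> length (d i)"

text \<open>The linear strand: by \<open>d_ge\<close> below, these are the generators of the least
  degree that \<open>F i\<close> can have.\<close>

definition gens :: "nat \<Rightarrow> nat set" where
  "gens i = {r. r < rk i \<and> d i ! r = D + int i}"

abbreviation W :: "('v, 'k) mpoly set" where "W \<equiv> I \<inter> homog_comp D"

lemma finite_gens [simp]: "finite (gens i)"
  by (rule finite_subset[of _ "{..<rk i}"]) (auto simp: gens_def)

lemma gens_less: "r \<in> gens i \<Longrightarrow> r < rk i"
  by (simp add: gens_def)

lemma count_list_d: "count_list (d i) (D + int i) = card (gens i)"
  unfolding count_list_eq_length_filter gens_def length_filter_conv_card
  by (intro arg_cong[of _ _ card]) auto

lemmas resD = res[unfolded minimal_graded_free_resolution_def Let_def]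
lemmas resD' = resD[THEN conjunct2]
lemmas resD'' = resD'[THEN conjunct2, THEN conjunct2]
lemmas resD3 = resD''[THEN conjunct2, THEN conjunct2]

lemma g_in: "c < rk 0 \<Longrightarrow> g c \<in> I \<inter> homog_comp (d 0 ! c)"
  using resD[THEN conjunct1] by simp

lemma A_carrier: "A i \<in> carrier_mat (rk i) (rk (Suc i))"
  using resD'[THEN conjunct1] by simp

lemma A_homog: "r < rk i \<Longrightarrow> c < rk (Suc i) \<Longrightarrow> A i $$ (r, c) \<in> homog_comp (d (Suc i) ! c - d i ! r)"
  using resD'[THEN conjunct2, THEN conjunct1] by simp

lemma A_const: "r < rk i \<Longrightarrow> c < rk (Suc i) \<Longrightarrow> lookup (A i $$ (r, c)) 0 = 0"
  using resD3[THEN conjunct2] by simp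

lemma aug_image: "(\<lambda>v. \<Sum>c<rk 0. v $ c * g c) ` carrier_vec (rk 0) = I"
  using resD''[THEN conjunct1] by (simp only:)

lemma aug_kernel: "{v \<in> carrier_vec (rk 0). (\<Sum>c<rk 0. v $ c * g c) = 0} = (\<lambda>w. A 0 *\<^sub>v w) ` carrier_vec (rk 1)"
  using resD''[THEN conjunct2, THEN conjunct1] by (simp only:)

lemma A_kernel: "mat_kernel (A i) = (\<lambda>w. A (Suc i) *\<^sub>v w) ` carrier_vec (rk (Suc (Suc i)))"
  using resD3[THEN conjunct1] by simp

lemma aug_A: "c < rk 1 \<Longrightarrow> (\<Sum>r<rk 0. A 0 $$ (r, c) * g r) = 0"
proof -
  assume c: "c < rk 1"
  have "A 0 *\<^sub>v unit_vec (rk 1) c \<in> {v \<in> carrier_vec (rk 0). (\<Sum>c<rk 0. v $ c * g c) = 0}"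
    unfolding aug_kernel by (intro imageI) simp
  then have "(\<Sum>r<rk 0. (A 0 *\<^sub>v unit_vec (rk 1) c) $ r * g r) = 0" by simp
  moreover have "(\<Sum>r<rk 0. (A 0 *\<^sub>v unit_vec (rk 1) c) $ r * g r) = (\<Sum>r<rk 0. A 0 $$ (r, c) * g r)"
    using mult_mat_unit_vec_index[OF A_carrier[of 0]] c by (intro sum.cong) auto
  ultimately show ?thesis by simp
qed

lemma A_A: "s < rk i \<Longrightarrow> c < rk (Suc (Suc i)) \<Longrightarrow> (\<Sum>r<rk (Suc i). A i $$ (s, r) * A (Suc i) $$ (r, c)) = 0"
proof -
  assume s: "s < rk i" and c: "c < rk (Suc (Suc i))"
  have "A (Suc i) *\<^sub>v unit_vec (rk (Suc (Suc i))) c \<in> mat_kernel (A i)"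
    unfolding A_kernel by (intro imageI) simp
  then have "(\<Sum>r<rk (Suc i). A i $$ (s, r) * (A (Suc i) *\<^sub>v unit_vec (rk (Suc (Suc i))) c) $ r) = 0"
    using s unfolding mat_kernel_iff[OF A_carrier] by blast
  moreover have "(\<Sum>r<rk (Suc i). A i $$ (s, r) * (A (Suc i) *\<^sub>v unit_vec (rk (Suc (Suc i))) c) $ r) =
      (\<Sum>r<rk (Suc i). A i $$ (s, r) * A (Suc i) $$ (r, c))"
    using mult_mat_unit_vec_index[OF A_carrier[of "Suc i"]] c by (intro sum.cong) auto
  ultimately show ?thesis by simp
qed

lemma lookup_mult_0:
  fixes p q :: "('v, 'k) mpoly"
  assumes "lookup p 0 = 0"
  shows "lookup (p * q) 0 = 0"
proof (rule ccontr)
  assume "lookup (p * q) 0 \<noteq> 0"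
  then obtain a b where ab: "0 = a + b" "lookup p a \<noteq> 0" by (rule lookup_mult_nonzeroE)
  have "mono_deg (0 :: 'v \<Rightarrow>\<^sub>0 nat) = mono_deg a + mono_deg b" unfolding ab(1) by (rule mono_deg_add)
  then have "a = 0" by simp
  then show False using ab(2) assms by simp
qed

lemma image_const:
  assumes "u \<in> carrier_vec (rk (Suc i))" "r < rk i"
  shows "lookup ((A i *\<^sub>v u) $ r) 0 = 0"
  unfolding mult_mat_vec_index[OF A_carrier assms] lookup_sum
  using assms(2) by (intro sum.neutral) (simp add: lookup_mult_0 A_const)

lemma aug_kernel_const:
  assumes "v \<in> carrier_vec (rk 0)" "(\<Sum>c<rk 0. v $ c * g c) = 0" "r < rk 0"
  shows "lookup (v $ r) 0 = 0"
proof -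
  have "v \<in> (\<lambda>w. A 0 *\<^sub>v w) ` carrier_vec (rk 1)" using assms aug_kernel by blast
  then show ?thesis using image_const[of _ 0 r] assms(3) by auto
qed

lemma A_kernel_const:
  assumes "w \<in> mat_kernel (A i)" "c < rk (Suc i)"
  shows "lookup (w $ c) 0 = 0"
  using assms image_const[of _ "Suc i" c] unfolding A_kernel by auto

text \<open>Minimality puts every kernel into the vectors without constant terms, so no basis vector
  maps to 0. A nonzero entry has no constant term either, hence positive degree, and degrees rise by
  at least 1 at each step.\<close>

lemma d_ge: "r < rk i \<Longrightarrow> d i ! r \<ge> D + int i"
proof (induction i arbitrary: r)
  case 0
  show ?case
  proof (rule ccontr)
    assume "\<not> ?thesis"
    then have "g r = 0" using g_in[OF 0] low[of "g r" "d 0 ! r"] by auto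
    then have "(\<Sum>c<rk 0. unit_vec (rk 0) r $ c * g c) = 0"
      using 0 by (intro sum.neutral) auto
    then have "lookup (unit_vec (rk 0) r $ r) (0 :: 'v \<Rightarrow>\<^sub>0 nat) = (0 :: 'k)"
      using 0 by (intro aug_kernel_const) auto
    then show False using 0 by simp
  qed
next
  case (Suc i)
  have "\<exists>s<rk i. A i $$ (s, r) \<noteq> 0"
  proof (rule ccontr)
    assume "\<not> ?thesis"
    then have "(\<Sum>c<rk (Suc i). A i $$ (s, c) * unit_vec (rk (Suc i)) r $ c) = 0" if "s < rk i" for s
      using that Suc.prems by (intro sum.neutral) auto
    then have "unit_vec (rk (Suc i)) r \<in> mat_kernel (A i)"
      unfolding mat_kernel_iff[OF A_carrier] by simp
    from A_kernel_const[OF this Suc.prems] show False using Suc.prems by simp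
  qed
  then obtain s where s: "s < rk i" "A i $$ (s, r) \<noteq> 0" by blast
  note h = A_homog[OF s(1) Suc.prems]
  have "d (Suc i) ! r - d i ! s \<noteq> 0"
  proof
    assume "d (Suc i) ! r - d i ! s = 0"
    then have "A i $$ (s, r) = cst (lookup (A i $$ (s, r)) 0)" using h homog_comp_0_eq by simp
    then show False using s(2) A_const[OF s(1) Suc.prems] by simp
  qed
  moreover have "\<not> d (Suc i) ! r - d i ! s < 0" using homog_comp_neg h s(2) by blast
  ultimately show ?case using Suc.IH[OF s(1)] by simp
qed

lemma A_gens:
  assumes "c \<in> gens (Suc i)" "r \<in> gens i"
  shows "A i $$ (r, c) \<in> homog_comp 1"
  using A_homog[of r i c] assms by (simp add: gens_def)

text \<open>A generator of \<open>F i\<close> outside the strand has degree above D + i, so the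
  entry has degree at most 0; it vanishes in negative degree by grading and in degree 0 by
  minimality. Thus the strand is a subcomplex with linear entries.\<close>

lemma A_not_gens:
  assumes c: "c \<in> gens (Suc i)" and r: "r < rk i" "r \<notin> gens i"
  shows "A i $$ (r, c) = 0"
proof -
  have c': "c < rk (Suc i)" using c by (rule gens_less)
  note h = A_homog[OF r(1) c']
  have "d (Suc i) ! c - d i ! r \<le> 0" using c r d_ge[OF r(1)] by (auto simp: gens_def)
  then consider "d (Suc i) ! c - d i ! r < 0" | "d (Suc i) ! c - d i ! r = 0" by linarith
  then show ?thesis
  proof cases
    case 1
    then show ?thesis using h homog_comp_neg by blast
  next
    case 2
    then have "A i $$ (r, c) = cst (lookup (A i $$ (r, c)) 0)" using h homog_comp_0_eq by simp
    then show ?thesis using A_const[OF r(1) c'] by simp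
  qed
qed

lemma sum_gens: "(\<And>r. r < rk i \<Longrightarrow> r \<notin> gens i \<Longrightarrow> f r = 0) \<Longrightarrow> (\<Sum>r<rk i. f r) = (\<Sum>r\<in>gens i. f r)"
  for f :: "nat \<Rightarrow> 'b::comm_monoid_add"
  by (intro sum.mono_neutral_right) (auto simp: gens_def)

text \<open>Exactness gives a preimage with arbitrary polynomial entries. In degree 1 only the
  constant terms of its entries at \<open>gens (Suc i)\<close> survive, because all other generators
  have too large a degree.\<close>

lemma kernel_lift:
  assumes w: "\<And>r. r \<in> gens i \<Longrightarrow> w r \<in> homog_comp 1"
    and 0: "i = 0 \<Longrightarrow> (\<Sum>r\<in>gens 0. w r * g r) = 0"
    and Suc: "\<And>k s. i = Suc k \<Longrightarrow> s < rk k \<Longrightarrow> (\<Sum>r\<in>gens i. A k $$ (s, r) * w r) = 0"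
  obtains b where "\<And>r. r \<in> gens i \<Longrightarrow> w r = (\<Sum>c\<in>gens (Suc i). cst (b c) * A i $$ (r, c))"
proof -
  define v where "v = vec (rk i) (\<lambda>r. if r \<in> gens i then w r else 0)"
  have v: "v \<in> carrier_vec (rk i)" by (simp add: v_def)
  have vr: "r < rk i \<Longrightarrow> v $ r = (if r \<in> gens i then w r else 0)" for r by (simp add: v_def)
  have "v \<in> (\<lambda>w. A i *\<^sub>v w) ` carrier_vec (rk (Suc i))"
  proof (cases i)
    case 0
    have "(\<Sum>c<rk i. v $ c * g c) = (\<Sum>c\<in>gens i. v $ c * g c)" by (rule sum_gens) (simp add: vr)
    also have "\<dots> = (\<Sum>c\<in>gens i. w c * g c)" by (intro sum.cong) (auto simp: vr gens_less)
    finally have "(\<Sum>c<rk i. v $ c * g c) = 0" using assms(2) 0 by simp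
    then have "v \<in> {v \<in> carrier_vec (rk 0). (\<Sum>c<rk 0. v $ c * g c) = 0}" using v 0 by simp
    then show ?thesis unfolding aug_kernel 0 by simp
  next
    case (Suc k)
    have "(\<Sum>c<rk i. A k $$ (s, c) * v $ c) = 0" if "s < rk k" for s
    proof -
      have "(\<Sum>c<rk i. A k $$ (s, c) * v $ c) = (\<Sum>c\<in>gens i. A k $$ (s, c) * v $ c)"
        by (rule sum_gens) (simp add: vr)
      also have "\<dots> = (\<Sum>c\<in>gens i. A k $$ (s, c) * w c)" by (intro sum.cong) (auto simp: vr gens_less)
      finally show ?thesis using assms(3)[OF Suc that] by simp
    qed
    then have "v \<in> mat_kernel (A k)" using v Suc unfolding mat_kernel_iff[OF A_carrier] by simp
    then show ?thesis unfolding A_kernel Suc .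
  qed
  then obtain u where u: "u \<in> carrier_vec (rk (Suc i))" "v = A i *\<^sub>v u" by blast
  show ?thesis
  proof (rule that)
    fix r assume r: "r \<in> gens i"
    then have r': "r < rk i" by (rule gens_less)
    have "w r = (\<Sum>c<rk (Suc i). A i $$ (r, c) * u $ c)"
      using vr[OF r'] r mult_mat_vec_index[OF A_carrier u(1) r'] u(2) by simp
    then have "hc 1 (w r) = (\<Sum>c<rk (Suc i). hc 1 (A i $$ (r, c) * u $ c))" by (simp add: hc_sum)
    also have "\<dots> = (\<Sum>c<rk (Suc i). if c \<in> gens (Suc i) then cst (lookup (u $ c) 0) * A i $$ (r, c) else 0)"
    proof (intro sum.cong refl)
      fix c assume "c \<in> {..<rk (Suc i)}"
      then have c: "c < rk (Suc i)" by simp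
      have e: "1 - (d (Suc i) ! c - d i ! r) = D + int (Suc i) - d (Suc i) ! c"
        using r by (simp add: gens_def)
      have hcm: "hc 1 (A i $$ (r, c) * u $ c) = A i $$ (r, c) * hc (D + int (Suc i) - d (Suc i) ! c) (u $ c)"
        using hc_mult[OF A_homog[OF r' c], of 1 "u $ c"] unfolding e .
      show "hc 1 (A i $$ (r, c) * u $ c) = (if c \<in> gens (Suc i) then cst (lookup (u $ c) 0) * A i $$ (r, c) else 0)"
      proof (cases "c \<in> gens (Suc i)")
        case True
        then have "D + int (Suc i) - d (Suc i) ! c = 0" by (simp add: gens_def)
        then show ?thesis unfolding hcm using True by (simp add: hc_0_eq mult.commute)
      next
        case False
        then have "D + int (Suc i) - d (Suc i) ! c < 0" using d_ge[OF c] c by (simp add: gens_def)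
        then have "hc (D + int (Suc i) - d (Suc i) ! c) (u $ c) = 0" by (rule homog_comp_neg) simp
        then show ?thesis unfolding hcm using False by simp
      qed
    qed
    also have "\<dots> = (\<Sum>c\<in>gens (Suc i). if c \<in> gens (Suc i) then cst (lookup (u $ c) 0) * A i $$ (r, c) else 0)"
      by (rule sum_gens) simp
    also have "\<dots> = (\<Sum>c\<in>gens (Suc i). cst (lookup (u $ c) 0) * A i $$ (r, c))" by (intro sum.cong) auto
    finally show "w r = (\<Sum>c\<in>gens (Suc i). cst (lookup (u $ c) 0) * A i $$ (r, c))"
      using hc_homog[OF w[OF r], of 1] by simp
  qed
qed

text \<open>The Koszul cycle of a generator: its value at a list of variables follows the linear
  parts of the differentials down to \<open>F 0\<close>, one variable per step.\<close>

primrec Z :: "nat \<Rightarrow> nat \<Rightarrow> 'v list \<Rightarrow> ('v, 'k) mpoly" where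
  "Z 0 = (\<lambda>r vs. if vs = [] then g r else 0)"
| "Z (Suc i) = (\<lambda>c vs. case vs of [] \<Rightarrow> 0 | v # us \<Rightarrow>
     \<Sum>r\<in>gens i. cst (lin_coeff v (A i $$ (r, c))) * Z i r us)"

lemma Z_Nil [simp]: "Z (Suc i) c [] = 0"
  by simp

lemma Z_Cons: "Z (Suc i) c (v # us) = (\<Sum>r\<in>gens i. cst (lin_coeff v (A i $$ (r, c))) * Z i r us)"
  by simp

lemma Z_0_Nil: "Z 0 r [] = g r"
  by simp

declare Z.simps(2) [simp del]

lemma sum_Z_Cons:
  "(\<Sum>c\<in>C. cst (a c) * Z (Suc i) c (v # us)) =
   (\<Sum>r\<in>gens i. cst (\<Sum>c\<in>C. a c * lin_coeff v (A i $$ (r, c))) * Z i r us)"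
proof -
  have "(\<Sum>c\<in>C. cst (a c) * Z (Suc i) c (v # us)) =
      (\<Sum>c\<in>C. \<Sum>r\<in>gens i. cst (a c * lin_coeff v (A i $$ (r, c))) * Z i r us)"
    unfolding Z_Cons sum_distrib_left by (intro sum.cong refl) (simp only: cst_mult mult.assoc)
  also have "\<dots> = (\<Sum>r\<in>gens i. \<Sum>c\<in>C. cst (a c * lin_coeff v (A i $$ (r, c))) * Z i r us)"
    by (rule sum.swap)
  finally show ?thesis unfolding cst_sum sum_distrib_right .
qed

abbreviation comb :: "nat \<Rightarrow> (nat \<Rightarrow> 'k) \<Rightarrow> 'v list \<Rightarrow> ('v, 'k) mpoly" where
  "comb i a vs \<equiv> \<Sum>r\<in>gens i. cst (a r) * Z i r vs"

text \<open>If a combination vanishes, induction kills all linear coefficients of the constant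
  vector's image under \<open>A i\<close>. This vector then lies in the kernel, where constant terms
  are 0.\<close>

lemma Z_independent:
  assumes "\<And>vs. comb i a vs = 0" "r \<in> gens i"
  shows "a r = 0"
  using assms
proof (induction i arbitrary: a r)
  case 0
  define v where "v = vec (rk 0) (\<lambda>r. if r \<in> gens 0 then cst (a r) else (0 :: ('v, 'k) mpoly))"
  have vr: "r < rk 0 \<Longrightarrow> v $ r = (if r \<in> gens 0 then cst (a r) else 0)" for r by (simp add: v_def)
  have "(\<Sum>c<rk 0. v $ c * g c) = (\<Sum>c\<in>gens 0. v $ c * g c)" by (rule sum_gens) (simp add: vr)
  also have "\<dots> = (\<Sum>c\<in>gens 0. cst (a c) * Z 0 c [])" by (intro sum.cong) (auto simp: vr gens_less)
  also have "\<dots> = 0" by (rule 0(1))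
  finally have "lookup (v $ r) 0 = 0" using 0(2) by (intro aug_kernel_const) (auto simp: v_def gens_less)
  then show ?case using 0(2) by (simp add: vr gens_less lookup_cst)
next
  case (Suc i)
  have lc: "(\<Sum>c\<in>gens (Suc i). a c * lin_coeff v (A i $$ (r, c))) = 0" if "r \<in> gens i" for v r
    using Suc.IH[OF _ that, of "\<lambda>r. \<Sum>c\<in>gens (Suc i). a c * lin_coeff v (A i $$ (r, c))"]
      Suc.prems(1)[of "v # us" for us] unfolding sum_Z_Cons by blast
  define w where "w = vec (rk (Suc i)) (\<lambda>c. if c \<in> gens (Suc i) then cst (a c) else (0 :: ('v, 'k) mpoly))"
  have wc: "c < rk (Suc i) \<Longrightarrow> w $ c = (if c \<in> gens (Suc i) then cst (a c) else 0)" for c by (simp add: w_def)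
  have "(\<Sum>c<rk (Suc i). A i $$ (r, c) * w $ c) = 0" if r: "r < rk i" for r
  proof -
    have "(\<Sum>c<rk (Suc i). A i $$ (r, c) * w $ c) = (\<Sum>c\<in>gens (Suc i). A i $$ (r, c) * w $ c)"
      by (rule sum_gens) (simp add: wc)
    also have "\<dots> = (\<Sum>c\<in>gens (Suc i). cst (a c) * A i $$ (r, c))"
      by (intro sum.cong) (auto simp: wc gens_less mult.commute)
    also have "\<dots> = 0"
    proof (cases "r \<in> gens i")
      case True
      let ?s = "\<Sum>c\<in>gens (Suc i). cst (a c) * A i $$ (r, c)"
      have "cst (a c) * A i $$ (r, c) \<in> homog_comp 1" if "c \<in> gens (Suc i)" for c
        using homog_comp_mult[OF cst_in_homog_comp A_gens[OF that True]] by simp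
      then have "?s \<in> homog_comp 1" by (intro homog_comp_sum)
      from linear_form_eq[OF this] have "?s = (\<Sum>v\<in>UNIV. cst (lin_coeff v ?s) * pvar v)" .
      also have "\<dots> = 0" using lc[OF True] by (simp add: lookup_sum)
      finally show ?thesis .
    next
      case False
      then show ?thesis using A_not_gens r by (intro sum.neutral) auto
    qed
    finally show ?thesis .
  qed
  then have "w \<in> mat_kernel (A i)" unfolding mat_kernel_iff[OF A_carrier] by (simp add: w_def)
  then have "lookup (w $ r) 0 = 0" using A_kernel_const Suc.prems(2) gens_less by blast
  then show ?case using Suc.prems(2) by (simp add: wc gens_less lookup_cst)
qed

lemma Z_comb_eq_0_iff:
  "(\<forall>vs. comb i a vs = 0) \<longleftrightarrow> (\<forall>r\<in>gens i. a r = 0)"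
proof
  assume *: "\<forall>vs. comb i a vs = 0"
  show "\<forall>r\<in>gens i. a r = 0"
  proof
    fix r assume "r \<in> gens i"
    with *[rule_format] show "a r = 0" by (rule Z_independent)
  qed
qed (simp add: sum.neutral)

text \<open>Prepares two consecutive linear maps for \<open>quadratic_form_eq_0_iff\<close>.\<close>

lemma quadratic_expansion:
  assumes s: "s \<in> gens k" and w: "\<And>r. r \<in> gens (Suc k) \<Longrightarrow> w r = (\<Sum>v\<in>UNIV. cst (a v r) * pvar v)"
  shows "(\<Sum>r\<in>gens (Suc k). A k $$ (s, r) * w r) =
    (\<Sum>u\<in>UNIV. \<Sum>v\<in>UNIV. cst (\<Sum>r\<in>gens (Suc k). a v r * lin_coeff u (A k $$ (s, r))) * (pvar u * pvar v))"
proof -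
  have "A k $$ (s, r) * w r =
      (\<Sum>u\<in>UNIV. \<Sum>v\<in>UNIV. cst (a v r * lin_coeff u (A k $$ (s, r))) * (pvar u * pvar v))"
    if r: "r \<in> gens (Suc k)" for r
  proof -
    have "A k $$ (s, r) * w r =
        (\<Sum>u\<in>UNIV. cst (lin_coeff u (A k $$ (s, r))) * pvar u) * (\<Sum>v\<in>UNIV. cst (a v r) * pvar v)"
      by (subst linear_form_eq[OF A_gens[OF r s]], subst w[OF r]) (rule refl)
    also have "\<dots> = (\<Sum>u\<in>UNIV. \<Sum>v\<in>UNIV. cst (a v r * lin_coeff u (A k $$ (s, r))) * (pvar u * pvar v))"
      unfolding sum_product by (intro sum.cong refl) (simp only: cst_mult ac_simps)
    finally show ?thesis .
  qed
  then have "(\<Sum>r\<in>gens (Suc k). A k $$ (s, r) * w r) = (\<Sum>r\<in>gens (Suc k).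
      \<Sum>u\<in>UNIV. \<Sum>v\<in>UNIV. cst (a v r * lin_coeff u (A k $$ (s, r))) * (pvar u * pvar v))"
    by (intro sum.cong refl)
  also have "\<dots> = (\<Sum>u\<in>UNIV. \<Sum>r\<in>gens (Suc k). \<Sum>v\<in>UNIV.
      cst (a v r * lin_coeff u (A k $$ (s, r))) * (pvar u * pvar v))" by (rule sum.swap)
  also have "\<dots> = (\<Sum>u\<in>UNIV. \<Sum>v\<in>UNIV. \<Sum>r\<in>gens (Suc k).
      cst (a v r * lin_coeff u (A k $$ (s, r))) * (pvar u * pvar v))" by (intro sum.cong refl sum.swap)
  finally show ?thesis unfolding cst_sum sum_distrib_right .
qed

lemma kspace_W: "kspace W"
  using R.subspace_0[OF ideal] R.subspace_add[OF ideal] R.subspace_scale[OF ideal]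
    homog_comp_mult[OF cst_in_homog_comp, of _ D]
  by (auto simp: kspace_def homog_comp_add)

text \<open>Independence of the cycles \<open>Z k\<close> lets alternation of \<open>z\<close> be
  tested on its coefficients.\<close>

lemma Z_span_aux:
  assumes z: "\<And>u v us. z (u # v # us) = (\<Sum>s\<in>gens k. cst (B s u v) * Z k s us)"
  shows "(\<forall>u v us. z (u # v # us) + z (v # u # us) = 0) \<and> (\<forall>u us. z (u # u # us) = 0) \<longleftrightarrow>
    (\<forall>s\<in>gens k. (\<forall>u v. B s u v + B s v u = 0) \<and> (\<forall>u. B s u u = 0))"
proof -
  have "z (u # v # us) + z (v # u # us) = (\<Sum>s\<in>gens k. cst (B s u v + B s v u) * Z k s us)" for u v us
    unfolding z by (simp only: cst_add distrib_right sum.distrib)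
  then have "(\<forall>us. z (u # v # us) + z (v # u # us) = 0) \<longleftrightarrow> (\<forall>s\<in>gens k. B s u v + B s v u = 0)" for u v
    by (simp only: Z_comb_eq_0_iff)
  moreover have "(\<forall>us. z (u # u # us) = 0) \<longleftrightarrow> (\<forall>s\<in>gens k. B s u u = 0)" for u
    unfolding z by (rule Z_comb_eq_0_iff)
  ultimately show ?thesis by blast
qed

text \<open>The cycles of the strand generators span the whole Koszul kernel. Fixing the first
  variable gives, by induction, coefficient vectors; assembled into linear forms, they lie in the
  kernel of the preceding map exactly because of the last clause of \<open>strand\<close>, and
  \<open>kernel_lift\<close> applies. Conversely, the clause holds for \<open>Z\<close> because
  consecutive differentials compose to 0.\<close>

lemma strand_span:
  "strand W i z \<longleftrightarrow> (\<exists>a. \<forall>vs. z vs = comb i a vs)"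
proof (induction i arbitrary: z)
  case 0
  show ?case
  proof
    assume z: "strand W 0 z"
    then have zI: "z [] \<in> I" and zD: "z [] \<in> homog_comp D" by auto
    obtain v where v: "v \<in> carrier_vec (rk 0)" "z [] = (\<Sum>c<rk 0. v $ c * g c)"
      using zI unfolding aug_image[symmetric] by blast
    \<comment> \<open>Taking the component of degree D reduces polynomial coefficients to scalars on
      \<open>gens 0\<close>.\<close>
    have "z [] = hc D (\<Sum>c<rk 0. v $ c * g c)" using hc_homog[OF zD, of D] v(2) by simp
    also have "\<dots> = (\<Sum>c<rk 0. hc (D - d 0 ! c) (v $ c) * g c)"
      unfolding hc_sum using hc_mult' g_in by (intro sum.cong refl) blast
    also have "\<dots> = (\<Sum>c\<in>gens 0. hc (D - d 0 ! c) (v $ c) * g c)"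
    proof (rule sum_gens)
      fix r assume r: "r < rk 0" "r \<notin> gens 0"
      then have "D - d 0 ! r < 0" using d_ge[OF r(1)] by (simp add: gens_def)
      then have "hc (D - d 0 ! r) (v $ r) = 0" by (rule homog_comp_neg) simp
      then show "hc (D - d 0 ! r) (v $ r) * g r = 0" by simp
    qed
    also have "\<dots> = (\<Sum>c\<in>gens 0. cst (lookup (v $ c) 0) * g c)"
      by (intro sum.cong) (auto simp: gens_def hc_0_eq)
    finally have "z vs = (\<Sum>r\<in>gens 0. cst (lookup (v $ r) 0) * Z 0 r vs)" for vs
      using z by (cases "vs = []") auto
    then show "\<exists>a. \<forall>vs. z vs = comb 0 a vs" by (intro exI allI)
  next
    assume "\<exists>a. \<forall>vs. z vs = comb 0 a vs"
    then obtain a where a: "z = (\<lambda>vs. \<Sum>r\<in>gens 0. cst (a r) * Z 0 r vs)" by blast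
    have "strand W 0 (Z 0 r)" if "r \<in> gens 0" for r
      using g_in[OF gens_less[OF that]] that by (simp add: gens_def)
    then show "strand W 0 z" unfolding a by (rule strand_sum[OF kspace_W])
  qed
next
  case (Suc i)
  show ?case
  proof
    assume z: "strand W (Suc i) z"
    have "\<exists>a. \<forall>us. z (v # us) = comb i a us" for v
      by (rule Suc.IH[THEN iffD1, OF strand_SucD(2)[OF z]])
    then have "\<exists>a. \<forall>v us. z (v # us) = comb i (a v) us"
      by (intro choice allI)
    then obtain a where a: "\<And>v us. z (v # us) = comb i (a v) us" by blast
    \<comment> \<open>The linear forms that reassemble the coefficients over all choices of the
      first variable.\<close>
    define w where "w r = (\<Sum>v\<in>UNIV. cst (a v r) * pvar v)" for r
    obtain b where b: "\<And>r. r \<in> gens i \<Longrightarrow> w r = (\<Sum>c\<in>gens (Suc i). cst (b c) * A i $$ (r, c))"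
    proof (rule kernel_lift[of i w])
      fix r
      have "cst (a v r) * pvar v \<in> homog_comp 1" for v
        using homog_comp_mult[OF cst_in_homog_comp pvar_in_homog_comp] by simp
      then show "w r \<in> homog_comp 1" unfolding w_def by (intro homog_comp_sum)
    next
      assume i: "i = 0"
      have "(\<Sum>r\<in>gens 0. w r * g r) = (\<Sum>v\<in>UNIV. \<Sum>r\<in>gens 0. cst (a v r) * pvar v * g r)"
        unfolding w_def sum_distrib_right by (rule sum.swap)
      also have "\<dots> = (\<Sum>v\<in>UNIV. pvar v * z [v])"
        unfolding a sum_distrib_left i Z_0_Nil
        by (intro sum.cong refl) (simp only: mult.assoc mult.left_commute)
      also have "\<dots> = 0" using z i by simp
      finally show "(\<Sum>r\<in>gens 0. w r * g r) = 0" .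
    next
      fix k s assume i: "i = Suc k" and s: "s < rk k"
      show "(\<Sum>r\<in>gens i. A k $$ (s, r) * w r) = 0"
      proof (cases "s \<in> gens k")
        case True
        \<comment> \<open>The coefficients of \<open>z\<close> after two variables: they alternate
          as \<open>z\<close> does, which says that the quadratic form given by \<open>A k\<close>
          applied to \<open>w\<close> is 0.\<close>
        define B where "B s v u = (\<Sum>r\<in>gens (Suc k). a v r * lin_coeff u (A k $$ (s, r)))" for s v u
        have zz: "z (v # u # us) = (\<Sum>s\<in>gens k. cst (B s v u) * Z k s us)" for v u us
          unfolding a i sum_Z_Cons B_def ..
        have "(\<forall>u v us. z (u # v # us) + z (v # u # us) = 0) \<and> (\<forall>u us. z (u # u # us) = 0)"
          using z unfolding i by simp
        then have "(\<forall>u v. B s u v + B s v u = 0) \<and> (\<forall>u. B s u u = 0)"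
          unfolding Z_span_aux[where z = z and k = k and B = B, OF zz] using True by blast
        then have "(\<Sum>u\<in>UNIV. \<Sum>v\<in>UNIV. cst (B s v u) * (pvar u * pvar v)) = 0"
          unfolding quadratic_form_eq_0_iff by blast
        then show ?thesis using quadratic_expansion[OF True, of w a] unfolding B_def i w_def by simp
      next
        case False
        then show ?thesis using A_not_gens[of _ k s] s i by (intro sum.neutral) auto
      qed
    qed blast
    have "a v r = (\<Sum>c\<in>gens (Suc i). b c * lin_coeff v (A i $$ (r, c)))" if "r \<in> gens i" for v r
    proof -
      have "a v r = lin_coeff v (w r)" unfolding w_def lin_coeff_lin ..
      also have "\<dots> = (\<Sum>c\<in>gens (Suc i). b c * lin_coeff v (A i $$ (r, c)))"
        unfolding b[OF that] by (simp add: lookup_sum)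
      finally show ?thesis .
    qed
    then have "z (v # us) = (\<Sum>c\<in>gens (Suc i). cst (b c) * Z (Suc i) c (v # us))" for v us
      unfolding a sum_Z_Cons by (intro sum.cong) auto
    then have "z vs = (\<Sum>c\<in>gens (Suc i). cst (b c) * Z (Suc i) c vs)" for vs
      using strand_SucD(1)[OF z] by (cases vs) simp_all
    then show "\<exists>a. \<forall>vs. z vs = comb (Suc i) a vs" by (intro exI allI)
  next
    assume "\<exists>a. \<forall>vs. z vs = comb (Suc i) a vs"
    then obtain b where b: "z = (\<lambda>vs. \<Sum>r\<in>gens (Suc i). cst (b r) * Z (Suc i) r vs)" by blast
    have "strand W (Suc i) (Z (Suc i) c)" if c: "c \<in> gens (Suc i)" for c
    proof -
      have comp: "strand W i (\<lambda>us. Z (Suc i) c (v # us))" for v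
        unfolding Suc.IH Z_Cons by (intro exI allI) (rule refl)
      show ?thesis
      proof (cases i)
        case 0
        have "(\<Sum>v\<in>UNIV. pvar v * Z (Suc 0) c [v]) =
            (\<Sum>v\<in>UNIV. \<Sum>r\<in>gens 0. cst (lin_coeff v (A 0 $$ (r, c))) * pvar v * g r)"
          unfolding Z_Cons sum_distrib_left Z_0_Nil
            by (intro sum.cong refl) (simp only: mult.assoc mult.left_commute)
        also have "\<dots> = (\<Sum>r\<in>gens 0. (\<Sum>v\<in>UNIV. cst (lin_coeff v (A 0 $$ (r, c))) * pvar v) * g r)"
          unfolding sum_distrib_right by (rule sum.swap)
        also have "\<dots> = (\<Sum>r\<in>gens 0. A 0 $$ (r, c) * g r)"
          using linear_form_eq[OF A_gens[of c 0]] c 0 by (intro sum.cong) auto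
        also have "\<dots> = (\<Sum>r<rk 0. A 0 $$ (r, c) * g r)"
          using A_not_gens[of c 0] c 0 by (intro sum_gens[symmetric]) auto
        also have "\<dots> = 0" using aug_A gens_less[OF c] 0 by simp
        finally show ?thesis using comp 0 by simp
      next
        case (Suc k)
        define B where "B s v u = (\<Sum>r\<in>gens (Suc k). lin_coeff v (A (Suc k) $$ (r, c)) * lin_coeff u (A k $$ (s, r)))" for s v u
        have zz: "Z (Suc i) c (v # u # us) = (\<Sum>s\<in>gens k. cst (B s v u) * Z k s us)" for v u us
          unfolding Z_Cons[of "Suc k"] Suc sum_Z_Cons B_def ..
        have "(\<forall>u v. B s u v + B s v u = 0) \<and> (\<forall>u. B s u u = 0)" if s: "s \<in> gens k" for s
        proof -
          have "0 = (\<Sum>r<rk (Suc k). A k $$ (s, r) * A (Suc k) $$ (r, c))"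
            using A_A gens_less s c Suc by simp
          also have "\<dots> = (\<Sum>r\<in>gens (Suc k). A k $$ (s, r) * A (Suc k) $$ (r, c))"
            using A_not_gens[of c "Suc k"] c Suc by (intro sum_gens) auto
          also have "\<dots> = (\<Sum>u\<in>UNIV. \<Sum>v\<in>UNIV. cst (B s v u) * (pvar u * pvar v))"
            unfolding B_def using linear_form_eq[OF A_gens[of c "Suc k"]] c Suc
            by (intro quadratic_expansion[OF s]) auto
          finally have B: "\<forall>u v. u \<noteq> v \<longrightarrow> B s v u + B s u v = 0" "\<forall>u. B s u u = 0"
            using quadratic_form_eq_0_iff[of "\<lambda>u v. B s v u"] by simp_all
          have "B s u v + B s v u = 0" for u v
            using B(1)[rule_format, of v u] B(2) by (cases "u = v") simp_all
          then show ?thesis using B(2) by blast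
        qed
        then have "(\<forall>u v us. Z (Suc i) c (u # v # us) + Z (Suc i) c (v # u # us) = 0) \<and>
            (\<forall>u us. Z (Suc i) c (u # u # us) = 0)"
          unfolding Z_span_aux[where z = "Z (Suc i) c" and k = k and B = B, OF zz] by blast
        then show ?thesis using comp Suc by simp
      qed
    qed
    then show "strand W (Suc i) z" unfolding b by (rule strand_sum[OF kspace_W])
  qed
qed

text \<open>\<open>Y\<close> is a set of coefficient positions that detect every nonzero element of
  the strand, which bounds the number of generators above; the independent family over
  \<open>P\<close> bounds it below.\<close>

theorem count_list_eq_strand_dim:
  fixes \<zeta> :: "'p \<Rightarrow> 'v list \<Rightarrow> ('v, 'k) mpoly" and Y :: "('v list \<times> ('v \<Rightarrow>\<^sub>0 nat)) set"
  assumes Y: "finite Y" "card Y \<le> N"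
      "\<And>z. strand W i z \<Longrightarrow> (\<And>vs \<nu>. (vs, \<nu>) \<in> Y \<Longrightarrow> lookup (z vs) \<nu> = 0) \<Longrightarrow> \<forall>vs. z vs = 0"
    and P: "finite P" "card P = N" "\<And>p. p \<in> P \<Longrightarrow> strand W i (\<zeta> p)"
      "\<And>a p. (\<And>vs. (\<Sum>p\<in>P. cst (a p) * \<zeta> p vs) = 0) \<Longrightarrow> p \<in> P \<Longrightarrow> a p = 0"
  shows "count_list (d i) (D + int i) = N"
proof (rule antisym)
  show "count_list (d i) (D + int i) \<le> N"
  proof (rule ccontr)
    assume "\<not> ?thesis"
    then have "card Y < card (gens i)" using Y(2) by (simp add: count_list_d)
    then obtain a where a: "\<exists>r\<in>gens i. a r \<noteq> 0"
        "\<forall>q\<in>Y. (\<Sum>r\<in>gens i. a r * (case q of (vs, \<nu>) \<Rightarrow> lookup (Z i r vs) \<nu>)) = 0"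
      using nontrivial_solution[OF Y(1) finite_gens, of i "\<lambda>r q. case q of (vs, \<nu>) \<Rightarrow> lookup (Z i r vs) \<nu>"]
      by blast
    define z where "z = (\<lambda>vs. \<Sum>r\<in>gens i. cst (a r) * Z i r vs)"
    have "strand W i z" unfolding strand_span z_def by blast
    moreover have "lookup (z vs) \<nu> = 0" if "(vs, \<nu>) \<in> Y" for vs \<nu>
      using a(2) that by (fastforce simp: z_def lookup_sum)
    ultimately have "\<forall>vs. z vs = 0" by (rule Y(3))
    then have "a r = 0" if "r \<in> gens i" for r using that by (intro Z_independent) (auto simp: z_def)
    then show False using a(1) by blast
  qed
  show "N \<le> count_list (d i) (D + int i)"
  proof (rule ccontr)
    assume "\<not> ?thesis"
    then have lt: "card (gens i) < card P" using P(2) by (simp add: count_list_d)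
    have "\<exists>b. \<forall>vs. \<zeta> p vs = comb i b vs" if "p \<in> P" for p
      using P(3)[OF that] unfolding strand_span .
    then obtain b where b: "\<And>p vs. p \<in> P \<Longrightarrow> \<zeta> p vs = comb i (b p) vs"
      using bchoice[of P "\<lambda>p b. \<forall>vs. \<zeta> p vs = comb i b vs"] by blast
    obtain a where a: "\<exists>p\<in>P. a p \<noteq> 0" "\<forall>r\<in>gens i. (\<Sum>p\<in>P. a p * b p r) = 0"
      using nontrivial_solution[OF finite_gens P(1) lt, of b] by blast
    have "(\<Sum>p\<in>P. cst (a p) * \<zeta> p vs) = 0" for vs
    proof -
      have "(\<Sum>p\<in>P. cst (a p) * \<zeta> p vs) = (\<Sum>p\<in>P. \<Sum>r\<in>gens i. cst (a p * b p r) * Z i r vs)"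
        by (intro sum.cong refl) (simp only: b sum_distrib_left cst_mult mult.assoc)
      also have "\<dots> = (\<Sum>r\<in>gens i. cst (\<Sum>p\<in>P. a p * b p r) * Z i r vs)"
        unfolding cst_sum sum_distrib_right by (rule sum.swap)
      also have "\<dots> = 0" using a(2) by (intro sum.neutral) simp
      finally show ?thesis .
    qed
    then show False using P(4) a(1) by blast
  qed
qed

end

text \<open>Existence of a resolution and equality of the count in all of them make the definite
  description meaningful.\<close>

theorem ideal_betti_eq_strand_dim:
  fixes I :: "('v::{finite,linorder}, 'k::field) mpoly set"
    and \<zeta> :: "'p \<Rightarrow> 'v list \<Rightarrow> ('v, 'k) mpoly" and Y :: "('v list \<times> ('v \<Rightarrow>\<^sub>0 nat)) set"
  assumes I: "R.subspace I" "hom_closed I"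
    and low: "\<And>p j. p \<in> I \<Longrightarrow> p \<in> homog_comp j \<Longrightarrow> j < D \<Longrightarrow> p = 0"
    and Y: "finite Y" "card Y \<le> N"
      "\<And>z. strand (I \<inter> homog_comp D) i z \<Longrightarrow> (\<And>vs \<nu>. (vs, \<nu>) \<in> Y \<Longrightarrow> lookup (z vs) \<nu> = 0) \<Longrightarrow> \<forall>vs. z vs = 0"
    and P: "finite P" "card P = N" "\<And>p. p \<in> P \<Longrightarrow> strand (I \<inter> homog_comp D) i (\<zeta> p)"
      "\<And>a p. (\<And>vs. (\<Sum>p\<in>P. cst (a p) * \<zeta> p vs) = 0) \<Longrightarrow> p \<in> P \<Longrightarrow> a p = 0"
  shows "ideal_betti i (D + int i) I = N"
proof -
  have count: "count_list (d i) (D + int i) = N"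
    if "minimal_graded_free_resolution (*) I (\<lambda>k. I \<inter> homog_comp k) d A g" for d A g
  proof -
    interpret minimal_resolution I d A g D using that I(1) low by unfold_locales
    show ?thesis using Y P by (rule count_list_eq_strand_dim)
  qed
  obtain d A g where "minimal_graded_free_resolution (*) I (\<lambda>k. I \<inter> homog_comp k) d A g"
    using minimal_graded_free_resolution_exists[OF I] by blast
  then show ?thesis unfolding ideal_betti_def graded_betti_def
    using count by (intro the_equality) blast+
qed

subsection \<open>Alternating functions\<close>

lemma strand_alternating:
  assumes "strand W i z"
  shows "z (u # v # us) + z (v # u # us) = 0" "z (u # u # us) = 0"
proof -
  consider "i = 0" | "i = Suc 0" | k where "i = Suc (Suc k)" by (metis not0_implies_Suc)
  then have "z (u # v # us) + z (v # u # us) = 0 \<and> z (u # u # us) = 0"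
    using assms by cases simp_all
  then show "z (u # v # us) + z (v # u # us) = 0" "z (u # u # us) = 0" by auto
qed

lemma strand_length: "strand W i z \<Longrightarrow> z vs \<noteq> 0 \<Longrightarrow> length vs = i"
proof (induction i arbitrary: z vs)
  case (Suc i)
  then obtain v us where vs: "vs = v # us" using strand_SucD(1)[OF Suc.prems(1)] Suc.prems(2) by (cases vs) auto
  then show ?case using Suc.IH[OF strand_SucD(2)[OF Suc.prems(1), of v], of us] Suc.prems(2) by simp
qed auto

lemma strand_values: "strand W i z \<Longrightarrow> 0 \<in> W \<Longrightarrow> z vs \<in> W"
proof (induction i arbitrary: z vs)
  case 0
  then show ?case by (cases "vs = []") auto
next
  case (Suc i)
  show ?case
  proof (cases vs)
    case Nil
    then show ?thesis using strand_SucD(1)[OF Suc.prems(1)] Suc.prems(2) by simp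
  next
    case (Cons v us)
    then show ?thesis using Suc.IH[OF strand_SucD(2)[OF Suc.prems(1), of v], of us] Suc.prems(2) by simp
  qed
qed

text \<open>Unfolding \<open>strand\<close> reaches the Koszul relation when a single variable is
  left, hence in last position; other positions are reached by permuting.\<close>

lemma strand_last: "strand W (Suc i) z \<Longrightarrow> (\<Sum>v\<in>UNIV. pvar v * z (us @ [v])) = 0"
proof (induction i arbitrary: z us)
  case 0
  then show ?case by (cases us) auto
next
  case (Suc i)
  show ?case
  proof (cases us)
    case Nil
    have "z [v] = 0" for v using strand_SucD(1)[OF strand_SucD(2)[OF Suc.prems, of v]] .
    then show ?thesis using Nil by simp
  next
    case (Cons w ws)
    then show ?thesis using Suc.IH[OF strand_SucD(2)[OF Suc.prems, of w], of ws] by simp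
  qed
qed

lemma strand_move_front:
  "strand W i z \<Longrightarrow> z (ws @ v # us) = z (v # ws @ us) \<or> z (ws @ v # us) = - z (v # ws @ us)"
proof (induction ws arbitrary: i z)
  case (Cons w ws)
  show ?case
  proof (cases i)
    case 0
    then show ?thesis using Cons.prems by simp
  next
    case (Suc k)
    have "z (w # ws @ v # us) = z (w # v # ws @ us) \<or> z (w # ws @ v # us) = - z (w # v # ws @ us)"
      using Cons.IH[OF strand_SucD(2)[OF Cons.prems[unfolded Suc], of w]] .
    moreover have "z (w # v # ws @ us) = - z (v # w # ws @ us)"
      using strand_alternating(1)[OF Cons.prems, of w v "ws @ us"] by (simp add: eq_neg_iff_add_eq_0)
    ultimately show ?thesis by auto
  qed
qed simp

text \<open>The sign is left open, since only the vanishing of coefficients will matter.\<close>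

lemma strand_permute:
  "strand W i z \<Longrightarrow> mset us = mset vs \<Longrightarrow> z us = z vs \<or> z us = - z vs"
proof (induction vs arbitrary: i z us)
  case (Cons v vs)
  show ?case
  proof (cases i)
    case 0
    then show ?thesis using Cons.prems by (cases us) auto
  next
    case (Suc k)
    have "v \<in> set us" using Cons.prems(2) by (metis list.set_intros(1) set_mset_mset)
    then obtain ws ws' where us: "us = ws @ v # ws'" by (meson split_list)
    have "mset (ws @ ws') = mset vs" using Cons.prems(2) us by simp
    then have "z (v # ws @ ws') = z (v # vs) \<or> z (v # ws @ ws') = - z (v # vs)"
      using Cons.IH[OF strand_SucD(2)[OF Cons.prems(1)[unfolded Suc], of v]] by blast
    then show ?thesis using strand_move_front[OF Cons.prems(1), of ws v ws'] us by auto
  qed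
qed simp

lemma strand_permute_lookup:
  assumes "strand W i z" "mset us = mset vs"
  shows "lookup (z us) s = 0 \<longleftrightarrow> lookup (z vs) s = 0"
  using strand_permute[OF assms] by auto

lemma strand_distinct:
  assumes z: "strand W i z" "z vs \<noteq> 0"
  shows "distinct vs"
proof (rule ccontr)
  assume "\<not> distinct vs"
  then obtain a b c v where vs: "vs = a @ [v] @ b @ [v] @ c" by (meson not_distinct_decomp)
  have "z vs = z (v # v # a @ b @ c) \<or> z vs = - z (v # v # a @ b @ c)"
    by (rule strand_permute[OF z(1)]) (simp add: vs)
  then show False using strand_alternating(2)[OF z(1)] z(2) by auto
qed

text \<open>\<open>wedge l z\<close> codes \<open>l \<and> z\<close> for \<open>l \<in> V \<otimes> R\<close>: expansion along the position of the factor \<open>l\<close>.\<close>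

fun wedge :: "('v \<Rightarrow> ('v, 'k::comm_ring_1) mpoly) \<Rightarrow> ('v list \<Rightarrow> ('v, 'k) mpoly) \<Rightarrow> 'v list \<Rightarrow> ('v, 'k) mpoly" where
  "wedge l z [] = 0"
| "wedge l z (v # vs) = l v * z vs - wedge l (\<lambda>us. z (v # us)) vs"

lemma wedge_add: "wedge l (\<lambda>us. x us + y us) vs = wedge l x vs + wedge l y vs"
  by (induction vs arbitrary: x y) (simp_all add: distrib_left)

lemma wedge_zero [simp]: "wedge l (\<lambda>us. 0) vs = 0"
  by (induction vs) simp_all

text \<open>The Koszul differential is an antiderivation that kills \<open>l\<close> by assumption
  and \<open>z\<close> as an element of the strand, hence also their wedge product. On lists this
  becomes an induction that peels off the first variable.\<close>

lemma strand_wedge: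
  fixes W :: "('v::finite, 'k::comm_ring_1) mpoly set"
  assumes l: "(\<Sum>v\<in>UNIV. pvar v * l v) = 0" and W: "\<And>v p. p \<in> W \<Longrightarrow> l v * p \<in> W'" and W': "kspace W'"
  shows "strand W i z \<Longrightarrow> strand W' (Suc i) (wedge l z)"
proof (induction i arbitrary: z)
  case 0
  have z: "(\<lambda>us. z (v # us)) = (\<lambda>us. 0)" for v using 0 by auto
  have "strand W' 0 (\<lambda>us. wedge l z (v # us))" for v
    using 0 W by (simp add: z)
  moreover have "(\<Sum>v\<in>UNIV. pvar v * wedge l z [v]) = (\<Sum>v\<in>UNIV. pvar v * l v) * z []"
    unfolding sum_distrib_right by (intro sum.cong refl) (simp only: wedge.simps diff_zero mult.assoc)
  ultimately show ?case using l by simp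
next
  case (Suc i)
  have "cst (- 1) * p + q \<in> W'" if "p \<in> W'" "q \<in> W'" for p q
    using W' that unfolding kspace_def by blast
  then have lin: "l v * p + - 1 * q \<in> W'" if "p \<in> W" "q \<in> W'" for v p q
    using W[OF that(1), of v] that(2) by (fastforce simp: cst_uminus add.commute)
  have comp: "strand W' (Suc i) (\<lambda>us. wedge l z (v # us))" for v
  proof -
    have "strand W' (Suc i) (\<lambda>us. l v * z us + - 1 * wedge l (\<lambda>us. z (v # us)) us)"
      by (rule strand_lin_comb2[OF lin Suc.prems Suc.IH[OF strand_SucD(2)[OF Suc.prems]]])
    then show ?thesis by simp
  qed
  have "wedge l z (u # v # us) + wedge l z (v # u # us) = 0" for u v us
  proof -
    have "wedge l z (u # v # us) + wedge l z (v # u # us) =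
        wedge l (\<lambda>ws. z (u # v # ws)) us + wedge l (\<lambda>ws. z (v # u # ws)) us"
      by simp
    also have "\<dots> = wedge l (\<lambda>ws. z (u # v # ws) + z (v # u # ws)) us" by (rule wedge_add[symmetric])
    also have "\<dots> = 0" unfolding strand_alternating(1)[OF Suc.prems] by simp
    finally show ?thesis .
  qed
  moreover have "wedge l z (u # u # us) = 0" for u us
    by (simp add: strand_alternating(2)[OF Suc.prems])
  ultimately show ?case using comp by simp
qed

definition exps :: "'v list \<Rightarrow> 'v \<Rightarrow>\<^sub>0 nat" where
  "exps vs = (\<Sum>v\<leftarrow>vs. evar v)"

lemma exps_simps [simp]: "exps [] = 0" "exps (v # vs) = evar v + exps vs" "exps (vs @ ws) = exps vs + exps ws"
  by (simp_all add: exps_def)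

lemma exps_mset: "mset us = mset vs \<Longrightarrow> exps us = exps vs"
  unfolding exps_def by (metis mset_map sum_mset_sum_list)

lemma lookup_exps: "lookup (exps vs) v = count (mset vs) v"
  by (induction vs) (auto simp: lookup_add lookup_evar)

text \<open>One term of the expansion must contribute; the list left after removing \<open>v\<close>
  is recorded through its monomial only, which is all that the ordering of pairs sees.\<close>

lemma wedge_support:
  assumes "lookup (wedge l z us) \<nu> \<noteq> 0"
  shows "\<exists>v us' \<nu>1 \<nu>2. v \<in> set us \<and> exps us = evar v + exps us' \<and> \<nu> = \<nu>1 + \<nu>2 \<and>
    lookup (l v) \<nu>1 \<noteq> 0 \<and> lookup (z us') \<nu>2 \<noteq> 0"
  using assms
proof (induction us arbitrary: z)
  case (Cons v vs)
  then consider "lookup (l v * z vs) \<nu> \<noteq> 0" | "lookup (wedge l (\<lambda>us. z (v # us)) vs) \<nu> \<noteq> 0"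
    unfolding wedge.simps lookup_minus by fastforce
  then show ?case
  proof cases
    case 1
    then obtain a b where "\<nu> = a + b" "lookup (l v) a \<noteq> 0" "lookup (z vs) b \<noteq> 0"
      by (rule lookup_mult_nonzeroE)
    then show ?thesis by (intro exI[of _ v] exI[of _ vs] exI[of _ a] exI[of _ b]) simp
  next
    case 2
    from Cons.IH[OF this] obtain w us' \<nu>1 \<nu>2 where "w \<in> set vs" "exps vs = evar w + exps us'" "\<nu> = \<nu>1 + \<nu>2"
      "lookup (l w) \<nu>1 \<noteq> 0" "lookup (z (v # us')) \<nu>2 \<noteq> 0" by blast
    then show ?thesis
      by (intro exI[of _ w] exI[of _ "v # us'"] exI[of _ \<nu>1] exI[of _ \<nu>2]) (simp add: ac_simps)
  qed
qed simp

subsection \<open>Leading monomials\<close>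

text \<open>A sum of two exponents below the bounds reaches \<open>a + b\<close> only if both bounds
  are attained.\<close>

lemma lookup_mult_leading:
  fixes p q :: "('v::linorder, 'k::comm_ring_1) mpoly"
  assumes p: "\<And>s. lookup p s \<noteq> 0 \<Longrightarrow> s \<le> a" and q: "\<And>s. lookup q s \<noteq> 0 \<Longrightarrow> s \<le> b"
  shows "lookup (p * q) (a + b) = lookup p a * lookup q b"
proof -
  define p' where "p' = p - single a (lookup p a)"
  have p': "s < a" if "lookup p' s \<noteq> 0" for s
  proof -
    have "s \<noteq> a" using that by (auto simp: p'_def lookup_minus)
    then have "lookup p s \<noteq> 0" using that by (auto simp: p'_def lookup_minus lookup_single when_def)
    then show ?thesis using p \<open>s \<noteq> a\<close> by (simp add: order_less_le)
  qed
  have "lookup (p' * q) (a + b) = 0"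
  proof (rule ccontr)
    assume "lookup (p' * q) (a + b) \<noteq> 0"
    then obtain s t where st: "a + b = s + t" "lookup p' s \<noteq> 0" "lookup q t \<noteq> 0"
      by (rule lookup_mult_nonzeroE)
    have "s + t < a + b" by (rule add_less_le_mono[OF p'[OF st(2)] q[OF st(3)]])
    then show False using st(1) by simp
  qed
  moreover have "p * q = single a (lookup p a) * q + p' * q"
    by (simp add: p'_def left_diff_distrib)
  ultimately show ?thesis by (simp add: lookup_add)
qed

text \<open>The pairs to be compared consist of the total monomial and the monomial of the wedge
  part.\<close>

definition kle :: "('a::linorder) \<times> 'a \<Rightarrow> 'a \<times> 'a \<Rightarrow> bool" where
  "kle x y \<longleftrightarrow> fst x < fst y \<or> fst x = fst y \<and> snd x \<le> snd y"

definition klt :: "('a::linorder) \<times> 'a \<Rightarrow> 'a \<times> 'a \<Rightarrow> bool" where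
  "klt x y \<longleftrightarrow> fst x < fst y \<or> fst x = fst y \<and> snd x < snd y"

lemma kle_add:
  fixes a :: "'a::{linorder, ordered_cancel_ab_semigroup_add}"
  assumes "kle (a, b) (c, d)" "kle (a', b') (c', d')"
  shows "kle (a + a', b + b') (c + c', d + d')"
  using assms unfolding kle_def fst_conv snd_conv
  by (elim disjE conjE) (simp_all add: add_strict_mono add_strict_left_mono add_strict_right_mono add_mono)

lemma klt_kle_add:
  fixes a :: "'a::{linorder, ordered_cancel_ab_semigroup_add}"
  assumes "klt (a, b) (c, d)" "kle (a', b') (c', d')"
  shows "klt (a + a', b + b') (c + c', d + d')"
  using assms unfolding kle_def klt_def fst_conv snd_conv
  by (elim disjE conjE)
    (simp_all add: add_strict_mono add_strict_left_mono add_strict_right_mono add_less_le_mono)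

lemma klt_irrefl [simp]: "\<not> klt x x"
  by (simp add: klt_def)

lemma kle_refl [simp]: "kle x x"
  by (simp add: kle_def)

lemma klt_imp_kle: "klt x y \<Longrightarrow> kle x y"
  by (auto simp: kle_def klt_def)

lemma kle_antisym: "kle x y \<Longrightarrow> kle y x \<Longrightarrow> x = y"
  by (auto simp: kle_def prod_eq_iff)

lemma ex_kle_max:
  fixes k :: "'b \<Rightarrow> ('a::linorder) \<times> 'a"
  assumes "finite S" "S \<noteq> {}"
  obtains x where "x \<in> S" "\<And>y. y \<in> S \<Longrightarrow> kle (k y) (k x)"
proof -
  define S' where "S' = {x \<in> S. fst (k x) = Max ((fst \<circ> k) ` S)}"
  have "Max ((fst \<circ> k) ` S) \<in> (fst \<circ> k) ` S" using assms by (intro Max_in) auto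
  then have "S' \<noteq> {}" by (auto simp: S'_def)
  moreover have fin: "finite S'" using assms by (simp add: S'_def)
  ultimately have "Max ((snd \<circ> k) ` S') \<in> (snd \<circ> k) ` S'" by (intro Max_in) auto
  then obtain x where x: "x \<in> S'" "snd (k x) = Max ((snd \<circ> k) ` S')" by auto
  show ?thesis
  proof (rule that)
    show "x \<in> S" using x(1) by (simp add: S'_def)
    fix y assume y: "y \<in> S"
    have le: "fst (k y) \<le> fst (k x)" using x(1) y assms(1) by (auto simp: S'_def intro!: Max_ge)
    show "kle (k y) (k x)"
    proof (cases "fst (k y) = fst (k x)")
      case True
      then have "y \<in> S'" using x(1) y by (simp add: S'_def)
      then have "snd (k y) \<le> snd (k x)" unfolding x(2) using fin by (intro Max_ge) auto
      then show ?thesis using True by (simp add: kle_def)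
    next
      case False
      then show ?thesis using le by (simp add: kle_def)
    qed
  qed
qed

section \<open>Spans over the ground field\<close>

interpretation kv: module "\<lambda>(c::'k::comm_ring_1) (p::('v, 'k) mpoly). cst c * p"
proof (unfold_locales, goal_cases)
  case (1 a x y) show ?case by (rule distrib_left)
next
  case (2 a b x) show ?case unfolding cst_add by (rule distrib_right)
next
  case (3 a b x) show ?case unfolding cst_mult by (rule mult.assoc[symmetric])
next
  case (4 x) show ?case by (simp only: cst_1 mult_1_left)
qed

lemma kspace_span: "kspace (kv.span S)"
  by (simp add: kspace_def kv.span_zero kv.span_add kv.span_scale)

text \<open>Coefficients are indexed by \<open>S\<close> and not by its image, so that sums run over
  multisets of generators.\<close>

lemma kspan_image_explicit:
  fixes F :: "'a \<Rightarrow> ('v, 'k::comm_ring_1) mpoly"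
  assumes "finite S" "p \<in> kv.span (F ` S)"
  obtains c where "p = (\<Sum>a\<in>S. cst (c a) * F a)"
proof -
  let ?T = "{p. \<exists>c. p = (\<Sum>a\<in>S. cst (c a) * F a)}"
  have "kv.subspace ?T"
  proof (rule kv.subspaceI)
    show "0 \<in> ?T" by (auto intro: exI[of _ "\<lambda>_. 0"])
  next
    fix x y assume "x \<in> ?T" "y \<in> ?T"
    then obtain c c' where "x = (\<Sum>a\<in>S. cst (c a) * F a)" "y = (\<Sum>a\<in>S. cst (c' a) * F a)" by blast
    then have "x + y = (\<Sum>a\<in>S. cst (c a + c' a) * F a)"
      by (simp add: cst_add distrib_right sum.distrib)
    then show "x + y \<in> ?T" by (intro CollectI exI)
  next
    fix b x assume "x \<in> ?T"
    then obtain c where "x = (\<Sum>a\<in>S. cst (c a) * F a)" by blast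
    then have "cst b * x = (\<Sum>a\<in>S. cst (b * c a) * F a)"
      unfolding cst_mult mult.assoc by (simp only: sum_distrib_left)
    then show "cst b * x \<in> ?T" by (intro CollectI exI)
  qed
  moreover have "F ` S \<subseteq> ?T"
  proof clarify
    fix b assume "b \<in> S"
    then have "F b = (\<Sum>a\<in>S. cst (if a = b then 1 else 0) * F a)"
      using assms(1) by (simp add: if_distrib if_distribR cong: if_cong)
    then show "\<exists>c. F b = (\<Sum>a\<in>S. cst (c a) * F a)" by (rule exI[of _ "\<lambda>a. if a = b then 1 else 0"])
  qed
  ultimately have "kv.span (F ` S) \<subseteq> ?T" by (intro kv.span_minimal)
  then show ?thesis using assms(2) that by blast
qed

lemma kspan_mult_left:
  fixes T U :: "('v, 'k::comm_ring_1) mpoly set"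
  assumes "\<And>q. q \<in> T \<Longrightarrow> p * q \<in> kv.span U" and "q \<in> kv.span T"
  shows "p * q \<in> kv.span U"
proof -
  have "kv.subspace {q. p * q \<in> kv.span U}"
  proof (rule kv.subspaceI; unfold mem_Collect_eq)
    show "p * 0 \<in> kv.span U" by (simp add: kv.span_zero)
  next
    fix x y assume "p * x \<in> kv.span U" "p * y \<in> kv.span U"
    then show "p * (x + y) \<in> kv.span U" unfolding distrib_left by (rule kv.span_add)
  next
    fix c x assume "p * x \<in> kv.span U"
    then show "p * (cst c * x) \<in> kv.span U" unfolding mult.left_commute[of p] by (rule kv.span_scale)
  qed
  then have "kv.span T \<subseteq> {q. p * q \<in> kv.span U}" using assms(1) by (intro kv.span_minimal) auto
  then show ?thesis using assms(2) by blast
qed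

lemma kspan_mult:
  assumes "\<And>p q. p \<in> S \<Longrightarrow> q \<in> T \<Longrightarrow> p * q \<in> kv.span U" and p: "p \<in> kv.span S" and q: "q \<in> kv.span T"
  shows "p * q \<in> kv.span U"
proof -
  have "q * p' \<in> kv.span U" if "p' \<in> S" for p'
    using kspan_mult_left[OF assms(1)[OF that] q] by (simp only: mult.commute)
  then have "q * p \<in> kv.span U" using p by (rule kspan_mult_left)
  then show ?thesis by (simp only: mult.commute)
qed

text \<open>What the count needs, shared by both ideals: generators \<open>f e\<close> with leading
  monomials \<open>u e\<close>, and linear syzygies \<open>l r\<close> indexed by the variable
  \<open>r\<close> at which they lead, with leading generator \<open>\<kappa> r\<close>. The
  assumption \<open>exchange\<close> is the combinatorial core: trading \<open>v\<close> for a
  smaller variable \<open>w\<close> is possible only if \<open>v\<close> indexes a syzygy whose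
  leading generator divides the product.\<close>

locale strand_data =
  fixes P :: "'e set" and u :: "'e \<Rightarrow> ('v::{finite,linorder} \<Rightarrow>\<^sub>0 nat)" and f :: "'e \<Rightarrow> ('v, 'k::field) mpoly"
    and V0 :: "'v set" and \<kappa> :: "'v \<Rightarrow> 'e" and l :: "'v \<Rightarrow> 'v \<Rightarrow> ('v, 'k) mpoly"
  assumes finite_P: "finite P"
    and f_homog: "e \<in> P \<Longrightarrow> f e \<in> homog_comp 2"
    and f_lead: "e \<in> P \<Longrightarrow> lookup (f e) (u e) \<noteq> 0"
    and f_le: "e \<in> P \<Longrightarrow> lookup (f e) s \<noteq> 0 \<Longrightarrow> s \<le> u e"
    and u_inj: "set_mset a \<subseteq> P \<Longrightarrow> set_mset a' \<subseteq> P \<Longrightarrow> (\<Sum>e\<in>#a. u e) = (\<Sum>e\<in>#a'. u e) \<Longrightarrow> a = a'"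
    and exchange: "set_mset a \<subseteq> P \<Longrightarrow> set_mset a' \<subseteq> P \<Longrightarrow> size a = size a' \<Longrightarrow> evar w < evar v \<Longrightarrow>
      evar v + (\<Sum>e\<in>#a. u e) = evar w + (\<Sum>e\<in>#a'. u e) \<Longrightarrow> v \<in> V0 \<and> \<kappa> v \<in># a"
    and \<kappa>_P: "v \<in> V0 \<Longrightarrow> \<kappa> v \<in> P"
    and \<kappa>_inj: "inj_on \<kappa> V0"
    and l_span: "r \<in> V0 \<Longrightarrow> l r v \<in> kv.span (f ` P)"
    and l_syz: "r \<in> V0 \<Longrightarrow> (\<Sum>v\<in>UNIV. pvar v * l r v) = 0"
    and l_lead: "r \<in> V0 \<Longrightarrow> lookup (l r r) (u (\<kappa> r)) \<noteq> 0"
    and l_less: "r \<in> V0 \<Longrightarrow> lookup (l r v) s \<noteq> 0 \<Longrightarrow> (v, s) \<noteq> (r, u (\<kappa> r)) \<Longrightarrow>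
      klt (evar v + s, evar v) (evar r + u (\<kappa> r), evar r)"
begin

definition U :: "'e multiset \<Rightarrow> 'v \<Rightarrow>\<^sub>0 nat" where "U a = (\<Sum>e\<in>#a. u e)"

definition F :: "'e multiset \<Rightarrow> ('v, 'k) mpoly" where "F a = (\<Prod>e\<in>#a. f e)"

definition W :: "nat \<Rightarrow> ('v, 'k) mpoly set" where
  "W m = kv.span (F ` multisets_of_size P m)"

lemma U_simps [simp]: "U {#} = 0" "U (add_mset e a) = u e + U a" "U (a + b) = U a + U b"
  by (simp_all add: U_def)

lemma F_simps [simp]: "F {#} = 1" "F (add_mset e a) = f e * F a"
  by (simp_all add: F_def)

lemma F_lead:
  assumes "set_mset a \<subseteq> P"
  shows "lookup (F a) (U a) \<noteq> 0" "lookup (F a) s \<noteq> 0 \<Longrightarrow> s \<le> U a"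
proof -
  have "lookup (F a) (U a) \<noteq> 0 \<and> (\<forall>s. lookup (F a) s \<noteq> 0 \<longrightarrow> s \<le> U a)"
    using assms
  proof (induction a)
    case empty
    then show ?case by (auto simp: lookup_one when_def)
  next
    case (add e a)
    then have e: "e \<in> P" and IH: "lookup (F a) (U a) \<noteq> 0" "\<And>s. lookup (F a) s \<noteq> 0 \<Longrightarrow> s \<le> U a" by auto
    have "lookup (f e * F a) (u e + U a) = lookup (f e) (u e) * lookup (F a) (U a)"
      by (rule lookup_mult_leading) (use f_le[OF e] IH(2) in auto)
    then have 1: "lookup (f e * F a) (u e + U a) \<noteq> 0" using f_lead[OF e] IH(1) by simp
    have "s \<le> u e + U a" if "lookup (f e * F a) s \<noteq> 0" for s
      using that by (rule lookup_mult_nonzeroE) (auto intro!: add_mono f_le[OF e] IH(2))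
    with 1 show ?case by simp
  qed
  then show "lookup (F a) (U a) \<noteq> 0" "lookup (F a) s \<noteq> 0 \<Longrightarrow> s \<le> U a" by auto
qed

text \<open>By \<open>u_inj\<close> different products have different leading monomials, so the
  largest of those in a combination cannot cancel.\<close>

lemma W_lead:
  assumes p: "p \<in> W m" and s: "lookup p s \<noteq> 0" "\<And>t. lookup p t \<noteq> 0 \<Longrightarrow> t \<le> s"
  obtains a where "a \<in> multisets_of_size P m" "s = U a"
proof -
  let ?M = "multisets_of_size P m"
  have M: "set_mset a \<subseteq> P" if "a \<in> ?M" for a using that by (rule multisets_of_size_subset)
  have fin: "finite ?M" by (rule finite_multisets_of_size[OF finite_P])
  obtain c where c: "p = (\<Sum>a\<in>?M. cst (c a) * F a)"
    using kspan_image_explicit[OF fin p[unfolded W_def]] by blast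
  have lp: "lookup p t = (\<Sum>a\<in>?M. c a * lookup (F a) t)" for t unfolding c by (simp add: lookup_sum)
  define S where "S = {a \<in> ?M. c a \<noteq> 0}"
  have "S \<noteq> {}"
  proof
    assume "S = {}"
    then have "lookup p s = 0" unfolding lp S_def by (intro sum.neutral) auto
    then show False using s(1) by simp
  qed
  moreover have finS: "finite S" using fin by (simp add: S_def)
  ultimately have "Max (U ` S) \<in> U ` S" by (intro Max_in) auto
  then obtain a0 where a0: "a0 \<in> S" "U a0 = Max (U ` S)" by auto
  have le: "U a \<le> U a0" if "a \<in> S" for a unfolding a0(2) using that finS by (intro Max_ge) auto
  have a0M: "a0 \<in> ?M" "c a0 \<noteq> 0" using a0(1) by (auto simp: S_def)
  have "lookup p (U a0) = c a0 * lookup (F a0) (U a0)"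
  proof -
    have "c a * lookup (F a) (U a0) = 0" if "a \<in> ?M - {a0}" for a
    proof (rule ccontr)
      assume nz: "c a * lookup (F a) (U a0) \<noteq> 0"
      then have "a \<in> S" using that by (auto simp: S_def)
      moreover have "U a0 \<le> U a" using nz that M by (intro F_lead(2)) auto
      ultimately have "U a = U a0" using le by (simp add: antisym)
      then have "a = a0" using u_inj[of a a0] that M a0M unfolding U_def by auto
      then show False using that by simp
    qed
    then have "(\<Sum>a\<in>?M - {a0}. c a * lookup (F a) (U a0)) = 0" by (rule sum.neutral[OF ballI])
    then show ?thesis unfolding lp by (subst sum.remove[OF fin a0M(1)]) simp
  qed
  then have "lookup p (U a0) \<noteq> 0" using a0M F_lead(1)[OF M[OF a0M(1)]] by simp
  then have "U a0 \<le> s" by (rule s(2))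
  moreover have "s \<le> U a0"
  proof -
    obtain a where a: "a \<in> ?M" "c a * lookup (F a) s \<noteq> 0"
      using s(1) unfolding lp by (meson sum.not_neutral_contains_not_neutral)
    then have "s \<le> U a" by (intro F_lead(2)[OF M]) auto
    also have "U a \<le> U a0" using a by (intro le) (auto simp: S_def)
    finally show ?thesis .
  qed
  ultimately show ?thesis using that[of a0] a0M by simp
qed

lemma kspace_W: "kspace (W m)"
  unfolding W_def by (rule kspace_span)

lemma W_mult: "p \<in> kv.span (f ` P) \<Longrightarrow> q \<in> W m \<Longrightarrow> p * q \<in> W (Suc m)"
  unfolding W_def
proof (rule kspan_mult)
  fix p q assume "p \<in> f ` P" "q \<in> F ` multisets_of_size P m"
  then obtain e a where "e \<in> P" "a \<in> multisets_of_size P m" "p = f e" "q = F a" by blast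
  then have *: "add_mset e a \<in> multisets_of_size P (Suc m)" "p * q = F (add_mset e a)"
    by (auto simp: multisets_of_size_def)
  show "p * q \<in> kv.span (F ` multisets_of_size P (Suc m))"
    unfolding *(2) using *(1) by (intro kv.span_base imageI)
qed

section \<open>Wedge products of syzygies and their leading pairs\<close>

definition wedges :: "'v list \<Rightarrow> ('v, 'k) mpoly \<Rightarrow> 'v list \<Rightarrow> ('v, 'k) mpoly" where
  "wedges rs p = foldr (\<lambda>r. wedge (l r)) rs (\<lambda>vs. if vs = [] then p else 0)"

lemma wedges_simps [simp]:
  "wedges [] p = (\<lambda>vs. if vs = [] then p else 0)" "wedges (r # rs) p = wedge (l r) (wedges rs p)"
  by (simp_all add: wedges_def)

lemma strand_wedges:
  "set rs \<subseteq> V0 \<Longrightarrow> p \<in> W k \<Longrightarrow> strand (W (k + length rs)) (length rs) (wedges rs p)"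
proof (induction rs)
  case (Cons r rs)
  then have "strand (W (Suc (k + length rs))) (Suc (length rs)) (wedge (l r) (wedges rs p))"
    by (intro strand_wedge[where W = "W (k + length rs)"] l_syz W_mult l_span kspace_W) auto
  then show ?case by simp
qed simp

definition lead :: "'v list \<Rightarrow> 'v \<Rightarrow>\<^sub>0 nat" where
  "lead rs = (\<Sum>r\<leftarrow>rs. u (\<kappa> r))"

lemma lead_simps [simp]: "lead [] = 0" "lead (r # rs) = u (\<kappa> r) + lead rs"
  by (simp_all add: lead_def)

lemma l_kle: "r \<in> V0 \<Longrightarrow> lookup (l r v) s \<noteq> 0 \<Longrightarrow> kle (evar v + s, evar v) (evar r + u (\<kappa> r), evar r)"
  using l_less[of r v s] klt_imp_kle by (cases "(v, s) = (r, u (\<kappa> r))") auto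

text \<open>The order on pairs is compatible with addition, so the bounds for the single syzygies
  add up.\<close>

lemma wedges_support:
  assumes "set rs \<subseteq> V0" and p: "\<And>s. lookup p s \<noteq> 0 \<Longrightarrow> s \<le> \<nu>0" and "lookup (wedges rs p us) \<nu> \<noteq> 0"
  shows "kle (exps us + \<nu>, exps us) (exps rs + (lead rs + \<nu>0), exps rs)"
  using assms(1,3)
proof (induction rs arbitrary: us \<nu>)
  case Nil
  then have "us = []" "\<nu> \<le> \<nu>0" using p by (auto split: if_splits)
  then show ?case by (auto simp: kle_def)
next
  case (Cons r rs)
  then have "lookup (wedge (l r) (wedges rs p) us) \<nu> \<noteq> 0" by simp
  from wedge_support[OF this] obtain v us' \<nu>1 \<nu>2 where d: "exps us = evar v + exps us'" "\<nu> = \<nu>1 + \<nu>2"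
    "lookup (l r v) \<nu>1 \<noteq> 0" "lookup (wedges rs p us') \<nu>2 \<noteq> 0" by blast
  have "kle (evar v + \<nu>1, evar v) (evar r + u (\<kappa> r), evar r)"
    using l_kle d(3) Cons.prems by simp
  moreover have "kle (exps us' + \<nu>2, exps us') (exps rs + (lead rs + \<nu>0), exps rs)"
    using Cons.IH d(4) Cons.prems by simp
  ultimately have "kle (evar v + \<nu>1 + (exps us' + \<nu>2), evar v + exps us')
      (evar r + u (\<kappa> r) + (exps rs + (lead rs + \<nu>0)), evar r + exps rs)" by (rule kle_add)
  then show ?case unfolding d(1,2) exps_simps lead_simps by (simp only: ac_simps)
qed

text \<open>At the leading pair only the term of the expansion with \<open>l r\<close> at its own
  variable contributes, and there the leading coefficients multiply.\<close>

lemma wedges_lead: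
  assumes "set rs \<subseteq> V0" "distinct rs" and p: "\<And>s. lookup p s \<noteq> 0 \<Longrightarrow> s \<le> \<nu>0" "lookup p \<nu>0 \<noteq> 0"
  shows "lookup (wedges rs p rs) (lead rs + \<nu>0) \<noteq> 0"
  using assms(1,2)
proof (induction rs)
  case Nil
  then show ?case using p by simp
next
  case (Cons r rs)
  then have r: "r \<in> V0" "r \<notin> set rs" "set rs \<subseteq> V0" by auto
  let ?T = "lead rs + \<nu>0"
  have "lookup (l r r * wedges rs p rs) (u (\<kappa> r) + ?T) = lookup (l r r) (u (\<kappa> r)) * lookup (wedges rs p rs) ?T"
  proof (rule lookup_mult_leading)
    fix s assume "lookup (l r r) s \<noteq> 0"
    from l_kle[OF r(1) this] show "s \<le> u (\<kappa> r)" by (auto simp: kle_def)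
  next
    fix s assume "lookup (wedges rs p rs) s \<noteq> 0"
    from wedges_support[OF r(3) p(1) this] show "s \<le> ?T" by (auto simp: kle_def)
  qed
  then have 1: "lookup (l r r * wedges rs p rs) (u (\<kappa> r) + ?T) \<noteq> 0"
    using l_lead[OF r(1)] Cons.IH Cons.prems by simp
  \<comment> \<open>In the remaining terms \<open>l r\<close> sits at a variable different from
    \<open>r\<close>, which makes the pair strictly smaller, although it would have to be the same
    pair.\<close>
  have 2: "lookup (wedge (l r) (\<lambda>us. wedges rs p (r # us)) rs) (u (\<kappa> r) + ?T) = 0"
  proof (rule ccontr)
    assume "\<not> ?thesis"
    from wedge_support[OF this] obtain v us' \<nu>1 \<nu>2 where d: "v \<in> set rs" "exps rs = evar v + exps us'"
      "u (\<kappa> r) + ?T = \<nu>1 + \<nu>2" "lookup (l r v) \<nu>1 \<noteq> 0" "lookup (wedges rs p (r # us')) \<nu>2 \<noteq> 0" by blast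
    have "klt (evar v + \<nu>1, evar v) (evar r + u (\<kappa> r), evar r)"
      using l_less[OF r(1) d(4)] d(1) r(2) by auto
    moreover have "kle (exps (r # us') + \<nu>2, exps (r # us')) (exps rs + ?T, exps rs)"
      by (rule wedges_support[OF r(3) p(1) d(5)])
    ultimately have "klt (evar v + \<nu>1 + (exps (r # us') + \<nu>2), evar v + exps (r # us'))
        (evar r + u (\<kappa> r) + (exps rs + ?T), evar r + exps rs)" by (rule klt_kle_add)
    moreover have "evar v + exps (r # us') = evar r + exps rs" unfolding d(2) exps_simps by (simp only: ac_simps)
    moreover have "evar v + \<nu>1 + (exps (r # us') + \<nu>2) = evar r + u (\<kappa> r) + (exps rs + ?T)"
    proof -
      have "evar v + \<nu>1 + (exps (r # us') + \<nu>2) = evar r + (evar v + exps us') + (\<nu>1 + \<nu>2)"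
        unfolding exps_simps by (simp only: ac_simps)
      also have "\<dots> = evar r + u (\<kappa> r) + (exps rs + ?T)"
        unfolding d(2)[symmetric] d(3)[symmetric] by (simp only: ac_simps)
      finally show ?thesis .
    qed
    ultimately show False by simp
  qed
  have "wedges (r # rs) p (r # rs) = l r r * wedges rs p rs - wedge (l r) (\<lambda>us. wedges rs p (r # us)) rs" by simp
  then have "lookup (wedges (r # rs) p (r # rs)) (u (\<kappa> r) + ?T) = lookup (l r r * wedges rs p rs) (u (\<kappa> r) + ?T)"
    using 2 by (simp only: lookup_minus diff_zero)
  then show ?case using 1 by (simp only: lead_simps add.assoc not_False_eq_True)
qed

text \<open>A choice of i syzygies and m - i further generators. The bound on \<open>i\<close>
  guards the truncated subtraction and makes the set empty for i > m.\<close>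

definition index :: "nat \<Rightarrow> nat \<Rightarrow> ('v set \<times> 'e multiset) set" where
  "index m i = {(J, b). J \<subseteq> V0 \<and> card J = i \<and> i \<le> m \<and> b \<in> multisets_of_size P (m - i)}"

text \<open>Sorting picks one list for each wedge of variables.\<close>

definition lead_pair :: "'v set \<times> 'e multiset \<Rightarrow> 'v list \<times> ('v \<Rightarrow>\<^sub>0 nat)" where
  "lead_pair = (\<lambda>(J, b). (sorted_list_of_set J, lead (sorted_list_of_set J) + U b))"

lemma index_eq: "index m i = (if i \<le> m then {J. J \<subseteq> V0 \<and> card J = i} \<times> multisets_of_size P (m - i) else {})"
  by (auto simp: index_def)

lemma finite_index [simp]: "finite (index m i)"
  by (simp add: index_eq finite_multisets_of_size[OF finite_P])

lemma card_index: "card (index m i) = (if i \<le> m then (card V0 choose i) * card (multisets_of_size P (m - i)) else 0)"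
  by (simp add: index_eq card_cartesian_product n_subsets)

lemma lead_eq_U:
  "distinct vs \<Longrightarrow> lead vs = U (image_mset \<kappa> (mset vs))"
  by (induction vs) auto

text \<open>At the largest pair with nonzero coefficient, every variable of the wedge must be
  cancelled by a smaller one in a Koszul relation. By \<open>exchange\<close> it then indexes a
  syzygy whose leading generator divides the monomial, so the pair is one of the excluded leading
  pairs.\<close>

lemma strand_W_upper:
  assumes z: "strand (W m) i z"
    and vanish: "\<And>vs \<nu>. (vs, \<nu>) \<in> lead_pair ` index m i \<Longrightarrow> lookup (z vs) \<nu> = 0"
  shows "z vs = 0"
proof (rule ccontr)
  assume "z vs \<noteq> 0"
  define S where "S = (SIGMA vs:{vs. set vs \<subseteq> UNIV \<and> length vs = i}. keys (z vs))"
  have Siff: "(us, s) \<in> S \<longleftrightarrow> lookup (z us) s \<noteq> 0" for us s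
  proof -
    have "length us = i" if "lookup (z us) s \<noteq> 0"
      by (rule strand_length[OF z]) (use that in auto)
    then show ?thesis by (auto simp: S_def in_keys_iff)
  qed
  have "finite S" unfolding S_def by (intro finite_SigmaI finite_lists_length_eq) auto
  moreover have "S \<noteq> {}"
  proof -
    obtain s where "lookup (z vs) s \<noteq> 0" using \<open>z vs \<noteq> 0\<close> by (metis lookup_zero poly_mapping_eqI)
    then show ?thesis using Siff by blast
  qed
  ultimately obtain x where x: "x \<in> S"
    "\<And>y. y \<in> S \<Longrightarrow> kle (exps (fst y) + snd y, exps (fst y)) (exps (fst x) + snd x, exps (fst x))"
    by (rule ex_kle_max[where k = "\<lambda>(us, s). (exps us + s, exps us)"]) (auto simp: case_prod_beta)
  obtain ws \<nu> where xw: "x = (ws, \<nu>)" by (cases x)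
  have ws: "lookup (z ws) \<nu> \<noteq> 0" using x(1) Siff xw by blast
  have max: "kle (exps us + s, exps us) (exps ws + \<nu>, exps ws)" if "lookup (z us) s \<noteq> 0" for us s
    using x(2)[of "(us, s)"] that Siff xw by simp
  have zW: "z us \<in> W m" for us using strand_values[OF z] kspace_W[of m] by (auto simp: kspace_def)
  have wnz: "z ws \<noteq> 0" using ws by auto
  have "t \<le> \<nu>" if "lookup (z ws) t \<noteq> 0" for t using max[OF that] by (auto simp: kle_def)
  then obtain a where a: "a \<in> multisets_of_size P m" "\<nu> = U a" using W_lead[OF zW ws] by blast
  have dist: "distinct ws" by (rule strand_distinct[OF z wnz])
  have len: "length ws = i" by (rule strand_length[OF z wnz])
  have ex: "v \<in> V0 \<and> \<kappa> v \<in># a" if v: "v \<in> set ws" for v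
  proof -
    define us where "us = remove1 v ws"
    have perm: "mset (us @ [v]) = mset ws" using v by (simp add: us_def)
    obtain k where k: "i = Suc k" using v len by (cases i) auto
    have nz: "lookup (z (us @ [v])) \<nu> \<noteq> 0" using strand_permute_lookup[OF z perm] ws by simp
    have ps: "lookup (pvar w * p) (evar w + s) = lookup p s" for w s and p :: "('v, 'k) mpoly"
      unfolding pvar_eq lookup_single_mult by simp
    \<comment> \<open>The Koszul relation at the monomial \<open>evar v + \<nu>\<close>: the summand
      of \<open>v\<close> is nonzero, so some other variable \<open>w\<close> contributes as
      well.\<close>
    have "(\<Sum>w\<in>UNIV. lookup (pvar w * z (us @ [w])) (evar v + \<nu>)) = 0"
      using arg_cong[OF strand_last[OF z[unfolded k], of us], of "\<lambda>p. lookup p (evar v + \<nu>)"]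
      by (simp only: lookup_sum lookup_zero)
    moreover have "(\<Sum>w\<in>UNIV. lookup (pvar w * z (us @ [w])) (evar v + \<nu>)) =
        lookup (z (us @ [v])) \<nu> + (\<Sum>w\<in>UNIV - {v}. lookup (pvar w * z (us @ [w])) (evar v + \<nu>))"
      by (subst sum.remove[of _ v]) (simp_all add: ps)
    ultimately have "(\<Sum>w\<in>UNIV - {v}. lookup (pvar w * z (us @ [w])) (evar v + \<nu>)) \<noteq> 0"
      using nz by auto
    then obtain w where w: "w \<noteq> v" "lookup (pvar w * z (us @ [w])) (evar v + \<nu>) \<noteq> 0"
      by (metis (no_types, lifting) DiffD2 insertI1 sum.not_neutral_contains_not_neutral)
    from w(2) obtain \<nu>' where \<nu>': "evar v + \<nu> = evar w + \<nu>'" "lookup (z (us @ [w])) \<nu>' \<noteq> 0"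
      unfolding pvar_eq by (rule lookup_single_mult_nonzeroE)
    have ews: "exps ws = exps us + evar v" using exps_mset[OF perm] by simp
    \<comment> \<open>Trading \<open>v\<close> for \<open>w\<close> keeps the total monomial.
      Maximality therefore compares the wedge parts, giving \<open>w\<close> below \<open>v\<close>,
      and makes \<open>\<nu>'\<close> a leading monomial too.\<close>
    have key: "exps (us @ [w]) + \<nu>' = exps ws + \<nu>"
      unfolding ews using \<nu>'(1) by (simp add: add.assoc)
    have "exps (us @ [w]) \<le> exps ws" using max[OF \<nu>'(2)] key by (simp add: kle_def)
    then have "evar w \<le> evar v" unfolding ews by simp
    then have lt: "evar w < evar v" using w(1) by (simp add: order_less_le)
    have "t \<le> \<nu>'" if "lookup (z (us @ [w])) t \<noteq> 0" for t
    proof -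
      have "exps (us @ [w]) + t \<le> exps (us @ [w]) + \<nu>'" using max[OF that] unfolding key by (auto simp: kle_def)
      then show ?thesis by simp
    qed
    then obtain a' where a': "a' \<in> multisets_of_size P m" "\<nu>' = U a'" using W_lead[OF zW \<nu>'(2)] by blast
    show ?thesis
      using exchange[of a a' w v] a a' lt \<nu>'(1) by (auto simp: multisets_of_size_def U_def)
  qed
  define J where "J = set ws"
  define c where "c = image_mset \<kappa> (mset_set J)"
  have JV: "J \<subseteq> V0" using ex by (auto simp: J_def)
  \<comment> \<open>Injectivity of \<open>\<kappa>\<close> makes \<open>c\<close> free of
    multiplicities, so it is contained in \<open>a\<close> as soon as each of its elements
    is.\<close>
  have c_eq: "c = mset_set (\<kappa> ` J)"
    unfolding c_def using inj_on_subset[OF \<kappa>_inj JV] by (rule image_mset_mset_set)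
  have "c \<subseteq># a"
    unfolding c_eq by (rule mset_subset_eqI) (use ex in \<open>auto simp: count_mset_set' J_def Suc_le_eq\<close>)
  then obtain b where b: "a = c + b" by (metis subset_mset.add_diff_inverse)
  have cardJ: "card J = i" using dist len by (simp add: J_def distinct_card)
  have sc: "size c = i" using cardJ by (simp add: c_def)
  define vs' where "vs' = sorted_list_of_set J"
  have mvs: "mset vs' = mset_set J"
    unfolding vs'_def using mset_set_set[of "sorted_list_of_set J"] by simp
  have "mset vs' = mset ws" unfolding mvs J_def using dist by (simp add: mset_set_set)
  then have nz: "lookup (z vs') \<nu> \<noteq> 0" using strand_permute_lookup[OF z] ws by blast
  have "(J, b) \<in> index m i" using a(1) b sc cardJ JV by (auto simp: index_def multisets_of_size_def)
  moreover have "lead_pair (J, b) = (vs', \<nu>)"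
    using lead_eq_U[of vs'] mvs b a(2) by (simp add: lead_pair_def vs'_def c_def)
  ultimately have "(vs', \<nu>) \<in> lead_pair ` index m i" by (metis imageI)
  then show False using vanish nz by blast
qed

definition strand_basis :: "'v set \<times> 'e multiset \<Rightarrow> 'v list \<Rightarrow> ('v, 'k) mpoly" where
  "strand_basis = (\<lambda>(J, b). wedges (sorted_list_of_set J) (F b))"

lemma strand_basis_in_strand: "x \<in> index m i \<Longrightarrow> strand (W m) i (strand_basis x)"
proof -
  assume "x \<in> index m i"
  then obtain J b where x: "x = (J, b)" "J \<subseteq> V0" "card J = i" "i \<le> m" "b \<in> multisets_of_size P (m - i)"
    by (auto simp: index_def)
  have "F b \<in> W (m - i)" unfolding W_def using x(5) by (intro kv.span_base imageI)
  then have "strand (W (m - i + length (sorted_list_of_set J))) (length (sorted_list_of_set J))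
      (wedges (sorted_list_of_set J) (F b))"
    using x by (intro strand_wedges) auto
  then show ?thesis using x by (simp add: strand_basis_def)
qed

text \<open>In a vanishing combination consider the member with the largest leading pair: no other
  member reaches that coefficient, because the leading pair determines both the set of syzygies and
  the multiset of generators.\<close>

lemma strand_basis_independent:
  assumes zero: "\<And>vs. (\<Sum>x\<in>index m i. cst (a x) * strand_basis x vs) = 0" and x: "x \<in> index m i"
  shows "a x = 0"
proof (rule ccontr)
  assume "a x \<noteq> 0"
  define S where "S = {x \<in> index m i. a x \<noteq> 0}"
  define k where "k x = (exps (fst (lead_pair x)) + snd (lead_pair x), exps (fst (lead_pair x)))" for x
  have "x \<in> S" using x \<open>a x \<noteq> 0\<close> by (simp add: S_def)
  then have ne: "S \<noteq> {}" by blast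
  have finS: "finite S" by (simp add: S_def)
  obtain x0 where x0: "x0 \<in> S" "\<And>y. y \<in> S \<Longrightarrow> kle (k y) (k x0)"
    using ex_kle_max[OF finS ne, of k] by blast
  obtain vs0 \<nu>0 where p0: "lead_pair x0 = (vs0, \<nu>0)" by (cases "lead_pair x0")
  have bP: "set_mset b \<subseteq> P" if "(J, b) \<in> index m i" for J b
    using that by (auto simp: index_def multisets_of_size_def)
  have "a y * lookup (strand_basis y vs0) \<nu>0 = 0" if "y \<in> index m i - {x0}" for y
  proof (rule ccontr)
    assume nz: "a y * lookup (strand_basis y vs0) \<nu>0 \<noteq> 0"
    then have yS: "y \<in> S" using that by (auto simp: S_def)
    obtain J b where y: "y = (J, b)" by (cases y)
    obtain J0 b0 where x0': "x0 = (J0, b0)" by (cases x0)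
    have JV: "J \<subseteq> V0" using that y by (auto simp: index_def)
    have yI: "(J, b) \<in> index m i" "(J0, b0) \<in> index m i" using that y x0(1) x0' by (auto simp: S_def)
    have "lookup (wedges (sorted_list_of_set J) (F b) vs0) \<nu>0 \<noteq> 0" using nz y by (simp add: strand_basis_def)
    then have "kle (exps vs0 + \<nu>0, exps vs0) (exps (sorted_list_of_set J) + (lead (sorted_list_of_set J) + U b),
        exps (sorted_list_of_set J))"
      using JV F_lead(2)[OF bP[OF yI(1)]] by (intro wedges_support) auto
    then have "kle (k x0) (k y)" by (simp add: k_def p0) (simp add: y lead_pair_def)
    then have eq: "k x0 = k y" using x0(2)[OF yS] by (rule kle_antisym)
    then have "exps (sorted_list_of_set J) = exps (sorted_list_of_set J0)"
      by (simp add: k_def y x0' lead_pair_def)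
    then have "count (mset (sorted_list_of_set J)) v = count (mset (sorted_list_of_set J0)) v" for v
      by (metis lookup_exps)
    then have "mset (sorted_list_of_set J) = mset (sorted_list_of_set J0)" by (rule multiset_eqI)
    then have "set (sorted_list_of_set J) = set (sorted_list_of_set J0)" by (rule mset_eq_setD)
    then have JJ: "J = J0" by simp
    then have "U b = U b0" using eq by (simp add: k_def y x0' lead_pair_def)
    then have "b = b0" using u_inj[OF bP[OF yI(1)] bP[OF yI(2)]] by (simp add: U_def)
    then show False using that y x0' JJ by simp
  qed
  then have "(\<Sum>y\<in>index m i - {x0}. a y * lookup (strand_basis y vs0) \<nu>0) = 0" by (rule sum.neutral[OF ballI])
  moreover have "(\<Sum>y\<in>index m i. a y * lookup (strand_basis y vs0) \<nu>0) = 0"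
    using arg_cong[OF zero[of vs0], of "\<lambda>p. lookup p \<nu>0"] by (simp only: lookup_sum lookup_cst_mult lookup_zero)
  moreover have x0I: "x0 \<in> index m i" "a x0 \<noteq> 0" using x0(1) by (auto simp: S_def)
  ultimately have z: "lookup (strand_basis x0 vs0) \<nu>0 = 0"
    using sum.remove[OF finite_index x0I(1), of "\<lambda>y. a y * lookup (strand_basis y vs0) \<nu>0"] by simp
  obtain J0 b0 where x0': "x0 = (J0, b0)" by (cases x0)
  have vs0: "vs0 = sorted_list_of_set J0" "\<nu>0 = lead (sorted_list_of_set J0) + U b0"
    using p0 x0' by (auto simp: lead_pair_def)
  have b0P: "set_mset b0 \<subseteq> P" using bP x0I(1) x0' by blast
  have "J0 \<subseteq> V0" using x0I(1) x0' by (auto simp: index_def)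
  then have "lookup (wedges (sorted_list_of_set J0) (F b0) vs0) \<nu>0 \<noteq> 0"
    unfolding vs0 using F_lead[OF b0P] by (intro wedges_lead) auto
  then show False using z x0' by (simp add: strand_basis_def)
qed

theorem ideal_betti_linear_strand:
  assumes "R.subspace I" "hom_closed I" "\<And>p j. p \<in> I \<Longrightarrow> p \<in> homog_comp j \<Longrightarrow> j < D \<Longrightarrow> p = 0"
    and I: "I \<inter> homog_comp D = W m"
  shows "ideal_betti i (D + int i) I = card (index m i)"
proof (rule ideal_betti_eq_strand_dim[where Y = "lead_pair ` index m i" and P = "index m i" and \<zeta> = strand_basis])
  show "R.subspace I" "hom_closed I" by fact+
  show "p = 0" if "p \<in> I" "p \<in> homog_comp j" "j < D" for p j using that by (rule assms(3))
  show "card (lead_pair ` index m i) \<le> card (index m i)" by (rule card_image_le) simp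
  show "\<forall>vs. z vs = 0"
    if "strand (I \<inter> homog_comp D) i z" "\<And>vs \<nu>. (vs, \<nu>) \<in> lead_pair ` index m i \<Longrightarrow> lookup (z vs) \<nu> = 0" for z
    using strand_W_upper[OF that(1)[unfolded I] that(2)] by blast
  show "strand (I \<inter> homog_comp D) i (strand_basis x)" if "x \<in> index m i" for x
    unfolding I by (rule strand_basis_in_strand[OF that])
  show "a x = 0" if "\<And>vs. (\<Sum>x\<in>index m i. cst (a x) * strand_basis x vs) = 0" "x \<in> index m i" for a x
    using that by (rule strand_basis_independent)
qed simp_all

end

subsection \<open>Components of lowest degree of ideal powers\<close>

text \<open>The index \<open>i\<close> is forced into \<open>A\<close> so that its summand can be
  split off.\<close>

lemma hc_mult_expand:
  fixes p q :: "('v::finite, 'k::comm_ring_1) mpoly"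
  obtains A where "finite A" "i \<in> A" "\<And>j. hc j (p * q) = (\<Sum>k\<in>A. hc k p * hc (j - k) q)"
proof -
  let ?A = "insert i ((\<lambda>s. int (mono_deg s)) ` keys p)"
  have p: "(\<Sum>k\<in>?A. hc k p) = p" by (rule sum_hc) (auto simp: in_keys_iff)
  have "hc j (p * q) = (\<Sum>k\<in>?A. hc k p * hc (j - k) q)" for j
  proof -
    have "hc j (p * q) = hc j (\<Sum>k\<in>?A. hc k p * q)" unfolding sum_distrib_right[symmetric] p ..
    also have "\<dots> = (\<Sum>k\<in>?A. hc k p * hc (j - k) q)"
      unfolding hc_sum by (intro sum.cong refl hc_mult) simp
    finally show ?thesis .
  qed
  then show ?thesis using that[of ?A] by simp
qed

definition low :: "int \<Rightarrow> ('v, 'k::comm_ring_1) mpoly \<Rightarrow> bool" where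
  "low D p \<longleftrightarrow> (\<forall>j<D. hc j p = 0)"

lemma low_0: "low 0 p"
  unfolding low_def by (metis hc_in_homog_comp homog_comp_neg)

lemma hc_mult_low:
  fixes p q :: "('v::finite, 'k::comm_ring_1) mpoly"
  assumes p: "low D p" and q: "low D' q"
  shows "low (D + D') (p * q)" "hc (D + D') (p * q) = hc D p * hc D' q"
proof -
  obtain A where A: "finite A" "D \<in> A" "\<And>j. hc j (p * q) = (\<Sum>k\<in>A. hc k p * hc (j - k) q)"
    using hc_mult_expand[of D p q] by blast
  have z: "hc k p * hc (j - k) q = 0" if "j \<le> D + D'" "k \<noteq> D \<or> j < D + D'" for j k
  proof (cases "k < D")
    case True
    then show ?thesis using p by (simp add: low_def)
  next
    case False
    then have "j - k < D'" using that by auto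
    then show ?thesis using q by (simp add: low_def)
  qed
  show "low (D + D') (p * q)" unfolding low_def A(3) using z by (intro allI impI sum.neutral ballI) auto
  have "(\<Sum>k\<in>A - {D}. hc k p * hc (D + D' - k) q) = 0"
    using z[of "D + D'"] by (intro sum.neutral ballI) auto
  then show "hc (D + D') (p * q) = hc D p * hc D' q"
    unfolding A(3) using sum.remove[OF A(1,2), of "\<lambda>k. hc k p * hc (D + D' - k) q"] by simp
qed

text \<open>In the lowest degree only constant terms of coefficients count, so the span over the
  ring becomes a span over the field.\<close>

lemma span_low:
  fixes G :: "('v::finite, 'k::comm_ring_1) mpoly set"
  assumes G: "\<And>g. g \<in> G \<Longrightarrow> low D g" and p: "p \<in> R.span G"
  shows "low D p" "hc D p \<in> kv.span (hc D ` G)"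
proof -
  let ?T = "{p. low D p \<and> hc D p \<in> kv.span (hc D ` G)}"
  have "R.subspace ?T"
  proof (rule R.subspaceI)
    show "0 \<in> ?T" by (simp add: low_def kv.span_zero)
  next
    fix x y assume "x \<in> ?T" "y \<in> ?T"
    then show "x + y \<in> ?T" by (simp add: low_def hc_add kv.span_add)
  next
    fix q x assume x: "x \<in> ?T"
    then have "low (0 + D) (q * x)" "hc (0 + D) (q * x) = hc 0 q * hc D x"
      by (intro hc_mult_low low_0; simp)+
    then show "q * x \<in> ?T" using x kv.span_scale[of "hc D x" "hc D ` G" "lookup q 0"] by (simp add: hc_0_eq)
  qed
  moreover have "G \<subseteq> ?T" using G by (auto intro: kv.span_base)
  ultimately have "R.span G \<subseteq> ?T" by (intro R.span_minimal)
  then show "low D p" "hc D p \<in> kv.span (hc D ` G)" using p by auto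
qed

lemma hom_closed_span:
  fixes G :: "('v::finite, 'k::comm_ring_1) mpoly set"
  assumes G: "\<And>g j. g \<in> G \<Longrightarrow> hc j g \<in> R.span G"
  shows "hom_closed (R.span G)"
proof -
  let ?T = "{p. \<forall>j. hc j p \<in> R.span G}"
  have "R.subspace ?T"
  proof (rule R.subspaceI)
    show "0 \<in> ?T" by (simp add: R.span_zero)
  next
    fix x y assume "x \<in> ?T" "y \<in> ?T"
    then show "x + y \<in> ?T" by (simp add: hc_add R.span_add)
  next
    fix q x assume x: "x \<in> ?T"
    show "q * x \<in> ?T"
    proof clarify
      fix j
      obtain A where "\<And>j. hc j (q * x) = (\<Sum>k\<in>A. hc k q * hc (j - k) x)"
        using hc_mult_expand[of 0 q x] by blast
      then show "hc j (q * x) \<in> R.span G" using x by (auto intro!: R.span_sum R.span_scale)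
    qed
  qed
  then have "R.span G \<subseteq> ?T" using G by (intro R.span_minimal) auto
  then show ?thesis by (auto simp: hom_closed_def)
qed

text \<open>Bundles what the Betti computation asks of an ideal and what is inherited by
  products.\<close>

definition lowest :: "('v, 'k::comm_ring_1) mpoly set \<Rightarrow> int \<Rightarrow> ('v, 'k) mpoly set \<Rightarrow> bool" where
  "lowest I D W \<longleftrightarrow> R.subspace I \<and> hom_closed I \<and> (\<forall>p\<in>I. low D p) \<and> I \<inter> homog_comp D = W"

lemma subspace_homog: "R.subspace I \<Longrightarrow> kv.subspace (I \<inter> homog_comp D)"
  for I :: "('v::finite, 'k::comm_ring_1) mpoly set"
proof (rule kv.subspaceI)
  assume I: "R.subspace I"
  show "0 \<in> I \<inter> homog_comp D" using R.subspace_0[OF I] by simp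
  show "x + y \<in> I \<inter> homog_comp D" if "x \<in> I \<inter> homog_comp D" "y \<in> I \<inter> homog_comp D" for x y
    using that R.subspace_add[OF I] homog_comp_add by blast
  show "cst c * x \<in> I \<inter> homog_comp D" if "x \<in> I \<inter> homog_comp D" for c x
    using that R.subspace_scale[OF I] homog_comp_mult[OF cst_in_homog_comp, of x D c] by simp
qed

lemma lowest_span:
  fixes G :: "('v::finite, 'k::comm_ring_1) mpoly set"
  assumes G: "\<And>g. g \<in> G \<Longrightarrow> low D g" "\<And>g j. g \<in> G \<Longrightarrow> hc j g \<in> R.span G"
    and W: "hc D ` G \<subseteq> kv.span S" "S \<subseteq> R.span G \<inter> homog_comp D"
  shows "lowest (R.span G) D (kv.span S)"
proof -
  have "kv.span S \<subseteq> R.span G \<inter> homog_comp D"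
    by (intro kv.span_minimal W(2) subspace_homog R.subspace_span)
  moreover have "kv.span (hc D ` G) \<subseteq> kv.span S"
    by (intro kv.span_minimal W(1) kv.subspace_span)
  then have "p \<in> kv.span S" if "p \<in> R.span G \<inter> homog_comp D" for p
    using span_low(2)[OF G(1), of G p] that by (auto simp: hc_homog)
  ultimately show ?thesis
    using span_low(1)[OF G(1), of G] hom_closed_span[OF G(2)] by (auto simp: lowest_def R.subspace_span)
qed

text \<open>Lowest components of factors multiply to the lowest component of the product; products
  of homogeneous components stay among the generators, which gives homogeneity.\<close>

lemma lowest_product:
  fixes I I' :: "('v::finite, 'k::comm_ring_1) mpoly set"
  assumes I: "lowest I D W" and I': "lowest I' D' W'"
  shows "lowest (ideal_gen {a * b | a b. a \<in> I \<and> b \<in> I'}) (D + D') (kv.span {a * b | a b. a \<in> W \<and> b \<in> W'})"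
  unfolding ideal_gen_eq
proof (rule lowest_span)
  let ?G = "{a * b | a b. a \<in> I \<and> b \<in> I'}"
  have low: "low D a" "low D' b" "hc D a \<in> W" "hc D' b \<in> W'" if "a \<in> I" "b \<in> I'" for a b
    using that I I' unfolding lowest_def by (auto dest: hom_closedD)
  show "low (D + D') g" if "g \<in> ?G" for g using that low hc_mult_low(1) by blast
  show "hc j g \<in> R.span ?G" if g: "g \<in> ?G" for g j
  proof -
    obtain a b where ab: "a \<in> I" "b \<in> I'" "g = a * b" using g by blast
    obtain A where A: "\<And>j. hc j (a * b) = (\<Sum>k\<in>A. hc k a * hc (j - k) b)"
      using hc_mult_expand[of 0 a b] by blast
    have "hc k a * hc (j - k) b \<in> ?G" for k
      using hom_closedD[of I a k] hom_closedD[of I' b "j - k"] ab I I' unfolding lowest_def by blast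
    then show ?thesis unfolding ab(3) A by (intro R.span_sum R.span_base)
  qed
  show "hc (D + D') ` ?G \<subseteq> kv.span {a * b | a b. a \<in> W \<and> b \<in> W'}"
  proof clarify
    fix a b assume "a \<in> I" "b \<in> I'"
    then show "hc (D + D') (a * b) \<in> kv.span {a * b | a b. a \<in> W \<and> b \<in> W'}"
      unfolding hc_mult_low(2)[OF low(1,2)[OF \<open>a \<in> I\<close> \<open>b \<in> I'\<close>]] using low(3,4) by (intro kv.span_base) blast
  qed
  show "{a * b | a b. a \<in> W \<and> b \<in> W'} \<subseteq> R.span ?G \<inter> homog_comp (D + D')"
    using I I' homog_comp_mult unfolding lowest_def by (blast intro: R.span_base)
qed

lemma multisets_of_size_1: "multisets_of_size A 1 = (\<lambda>e. {#e#}) ` A"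
proof (intro equalityI subsetI)
  fix x assume x: "x \<in> multisets_of_size A 1"
  then obtain e where "x = {#e#}"
    using size_1_singleton_mset[of x] by (auto simp: multisets_of_size_def)
  then show "x \<in> (\<lambda>e. {#e#}) ` A" using x by (auto simp: multisets_of_size_def)
qed (auto simp: multisets_of_size_def)

context strand_data
begin

lemma hc_f: "e \<in> P \<Longrightarrow> hc j (f e) = (if j = 2 then f e else 0)"
  using hc_homog[OF f_homog, of e j] by auto

lemma W_1: "W 1 = kv.span (f ` P)"
proof -
  have "F ` multisets_of_size P 1 = f ` P" unfolding multisets_of_size_1 by (simp add: image_image)
  then show ?thesis by (simp add: W_def)
qed

lemma W_Suc: "kv.span {a * b | a b. a \<in> W 1 \<and> b \<in> W m} = W (Suc m)"
proof
  have "{a * b | a b. a \<in> W 1 \<and> b \<in> W m} \<subseteq> W (Suc m)" using W_mult unfolding W_1 by blast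
  then show "kv.span {a * b | a b. a \<in> W 1 \<and> b \<in> W m} \<subseteq> W (Suc m)"
    unfolding W_def[of "Suc m"] by (rule kv.span_minimal) (rule kv.subspace_span)
  have "F ` multisets_of_size P (Suc m) \<subseteq> {a * b | a b. a \<in> W 1 \<and> b \<in> W m}"
  proof clarify
    fix a assume a: "a \<in> multisets_of_size P (Suc m)"
    then have "size a = Suc m" by (simp add: multisets_of_size_def)
    then obtain e b where e: "a = add_mset e b" by (metis size_eq_Suc_imp_eq_union)
    then have b: "b \<in> multisets_of_size P m" "e \<in> P" using a by (auto simp: multisets_of_size_def)
    have "f e \<in> W 1" unfolding W_1 using b by (intro kv.span_base imageI)
    moreover have "F b \<in> W m" unfolding W_def using b by (intro kv.span_base imageI)
    moreover have "F a = f e * F b" using e by simp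
    ultimately show "\<exists>x y. F a = x * y \<and> x \<in> W 1 \<and> y \<in> W m" by blast
  qed
  then show "W (Suc m) \<subseteq> kv.span {a * b | a b. a \<in> W 1 \<and> b \<in> W m}"
    unfolding W_def[of "Suc m"] by (rule kv.span_mono)
qed

lemma lowest_power:
  assumes "lowest I 2 (W 1)"
  shows "lowest (ideal_power I m) (2 * int m) (W m)"
proof (induction m)
  case 0
  \<comment> \<open>The power 0 is the whole ring, and its constants are spanned by the empty
    product.\<close>
  have "W 0 = kv.span {1}" by (simp add: W_def)
  moreover have "kv.span {1 :: ('v, 'k) mpoly} = homog_comp 0"
  proof
    have "kv.subspace (UNIV \<inter> homog_comp 0 :: ('v, 'k) mpoly set)"
      by (rule subspace_homog) (rule R.subspace_UNIV)
    then show "kv.span {1 :: ('v, 'k) mpoly} \<subseteq> homog_comp 0"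
      using cst_in_homog_comp[of 1] by (intro kv.span_minimal) auto
    show "homog_comp 0 \<subseteq> kv.span {1 :: ('v, 'k) mpoly}"
    proof
      fix p :: "('v, 'k) mpoly" assume "p \<in> homog_comp 0"
      then have "p = cst (lookup p 0) * 1" using homog_comp_0_eq by simp
      also have "\<dots> \<in> kv.span {1}" by (intro kv.span_scale kv.span_base) simp
      finally show "p \<in> kv.span {1}" .
    qed
  qed
  ultimately show ?case by (simp add: lowest_def hom_closed_def low_0 R.subspace_UNIV)
next
  case (Suc m)
  have "2 + 2 * int m = 2 * int (Suc m)" by simp
  then show ?case using lowest_product[OF assms Suc.IH] by (simp add: W_Suc[unfolded One_nat_def])
qed

lemma lowest_betti:
  assumes "lowest I (2 * int m) (W m)"
  shows "ideal_betti i (2 * int m + int i) I = card (index m i)"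
proof (rule ideal_betti_linear_strand)
  show "R.subspace I" "hom_closed I" "I \<inter> homog_comp (2 * int m) = W m"
    using assms by (simp_all add: lowest_def)
  show "p = 0" if "p \<in> I" "p \<in> homog_comp j" "j < 2 * int m" for p j
    using assms that hc_homog[of p j j] by (auto simp: lowest_def low_def)
qed

lemma lowest_generated: "lowest (R.span (f ` P)) 2 (W 1)"
  unfolding W_1
proof (rule lowest_span)
  show "low 2 g" if "g \<in> f ` P" for g
    using that by (auto simp: low_def hc_f)
  show "hc j g \<in> R.span (f ` P)" if "g \<in> f ` P" for g j
    using that by (auto simp: hc_f R.span_zero R.span_base)
  show "hc 2 ` f ` P \<subseteq> kv.span (f ` P)"
    by (auto simp: hc_f intro: kv.span_base)
  show "f ` P \<subseteq> R.span (f ` P) \<inter> homog_comp 2"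
    using f_homog by (auto intro: R.span_base)
qed

text \<open>Only the generators of degree \<open>2\<close> of the initial ideal are determined; no Groebner basis is
  needed for the linear strand of its powers.\<close>

lemma lowest_initial:
  "lowest (initial_ideal_lex (R.span (f ` P))) 2 (kv.span ((\<lambda>e. single (u e) (1::'k)) ` P))"
proof -
  let ?J = "R.span (f ` P)"
  let ?G = "{single (Max (keys p)) (1::'k) | p. p \<in> ?J \<and> p \<noteq> 0}"
  have J: "hom_closed ?J" "\<And>p. p \<in> ?J \<Longrightarrow> low 2 p" "?J \<inter> homog_comp 2 = W 1"
    using lowest_generated by (auto simp: lowest_def)
  have hcs: "hc j (single s 1) = (if int (mono_deg s) = j then single s 1 else (0 :: ('v, 'k) mpoly))" for j s
    using homog_comp_single[of s "int (mono_deg s)" "1::'k"] by (simp add: hc_homog)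
  show ?thesis
    unfolding initial_ideal_lex_def ideal_gen_eq
  proof (rule lowest_span)
    fix g assume "g \<in> ?G"
    then obtain p where p: "p \<in> ?J" "p \<noteq> 0" "g = single (Max (keys p)) 1" by blast
    show "low 2 g"
      unfolding low_def
    proof (intro allI impI)
      fix j :: int assume "j < 2"
      then have "hc j p = 0" using J(2)[OF p(1)] by (simp add: low_def)
      then have "lookup (hc j p) (Max (keys p)) = 0" by simp
      then have "int (mono_deg (Max (keys p))) \<noteq> j"
        using Max_keys[OF p(2)] by (auto simp: lookup_hc)
      then show "hc j g = 0" unfolding p(3) hcs by simp
    qed
    show "hc j g \<in> R.span ?G" for j
      using \<open>g \<in> ?G\<close> unfolding p(3) hcs by (auto simp: R.span_zero intro: R.span_base)
  next
    show "hc 2 ` ?G \<subseteq> kv.span ((\<lambda>e. single (u e) (1::'k)) ` P)"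
    proof clarify
      fix p assume p: "p \<in> ?J" "p \<noteq> 0"
      let ?s = "Max (keys p)"
      show "hc 2 (single ?s (1::'k)) \<in> kv.span ((\<lambda>e. single (u e) (1::'k)) ` P)"
      proof (cases "int (mono_deg ?s) = 2")
        case True
        \<comment> \<open>The component of degree 2 keeps the leading monomial of \<open>p\<close>
          and is a combination of the generators, so that monomial is one of the
          \<open>u e\<close>.\<close>
        have "hc 2 p \<in> W 1" using J(1,3) p(1) by (auto dest: hom_closedD)
        moreover have "lookup (hc 2 p) ?s \<noteq> 0" using True Max_keys[OF p(2)] by (simp add: lookup_hc)
        moreover have "t \<le> ?s" if "lookup (hc 2 p) t \<noteq> 0" for t
          using that by (intro Max_keys_ge) (auto simp: lookup_hc split: if_splits)
        ultimately obtain a where a: "a \<in> multisets_of_size P 1" "?s = U a" by (rule W_lead) blast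
        then obtain e where "a = {#e#}" "e \<in> P" unfolding multisets_of_size_1 by blast
        then have "?s = u e" "e \<in> P" using a(2) by simp_all
        then show ?thesis using hcs[of 2 ?s] True by (auto intro: kv.span_base)
      next
        case False
        then have "hc 2 (single ?s (1::'k)) = 0" unfolding hcs by (simp only: if_False)
        then show ?thesis by (simp only: kv.span_zero)
      qed
    qed
    show "(\<lambda>e. single (u e) (1::'k)) ` P \<subseteq> R.span ?G \<inter> homog_comp 2"
    proof clarify
      fix e assume e: "e \<in> P"
      have "f e \<noteq> 0" using f_lead[OF e] by auto
      moreover have "Max (keys (f e)) = u e"
        using f_lead[OF e] f_le[OF e] by (intro Max_eqI) (auto simp: in_keys_iff)
      moreover have "f e \<in> ?J" using e by (intro R.span_base imageI)
      ultimately have "single (u e) (1::'k) \<in> ?G" by (intro CollectI exI[of _ "f e"]) auto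
      moreover have "int (mono_deg (u e)) = 2" using homog_compD[OF f_homog[OF e] f_lead[OF e]] .
      then have "single (u e) (1::'k) \<in> homog_comp 2" by (rule homog_comp_single)
      ultimately show "single (u e) (1::'k) \<in> R.span ?G \<inter> homog_comp 2" by (auto intro: R.span_base)
    qed
  qed
qed

end

subsection \<open>Closed graphs without 4-cliques\<close>

instance var :: (finite) finite
proof
  have "v \<in> X ` UNIV \<union> Y ` UNIV" for v :: "'a var" by (cases v) auto
  then show "finite (UNIV :: 'a var set)"
    by (intro finite_subset[of UNIV "X ` UNIV \<union> Y ` UNIV"] subsetI) auto
qed

lemma evar_less_iff: "evar w < evar v \<longleftrightarrow> v < w"
  unfolding evar_def by (rule lex_variables)

text \<open>Decided at \<open>X i\<close>, which only the right side contains; so x_i y_j leads x_i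
  y_j - x_j y_i.\<close>

lemma evar_swap_less:
  assumes "i < (j :: 'n::linorder)"
  shows "evar (X j) + evar (Y i) < evar (X i) + evar (Y j)"
  unfolding less_exponent_iff
proof (intro exI[of _ "X i"] conjI allI impI)
  show "lookup (evar (X j) + evar (Y i)) (X i) < lookup (evar (X i) + evar (Y j)) (X i)"
    using assms by (simp add: lookup_add lookup_evar)
  fix w assume "w < X i"
  then show "lookup (evar (X j) + evar (Y i)) w = lookup (evar (X i) + evar (Y j)) w"
    using assms by (cases w) (auto simp: lookup_add lookup_evar)
qed

lemma multiset_size_less: "size A < size B \<Longrightarrow> \<exists>e. count A e < count B e"
  by (metis leD leI mset_subset_eqI size_mset_mono)

lemma multiset_size_le_cases:
  assumes "size A \<le> size B" "count B e < count A e"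
  shows "\<exists>e'. count A e' < count B e'"
proof (rule ccontr)
  assume "\<not> ?thesis"
  then have "B \<subseteq># A" by (intro mset_subset_eqI) (simp add: not_less)
  moreover have "B \<noteq> A" using assms(2) by auto
  ultimately have "size B < size A" by (metis mset_subset_size subset_mset.less_le)
  then show False using assms(1) by simp
qed

locale closed_K4_free =
  fixes E :: "'n::{finite,linorder} set set"
  assumes simple: "simple_graph E" and closed: "closed_labeled E" and K4: "K4_free E"
begin

definition P :: "('n \<times> 'n) set" where
  "P = {(i, j). i < j \<and> {i, j} \<in> E}"

definition tri :: "'n \<Rightarrow> 'n \<Rightarrow> 'n \<Rightarrow> bool" where
  "tri i j k \<longleftrightarrow> (i, j) \<in> P \<and> (i, k) \<in> P \<and> (j, k) \<in> P"

lemma P_less: "(i, j) \<in> P \<Longrightarrow> i < j"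
  by (simp add: P_def)

lemma P_edge: "(i, j) \<in> P \<Longrightarrow> {i, j} \<in> E"
  by (simp add: P_def)

lemma edge_P: "{i, j} \<in> E \<Longrightarrow> i < j \<Longrightarrow> (i, j) \<in> P"
  by (simp add: P_def)

lemma up: "(i, j) \<in> P \<Longrightarrow> (i, k) \<in> P \<Longrightarrow> j \<noteq> k \<Longrightarrow> {j, k} \<in> E"
  using closed[unfolded closed_labeled_def, rule_format, of i j i k] by (simp add: P_def doubleton_eq_iff)

lemma down: "(i, k) \<in> P \<Longrightarrow> (j, k) \<in> P \<Longrightarrow> i \<noteq> j \<Longrightarrow> {i, j} \<in> E"
  using closed[unfolded closed_labeled_def, rule_format, of i k j k] by (auto simp: P_def doubleton_eq_iff)

text \<open>Closedness joins the three upper neighbours pairwise, which with \<open>i\<close> gives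
  a 4-clique.\<close>

lemma up_three:
  assumes "(i, a) \<in> P" "(i, b) \<in> P" "(i, c) \<in> P" "a \<noteq> b" "a \<noteq> c" "b \<noteq> c"
  shows False
proof -
  have "i \<noteq> a" "i \<noteq> b" "i \<noteq> c" using assms(1-3)[THEN P_less] by auto
  then have "card {i, a, b, c} = 4" using assms(4-6) by simp
  moreover have "{i, a} \<in> E" "{i, b} \<in> E" "{i, c} \<in> E" "{a, b} \<in> E" "{a, c} \<in> E" "{b, c} \<in> E"
    using assms up P_edge by auto
  then have "is_clique E {i, a, b, c}" unfolding is_clique_def by (auto simp: insert_commute)
  ultimately show False using K4 unfolding K4_free_def by blast
qed

lemma tri_less: "tri i j k \<Longrightarrow> i < j \<and> j < k"
  by (auto simp: tri_def dest: P_less)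

text \<open>The other two vertices are the at most two upper neighbours of \<open>i\<close>.\<close>

lemma tri_min_unique: "tri i j k \<Longrightarrow> tri i j' k' \<Longrightarrow> j = j' \<and> k = k'"
proof -
  assume t: "tri i j k" "tri i j' k'"
  then have p: "(i, j) \<in> P" "(i, k) \<in> P" "(i, j') \<in> P" "(i, k') \<in> P" "j < k" "j' < k'"
    by (auto simp: tri_def dest: P_less)
  have "j' = j \<or> j' = k" using up_three[OF p(1,2,3)] p(5) by auto
  moreover have "k' = j \<or> k' = k" using up_three[OF p(1,2,4)] p(5) by auto
  ultimately show ?thesis using p(5,6) by auto
qed

text \<open>Of two lower vertices i < i' the first would be joined to \<open>i'\<close> by
  closedness, and \<open>i'\<close>, \<open>j\<close>, \<open>k\<close> would be three upper
  neighbours of \<open>i\<close>.\<close>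

lemma tri_mid_unique: "tri i j k \<Longrightarrow> tri i' j k' \<Longrightarrow> i = i' \<and> k = k'"
proof -
  have *: "\<not> i < i'" if t: "tri i j k" "tri i' j k'" for i i' k k'
  proof
    assume lt: "i < i'"
    have p: "(i, j) \<in> P" "(i, k) \<in> P" "(i', j) \<in> P" "i' < j" "j < k" using t tri_less by (auto simp: tri_def)
    have "(i, i') \<in> P" using down[OF p(1,3)] lt by (intro edge_P) auto
    then show False by (rule up_three[OF p(1,2)]) (use p(4,5) in auto)
  qed
  assume t: "tri i j k" "tri i' j k'"
  then have "i = i'" using *[OF t] *[OF t(2,1)] by auto
  then show ?thesis using tri_min_unique t by blast
qed

text \<open>Otherwise \<open>i\<close> has the upper neighbours \<open>j\<close>, \<open>j'\<close>
  and \<open>k\<close>. Used to keep the leading edges of X- and Y-relations apart.\<close>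

lemma tri_top_edge_not_long: "tri i j k \<Longrightarrow> tri j j' k \<Longrightarrow> False"
proof -
  assume t: "tri i j k" "tri j j' k"
  have l: "i < j" "j < j'" "j' < k" using t tri_less by auto
  have p: "(i, j) \<in> P" "(i, k) \<in> P" "(j', k) \<in> P" using t by (auto simp: tri_def)
  have "(i, j') \<in> P" using down[OF p(2,3)] l by (intro edge_P) auto
  then show False by (rule up_three[OF p(1,2)]) (use l in auto)
qed

section \<open>Multisets of edges as matrices with given row and column sums\<close>

definition u :: "'n \<times> 'n \<Rightarrow> 'n var \<Rightarrow>\<^sub>0 nat" where
  "u = (\<lambda>(i, j). evar (X i) + evar (Y j))"

lemma u_pair [simp]: "u (i, j) = evar (X i) + evar (Y j)"
  by (simp add: u_def)

definition Us :: "('n \<times> 'n) multiset \<Rightarrow> 'n var \<Rightarrow>\<^sub>0 nat" where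
  "Us a = (\<Sum>e\<in>#a. u e)"

text \<open>Rows are the smaller and columns the larger endpoints; exponents of the X and Y
  variables are row and column sums.\<close>

lemma lookup_Us:
  "lookup (Us a) (X i) = size {#e \<in># a. fst e = i#}" "lookup (Us a) (Y j) = size {#e \<in># a. snd e = j#}"
proof -
  have "lookup (Us a) (X i) = size {#e \<in># a. fst e = i#} \<and> lookup (Us a) (Y j) = size {#e \<in># a. snd e = j#}"
    unfolding Us_def
  proof (induction a)
    case (add e a)
    then show ?case by (cases e) (auto simp: lookup_add lookup_evar)
  qed simp
  then show "lookup (Us a) (X i) = size {#e \<in># a. fst e = i#}" "lookup (Us a) (Y j) = size {#e \<in># a. snd e = j#}"
    by auto
qed

lemma row_gain: "lookup (Us a) (X i) < lookup (Us b) (X i) \<Longrightarrow> \<exists>k. count a (i, k) < count b (i, k)"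
  unfolding lookup_Us using multiset_size_less by (fastforce split: if_splits)

lemma column_gain: "lookup (Us a) (Y j) < lookup (Us b) (Y j) \<Longrightarrow> \<exists>k. count a (k, j) < count b (k, j)"
  unfolding lookup_Us using multiset_size_less by (fastforce split: if_splits)

lemma row_exchange:
  assumes "lookup (Us a) (X i) \<le> lookup (Us b) (X i)" "count b (i, k) < count a (i, k)"
  obtains k' where "count a (i, k') < count b (i, k')"
proof -
  have "\<exists>e. count {#e \<in># a. fst e = i#} e < count {#e \<in># b. fst e = i#} e"
    using assms by (intro multiset_size_le_cases[where e = "(i, k)"]) (simp_all add: lookup_Us)
  then show ?thesis using that by (auto split: if_splits)
qed

lemma column_exchange:
  assumes "lookup (Us a) (Y j) \<le> lookup (Us b) (Y j)" "count b (k, j) < count a (k, j)"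
  obtains k' where "count a (k', j) < count b (k', j)"
proof -
  have "\<exists>e. count {#e \<in># a. snd e = j#} e < count {#e \<in># b. snd e = j#} e"
    using assms by (intro multiset_size_le_cases[where e = "(k, j)"]) (simp_all add: lookup_Us)
  then show ?thesis using that by (auto split: if_splits)
qed

lemma count_P: "set_mset a \<subseteq> P \<Longrightarrow> count b e < count a e \<Longrightarrow> e \<in> P \<and> e \<in># a"
  by (metis count_greater_zero_iff gr_zeroI not_less_zero subsetD)

text \<open>
  The bipartite graph on \<open>X i, Y j\<close> with an edge for each \<open>(i, j) \<in> P\<close> is a disjoint union of
  paths.  The difference of the multisets \<open>a'\<close> and \<open>a\<close> is a chain on this graph whose boundary is
  controlled by the hypotheses; looking at its first row (or column) locates a triangle.
\<close>

lemma row_case: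
  assumes a: "set_mset a \<subseteq> P" "set_mset a' \<subseteq> P"
    and col: "\<And>j. lookup (Us a) (Y j) = lookup (Us a') (Y j)"
    and pos: "count a (i, k) < count a' (i, k)"
    and row: "\<And>r. r \<le> i \<Longrightarrow> lookup (Us a) (X r) \<le> lookup (Us a') (X r)"
  shows "\<exists>r j b. r \<le> i \<and> tri r j b \<and> (j, b) \<in># a \<and> lookup (Us a) (X r) < lookup (Us a') (X r)"
proof -
  define S where "S = {r. \<exists>b. count a (r, b) < count a' (r, b)}"
  have fin: "finite S" by simp
  have iS: "i \<in> S" using pos by (auto simp: S_def)
  \<comment> \<open>The first row in which \<open>a'\<close> exceeds \<open>a\<close> at some
    entry.\<close>
  define r where "r = Min S"
  have "r \<in> S" unfolding r_def using fin iS by (intro Min_in) auto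
  then obtain b where b: "count a (r, b) < count a' (r, b)" by (auto simp: S_def)
  have min: "r \<le> r'" if "count a (r', c) < count a' (r', c)" for r' c
    unfolding r_def using that fin by (intro Min_le) (auto simp: S_def)
  have ri: "r \<le> i" using min[OF pos] .
  have rbP: "(r, b) \<in> P" using count_P[OF a(2) b] by blast
  have "lookup (Us a') (Y b) \<le> lookup (Us a) (Y b)" using col by simp
  from column_exchange[OF this b] obtain r' where r': "count a' (r', b) < count a (r', b)" .
  have r'P: "(r', b) \<in> P" "(r', b) \<in># a" using count_P[OF a(1) r'] by auto
  have ne: "r' \<noteq> r" using r' b by auto
  \<comment> \<open>A loss in an earlier row would be offset by a gain in that row, against the
    choice of \<open>r\<close>.\<close>
  have "\<not> r' < r"
  proof
    assume lt: "r' < r"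
    have "lookup (Us a) (X r') \<le> lookup (Us a') (X r')" using lt ri by (intro row) simp
    from row_exchange[OF this r'] obtain c where "count a (r', c) < count a' (r', c)" .
    then show False using min lt by fastforce
  qed
  with ne have rr': "r < r'" by simp
  have rr'P: "(r, r') \<in> P" using down[OF rbP r'P(1)] rr' by (intro edge_P) auto
  have tri: "tri r r' b" using rr'P rbP r'P by (simp add: tri_def)
  have r'b: "r' < b" using P_less[OF r'P(1)] .
  \<comment> \<open>Without a surplus in row \<open>r\<close>, the gain at \<open>b\<close> is
    offset by a loss at the only other entry of the row, \<open>r'\<close>. Column \<open>r'\<close>
    then gains in a row after \<open>r\<close>, which would be a third upper neighbour of
    \<open>r\<close>.\<close>
  have "lookup (Us a) (X r) < lookup (Us a') (X r)"
  proof (rule ccontr)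
    assume "\<not> ?thesis"
    then have "lookup (Us a') (X r) \<le> lookup (Us a) (X r)" by simp
    from row_exchange[OF this b] obtain b' where b': "count a' (r, b') < count a (r, b')" .
    have b'P: "(r, b') \<in> P" using count_P[OF a(1) b'] by blast
    have "b' \<noteq> b" using b b' by auto
    then have "b' = r'" using up_three[OF rbP rr'P b'P] r'b by auto
    then have n: "count a' (r, r') < count a (r, r')" using b' by simp
    have "lookup (Us a) (Y r') \<le> lookup (Us a') (Y r')" using col by simp
    from column_exchange[OF this n] obtain s where s: "count a (s, r') < count a' (s, r')" .
    have sP: "(s, r') \<in> P" using count_P[OF a(2) s] by blast
    have "s \<noteq> r" using s n by auto
    with min[OF s] have "r < s" by simp
    have sr': "s < r'" using P_less[OF sP] .
    have "(r, s) \<in> P" using down[OF rr'P sP] \<open>r < s\<close> by (intro edge_P) auto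
    then show False by (rule up_three[OF rbP rr'P]) (use r'b sr' in auto)
  qed
  with tri r'P(2) ri show ?thesis by blast
qed

text \<open>Reversing the labels exchanges rows and columns but turns the first column into the last
  row, so this is not the mirror image of \<open>row_case\<close>.\<close>

lemma column_case:
  assumes a: "set_mset a \<subseteq> P" "set_mset a' \<subseteq> P"
    and row: "\<And>r. lookup (Us a) (X r) = lookup (Us a') (X r)"
    and pos: "count a (k, j) < count a' (k, j)"
    and col: "\<And>c. c \<le> j \<Longrightarrow> lookup (Us a) (Y c) \<le> lookup (Us a') (Y c)"
  shows "\<exists>r c b. c \<le> j \<and> tri r c b \<and> (r, b) \<in># a \<and> lookup (Us a) (Y c) < lookup (Us a') (Y c)"
proof -
  define S where "S = {c. \<exists>r. count a (r, c) < count a' (r, c)}"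
  have fin: "finite S" by simp
  have jS: "j \<in> S" using pos by (auto simp: S_def)
  define c where "c = Min S"
  have "c \<in> S" unfolding c_def using fin jS by (intro Min_in) auto
  then obtain r where r: "count a (r, c) < count a' (r, c)" by (auto simp: S_def)
  have min: "c \<le> c'" if "count a (s, c') < count a' (s, c')" for s c'
    unfolding c_def using that fin by (intro Min_le) (auto simp: S_def)
  have cj: "c \<le> j" using min[OF pos] .
  have rcP: "(r, c) \<in> P" using count_P[OF a(2) r] by blast
  have "lookup (Us a') (X r) \<le> lookup (Us a) (X r)" using row by simp
  from row_exchange[OF this r] obtain b where b: "count a' (r, b) < count a (r, b)" .
  have rbP: "(r, b) \<in> P" "(r, b) \<in># a" using count_P[OF a(1) b] by auto
  have ne: "b \<noteq> c" using r b by auto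
  have "\<not> b < c"
  proof
    assume lt: "b < c"
    have "lookup (Us a) (Y b) \<le> lookup (Us a') (Y b)" using lt cj by (intro col) simp
    from column_exchange[OF this b] obtain s where "count a (s, b) < count a' (s, b)" .
    then show False using min lt by fastforce
  qed
  with ne have cb: "c < b" by simp
  have cbP: "(c, b) \<in> P" using up[OF rcP rbP(1)] cb by (intro edge_P) auto
  have tri: "tri r c b" using rcP rbP cbP by (simp add: tri_def)
  \<comment> \<open>Without a surplus the gain in column \<open>c\<close> is offset by a loss in
    another row \<open>s\<close>. If s < r, row \<open>s\<close> must gain beyond \<open>c\<close>
    and \<open>s\<close> has three upper neighbours; if r < s, then \<open>s\<close>,
    \<open>c\<close> and \<open>b\<close> are three upper neighbours of \<open>r\<close>.\<close>
  have "lookup (Us a) (Y c) < lookup (Us a') (Y c)"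
  proof (rule ccontr)
    assume "\<not> ?thesis"
    then have "lookup (Us a') (Y c) \<le> lookup (Us a) (Y c)" by simp
    from column_exchange[OF this r] obtain s where s: "count a' (s, c) < count a (s, c)" .
    have sP: "(s, c) \<in> P" using count_P[OF a(1) s] by blast
    have sc: "s < c" and rc: "r < c" using P_less[OF sP] P_less[OF rcP] .
    have "s \<noteq> r" using r s by auto
    then consider "s < r" | "r < s" by fastforce
    then show False
    proof cases
      case 1
      have srP: "(s, r) \<in> P" using down[OF sP rcP] 1 by (intro edge_P) auto
      have "lookup (Us a) (X s) \<le> lookup (Us a') (X s)" using row by simp
      from row_exchange[OF this s] obtain b' where b': "count a (s, b') < count a' (s, b')" .
      have "b' \<noteq> c" using b' s by auto
      with min[OF b'] have "c < b'" by simp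
      moreover have "(s, b') \<in> P" using count_P[OF a(2) b'] by blast
      ultimately show False by (intro up_three[OF sP srP, of b']) (use rc in auto)
    next
      case 2
      have "(r, s) \<in> P" using down[OF rcP sP] 2 by (intro edge_P) auto
      then show False by (rule up_three[OF rcP rbP(1)]) (use cb sc in auto)
    qed
  qed
  with tri rbP(2) cj show ?thesis by blast
qed

text \<open>If an entry differed, \<open>row_case\<close> would find a row whose sums
  differ.\<close>

lemma Us_inj:
  assumes a: "set_mset a \<subseteq> P" "set_mset a' \<subseteq> P" and eq: "Us a = Us a'"
  shows "a = a'"
proof (rule multiset_eqI)
  fix e
  have *: "\<not> count b e < count b' e" if "set_mset b \<subseteq> P" "set_mset b' \<subseteq> P" "Us b = Us b'" for b b'
  proof
    assume "count b e < count b' e"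
    then have "count b (fst e, snd e) < count b' (fst e, snd e)" by simp
    from row_case[OF that(1,2) _ this] show False using that(3) by auto
  qed
  from *[OF a eq] *[OF a(2,1) eq[symmetric]] show "count a e = count a' e" by simp
qed

lemma size_eq_sum_X: "size a = (\<Sum>i\<in>UNIV. lookup (Us a) (X i))"
  unfolding Us_def
proof (induction a)
  case (add e a)
  then show ?case by (cases e) (simp add: lookup_add lookup_evar sum.distrib)
qed simp

text \<open>A triangle i < j < k enters through the variable \<open>X i\<close> of its least and
  \<open>Y j\<close> of its middle vertex, at which its two syzygies lead.\<close>

definition relations :: "'n var set" where
  "relations = {X i | i j k. tri i j k} \<union> {Y j | i j k. tri i j k}"

text \<open>The edge opposite to the indexing vertex. The descriptions are definite because a
  triangle is determined by its least and by its middle vertex.\<close>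

definition \<kappa> :: "'n var \<Rightarrow> 'n \<times> 'n" where
  "\<kappa> v = (case v of X i \<Rightarrow> (THE (j, k). tri i j k) | Y j \<Rightarrow> (THE (i, k). tri i j k))"

lemma \<kappa>_X: "tri i j k \<Longrightarrow> \<kappa> (X i) = (j, k)"
  unfolding \<kappa>_def using tri_min_unique by (auto intro!: the_equality)

lemma \<kappa>_Y: "tri i j k \<Longrightarrow> \<kappa> (Y j) = (i, k)"
  unfolding \<kappa>_def using tri_mid_unique by (auto intro!: the_equality)

lemma relations_cases:
  assumes "v \<in> relations"
  obtains i j k where "tri i j k" "v = X i" "\<kappa> v = (j, k)" | i j k where "tri i j k" "v = Y j" "\<kappa> v = (i, k)"
  using assms \<kappa>_X \<kappa>_Y unfolding relations_def by blast

text \<open>The lower end of the edge is the middle vertex for an X and the least vertex for a Y, so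
  it recovers the triangle; an X and a Y with the same edge contradict
  \<open>tri_top_edge_not_long\<close>.\<close>

lemma \<kappa>_inj: "inj_on \<kappa> relations"
proof (rule inj_onI)
  fix v w assume v: "v \<in> relations" and w: "w \<in> relations" and eq: "\<kappa> v = \<kappa> w"
  have XY: False if "tri i j k" "tri i' j' k'" "j = i'" "k = k'" for i j k i' j' k'
    using that tri_top_edge_not_long by blast
  show "v = w"
  proof (rule relations_cases[OF v])
    fix i j k assume 1: "tri i j k" "v = X i" "\<kappa> v = (j, k)"
    show "v = w"
    proof (rule relations_cases[OF w])
      fix i' j' k' assume 2: "tri i' j' k'" "w = X i'" "\<kappa> w = (j', k')"
      then show ?thesis using 1 eq tri_mid_unique[of i j k i' k] by simp
    next
      fix i' j' k' assume 2: "tri i' j' k'" "w = Y j'" "\<kappa> w = (i', k')"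
      then show ?thesis using 1 eq XY[of i j k i' j' k'] by simp
    qed
  next
    fix i j k assume 1: "tri i j k" "v = Y j" "\<kappa> v = (i, k)"
    show "v = w"
    proof (rule relations_cases[OF w])
      fix i' j' k' assume 2: "tri i' j' k'" "w = X i'" "\<kappa> w = (j', k')"
      have "j' = i" "k' = k" using 1(3) 2(3) eq by auto
      then show ?thesis using XY[OF 2(1) 1(1)] by blast
    next
      fix i' j' k' assume 2: "tri i' j' k'" "w = Y j'" "\<kappa> w = (i', k')"
      then show ?thesis using 1 eq tri_min_unique[of i j k j' k] by simp
    qed
  qed
qed

text \<open>The hypothesis moves one unit of a row (or column) sum from a later to an earlier place.
  All earlier sums agree, so the surplus found by \<open>row_case\<close> or
  \<open>column_case\<close> sits at the index of \<open>v\<close> itself.\<close>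

lemma exchange:
  assumes a: "set_mset a \<subseteq> P" "set_mset a' \<subseteq> P" and size: "size a = size a'"
    and lt: "evar w < evar v" and eq: "evar v + Us a = evar w + Us a'"
  shows "v \<in> relations \<and> \<kappa> v \<in># a"
proof -
  have lk: "(if x = v then 1 else 0) + lookup (Us a) x = (if x = w then 1 else 0) + lookup (Us a') x" for x
    using arg_cong[OF eq, of "\<lambda>s. lookup s x"] by (simp add: lookup_add lookup_evar eq_commute)
  have vw: "v < w" using lt evar_less_iff by blast
  \<comment> \<open>Equal sizes mean equal degree in the X variables, so \<open>v\<close> and
    \<open>w\<close> are of the same kind.\<close>
  have "(\<Sum>i\<in>UNIV. (if X i = v then 1 else 0) + lookup (Us a) (X i)) =
      (\<Sum>i\<in>UNIV. (if X i = w then 1 else 0) + lookup (Us a') (X i))"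
    by (intro sum.cong refl) (rule lk)
  then have "(\<Sum>i\<in>UNIV. if X i = v then 1 else (0::nat)) + size a = (\<Sum>i\<in>UNIV. if X i = w then 1 else 0) + size a'"
    by (simp only: size_eq_sum_X sum.distrib)
  then have sum_eq: "(\<Sum>i\<in>UNIV. if X i = v then 1 else (0::nat)) = (\<Sum>i\<in>UNIV. if X i = w then 1 else 0)"
    by (simp only: size add_right_cancel)
  show ?thesis
  proof (cases v)
    case (X i0)
    obtain i1 where w: "w = X i1" using sum_eq X by (cases w) auto
    have i01: "i0 < i1" using vw X w by simp
    have row: "(if i = i0 then 1 else 0) + lookup (Us a) (X i) = (if i = i1 then 1 else 0) + lookup (Us a') (X i)" for i
      using lk[of "X i"] X w by simp
    have col: "lookup (Us a) (Y j) = lookup (Us a') (Y j)" for j using lk[of "Y j"] X w by simp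
    have "lookup (Us a) (X i0) < lookup (Us a') (X i0)" using row[of i0] i01[THEN less_imp_neq] by simp
    from row_gain[OF this] obtain k where k: "count a (i0, k) < count a' (i0, k)" ..
    have "lookup (Us a) (X r) \<le> lookup (Us a') (X r)" if "r \<le> i0" for r
      using row[of r] that i01 by (auto split: if_splits)
    from row_case[OF a col k this] obtain r j b where
      r: "r \<le> i0" "tri r j b" "(j, b) \<in># a" "lookup (Us a) (X r) < lookup (Us a') (X r)" by blast
    have "r = i0" using row[of r] r(1,4) i01 by (auto split: if_splits)
    then show ?thesis using r(2,3) \<kappa>_X[of r j b] X by (auto simp: relations_def)
  next
    case (Y j0)
    obtain j1 where w: "w = Y j1" using vw Y by (cases w) auto
    have j01: "j0 < j1" using vw Y w by simp
    have col: "(if j = j0 then 1 else 0) + lookup (Us a) (Y j) = (if j = j1 then 1 else 0) + lookup (Us a') (Y j)" for j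
      using lk[of "Y j"] Y w by simp
    have row: "lookup (Us a) (X i) = lookup (Us a') (X i)" for i using lk[of "X i"] Y w by simp
    have "lookup (Us a) (Y j0) < lookup (Us a') (Y j0)" using col[of j0] j01[THEN less_imp_neq] by simp
    from column_gain[OF this] obtain k where k: "count a (k, j0) < count a' (k, j0)" ..
    have "lookup (Us a) (Y c) \<le> lookup (Us a') (Y c)" if "c \<le> j0" for c
      using col[of c] that j01 by (auto split: if_splits)
    from column_case[OF a row k this] obtain r c b where
      c: "c \<le> j0" "tri r c b" "(r, b) \<in># a" "lookup (Us a) (Y c) < lookup (Us a') (Y c)" by blast
    have "c = j0" using col[of c] c(1,4) j01 by (auto split: if_splits)
    then show ?thesis using c(2,3) \<kappa>_Y[of r c b] Y by (auto simp: relations_def)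
  qed
qed

text \<open>For \<delta> = 1 the binomials, for \<delta> = 0 their leading monomials.\<close>

definition f :: "'k::field \<Rightarrow> 'n \<times> 'n \<Rightarrow> ('n var, 'k) mpoly" where
  "f \<delta> = (\<lambda>(i, j). pvar (X i) * pvar (Y j) - cst \<delta> * (pvar (X j) * pvar (Y i)))"

lemma f_pair: "f \<delta> (i, j) = pvar (X i) * pvar (Y j) - cst \<delta> * (pvar (X j) * pvar (Y i))"
  by (simp add: f_def)

lemma lookup_f:
  "i < j \<Longrightarrow> lookup (f \<delta> (i, j)) s =
    (if s = evar (X i) + evar (Y j) then 1 else if s = evar (X j) + evar (Y i) then - \<delta> else 0)"
  using evar_swap_less[of i j]
  by (auto simp: f_pair lookup_minus lookup_cst_pvar_pvar pvar_eq mult_single lookup_single when_def)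

lemma f_le: "i < j \<Longrightarrow> lookup (f \<delta> (i, j)) s \<noteq> 0 \<Longrightarrow> s \<le> evar (X i) + evar (Y j)"
  using evar_swap_less[of i j] by (auto simp: lookup_f split: if_splits)

lemma f_homog: "f \<delta> e \<in> homog_comp 2"
proof -
  have p: "pvar v * pvar w \<in> homog_comp 2" for v w :: "'n var"
    using homog_comp_mult[OF pvar_in_homog_comp[of v] pvar_in_homog_comp[of w]] by simp
  have "cst \<delta> * (pvar v * pvar w) \<in> homog_comp 2" for v w :: "'n var"
    using homog_comp_mult[OF cst_in_homog_comp p, of \<delta>] by simp
  then have "f \<delta> (i, j) \<in> homog_comp 2" for i j
    unfolding f_pair by (intro homog_comp_diff p)
  then show ?thesis by (cases e) simp
qed

text \<open>
  The two linear syzygies of a triangle \<open>i < j < k\<close>, for \<open>\<delta> = 1\<close> those among the binomials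
  \<open>x\<^sub>iy\<^sub>j - x\<^sub>jy\<^sub>i\<close> (rows of the Eagon-Northcott complex) and for \<open>\<delta> = 0\<close> those among the
  monomials \<open>x\<^sub>iy\<^sub>j\<close>.
\<close>

definition l :: "'k::field \<Rightarrow> 'n var \<Rightarrow> 'n var \<Rightarrow> ('n var, 'k) mpoly" where
  "l \<delta> r v = (case r of
     X i \<Rightarrow> (case \<kappa> r of (j, k) \<Rightarrow>
       if v = X i then f \<delta> (j, k) else if v = X j then - f \<delta> (i, k) else if v = X k then cst \<delta> * f \<delta> (i, j) else 0)
   | Y j \<Rightarrow> (case \<kappa> r of (i, k) \<Rightarrow>
       if v = Y j then f \<delta> (i, k) else if v = Y k then - f \<delta> (i, j) else if v = Y i then - (cst \<delta> * f \<delta> (j, k)) else 0))"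

lemma l_X: "tri i j k \<Longrightarrow> l \<delta> (X i) v =
    (if v = X i then f \<delta> (j, k) else if v = X j then - f \<delta> (i, k) else if v = X k then cst \<delta> * f \<delta> (i, j) else 0)"
  by (simp add: l_def \<kappa>_X)

lemma l_Y: "tri i j k \<Longrightarrow> l \<delta> (Y j) v =
    (if v = Y j then f \<delta> (i, k) else if v = Y k then - f \<delta> (i, j) else if v = Y i then - (cst \<delta> * f \<delta> (j, k)) else 0)"
  by (simp add: l_def \<kappa>_Y)

lemma sum_three:
  fixes a b c :: "'a::finite" and p :: "'a \<Rightarrow> 'b::comm_ring_1"
  assumes "a \<noteq> b" "a \<noteq> c" "b \<noteq> c"
  shows "(\<Sum>v\<in>UNIV. p v * (if v = a then A else if v = b then B else if v = c then C else 0)) =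
    p a * A + p b * B + p c * C"
proof -
  have "(\<Sum>v\<in>UNIV. p v * (if v = a then A else if v = b then B else if v = c then C else 0)) =
      (\<Sum>v\<in>{a, b, c}. p v * (if v = a then A else if v = b then B else if v = c then C else 0))"
    by (rule sum.mono_neutral_right) auto
  also have "\<dots> = p a * A + p b * B + p c * C"
    using assms by (simp add: add.assoc)
  finally show ?thesis .
qed

text \<open>Both expansions leave a multiple of \<delta> - \<delta> * \<delta>, which vanishes at
  the two values of interest, 0 and 1.\<close>

lemma l_syz:
  assumes \<delta>: "\<delta> * \<delta> = (\<delta> :: 'k::field)" and r: "r \<in> relations"
  shows "(\<Sum>v\<in>UNIV. pvar v * l \<delta> r v) = 0"
proof -
  have cd: "cst \<delta> * cst \<delta> = (cst \<delta> :: ('n var, 'k) mpoly)" unfolding cst_mult[symmetric] \<delta> ..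
  from r show ?thesis
  proof (cases rule: relations_cases)
    case (1 i j k)
    note less = tri_less[OF 1(1)]
    have "xi * (xj * yk - d * (xk * yj)) + xj * - (xi * yk - d * (xk * yi)) + xk * (d * (xi * yj - d * (xj * yi))) =
        (d - d * d) * (xj * (xk * yi))" for xi xj xk yi yj yk d :: "('n var, 'k) mpoly"
      by (simp add: algebra_simps del: R.scale_scale)
    then show ?thesis
      unfolding 1(2) l_X[OF 1(1)] f_pair using less cd
      by (subst sum_three) auto
  next
    case (2 i j k)
    note less = tri_less[OF 2(1)]
    have "yj * (xi * yk - d * (xk * yi)) + yk * - (xi * yj - d * (xj * yi)) + yi * - (d * (xj * yk - d * (xk * yj))) =
        (d * d - d) * (xk * (yi * yj))" for xi xj xk yi yj yk d :: "('n var, 'k) mpoly"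
      by (simp add: algebra_simps del: R.scale_scale)
    then show ?thesis
      unfolding 2(2) l_Y[OF 2(1)] f_pair using less cd
      by (subst sum_three) auto
  qed
qed

lemma l_span: "r \<in> relations \<Longrightarrow> l \<delta> r v \<in> kv.span (f \<delta> ` P)"
proof -
  assume r: "r \<in> relations"
  have "f \<delta> e \<in> kv.span (f \<delta> ` P)" if "e \<in> P" for e using that by (intro kv.span_base imageI)
  then show ?thesis
    using r by (elim relations_cases) (auto simp: l_X l_Y tri_def kv.span_zero kv.span_neg kv.span_scale)
qed

lemma l_lead: "r \<in> relations \<Longrightarrow> lookup (l \<delta> r r) (u (\<kappa> r)) \<noteq> 0"
  by (erule relations_cases) (auto simp: l_X l_Y lookup_f dest!: tri_less)

text \<open>The leading terms of the first two summands share their total monomial, x_i x_j y_k for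
  \<open>X i\<close> and x_i y_j y_k for \<open>Y j\<close>; the tie goes to the indexing variable,
  which is the larger one. The third summand has a smaller total.\<close>

lemma l_less:
  assumes r: "r \<in> relations" and s: "lookup (l \<delta> r v) s \<noteq> 0" and ne: "(v, s) \<noteq> (r, u (\<kappa> r))"
  shows "klt (evar v + s, evar v) (evar r + u (\<kappa> r), evar r)"
proof -
  \<comment> \<open>Here \<open>s'\<close> is the leading monomial of the generator at position
    \<open>v\<close>; any other monomial of it only lowers the total.\<close>
  have kltI: "klt (evar v + s, evar v) (m, evar r)"
    if "s \<le> s'" "evar v + s' < m \<or> evar v + s' = m \<and> (v = r \<longrightarrow> s \<noteq> s') \<and> r \<le> v" for s' m
  proof -
    have le: "evar v + s \<le> evar v + s'" using that(1) by simp
    from that(2) show ?thesis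
    proof (elim disjE conjE)
      assume "evar v + s' < m"
      with le have "evar v + s < m" by (rule le_less_trans)
      then show ?thesis by (simp add: klt_def)
    next
      assume m: "evar v + s' = m" and "v = r \<longrightarrow> s \<noteq> s'" "r \<le> v"
      then have "s \<noteq> s' \<or> evar v < evar r" unfolding evar_less_iff by (auto simp: order_less_le)
      then show ?thesis using le m by (auto simp: klt_def order_less_le)
    qed
  qed
  from r show ?thesis
  proof (cases rule: relations_cases)
    case (1 i j k)
    have less: "i < j" "j < k" "i < k" using tri_less[OF 1(1)] by auto
    note \<kappa> = 1(2,3)
    consider "v = X i" "lookup (f \<delta> (j, k)) s \<noteq> 0" | "v = X j" "lookup (f \<delta> (i, k)) s \<noteq> 0"
      | "v = X k" "lookup (f \<delta> (i, j)) s \<noteq> 0"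
      using s unfolding 1(2) l_X[OF 1(1)] by (auto split: if_splits)
    then show ?thesis
    proof cases
      case a: 1
      show ?thesis by (rule kltI[OF f_le[OF less(2) a(2)]]) (use a ne \<kappa> in simp)
    next
      case a: 2
      show ?thesis by (rule kltI[OF f_le[OF less(3) a(2)]]) (use a less \<kappa> in \<open>auto simp: ac_simps\<close>)
    next
      case a: 3
      \<comment> \<open>The third summand: x_k y_j is below x_j y_k.\<close>
      have "evar (X k) + (evar (X i) + evar (Y j)) = evar (X i) + (evar (X k) + evar (Y j))"
        by (simp only: ac_simps)
      also have "\<dots> < evar (X i) + (evar (X j) + evar (Y k))"
        using evar_swap_less[OF less(2)] by (rule add_strict_left_mono)
      finally show ?thesis by (intro kltI[OF f_le[OF less(1) a(2)]]) (use a \<kappa>_X[OF 1(1)] 1(2) in simp)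
    qed
  next
    case (2 i j k)
    have less: "i < j" "j < k" "i < k" using tri_less[OF 2(1)] by auto
    note \<kappa> = 2(2,3)
    consider "v = Y j" "lookup (f \<delta> (i, k)) s \<noteq> 0" | "v = Y k" "lookup (f \<delta> (i, j)) s \<noteq> 0"
      | "v = Y i" "lookup (f \<delta> (j, k)) s \<noteq> 0"
      using s unfolding 2(2) l_Y[OF 2(1)] by (auto split: if_splits)
    then show ?thesis
    proof cases
      case a: 1
      show ?thesis by (rule kltI[OF f_le[OF less(3) a(2)]]) (use a ne \<kappa> in simp)
    next
      case a: 2
      show ?thesis by (rule kltI[OF f_le[OF less(1) a(2)]]) (use a less \<kappa> in \<open>auto simp: ac_simps\<close>)
    next
      case a: 3
      have "evar (Y i) + (evar (X j) + evar (Y k)) = evar (X j) + evar (Y i) + evar (Y k)"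
        by (simp only: ac_simps)
      also have "\<dots> < evar (X i) + evar (Y j) + evar (Y k)"
        using evar_swap_less[OF less(1)] by (rule add_strict_right_mono)
      also have "\<dots> = evar (Y j) + (evar (X i) + evar (Y k))" by (simp only: ac_simps)
      finally show ?thesis by (intro kltI[OF f_le[OF less(2) a(2)]]) (use a \<kappa>_Y[OF 2(1)] 2(2) in simp)
    qed
  qed
qed

lemma strand_data:
  assumes "\<delta> * \<delta> = (\<delta> :: 'k::field)"
  shows "strand_data P u (f \<delta>) relations \<kappa> (l \<delta>)"
proof
  show "finite P" by (rule finite_subset[of _ UNIV]) auto
  show "lookup (f \<delta> e) (u e) \<noteq> 0" if "e \<in> P" for e
    using that by (cases e) (auto simp: lookup_f dest: P_less)
  show "s \<le> u e" if "e \<in> P" "lookup (f \<delta> e) s \<noteq> 0" for e s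
    using that f_le[OF P_less] by (cases e) auto
  show "\<kappa> v \<in> P" if "v \<in> relations" for v
    using that by (rule relations_cases) (auto simp: tri_def)
  show "f \<delta> e \<in> homog_comp 2" for e by (rule f_homog)
  show "a = a'" if "set_mset a \<subseteq> P" "set_mset a' \<subseteq> P" "(\<Sum>e\<in>#a. u e) = (\<Sum>e\<in>#a'. u e)" for a a'
    using that unfolding Us_def[symmetric] by (rule Us_inj)
  show "v \<in> relations \<and> \<kappa> v \<in># a" if "set_mset a \<subseteq> P" "set_mset a' \<subseteq> P" "size a = size a'" "evar w < evar v"
    "evar v + (\<Sum>e\<in>#a. u e) = evar w + (\<Sum>e\<in>#a'. u e)" for a a' v w
    using that unfolding Us_def[symmetric] by (rule exchange)
  show "inj_on \<kappa> relations" by (rule \<kappa>_inj)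
  show "l \<delta> r v \<in> kv.span (f \<delta> ` P)" if "r \<in> relations" for r v using that by (rule l_span)
  show "(\<Sum>v\<in>UNIV. pvar v * l \<delta> r v) = 0" if "r \<in> relations" for r using assms that by (rule l_syz)
  show "lookup (l \<delta> r r) (u (\<kappa> r)) \<noteq> 0" if "r \<in> relations" for r using that by (rule l_lead)
  show "klt (evar v + s, evar v) (evar r + u (\<kappa> r), evar r)"
    if "r \<in> relations" "lookup (l \<delta> r v) s \<noteq> 0" "(v, s) \<noteq> (r, u (\<kappa> r))" for r v s
    using that by (rule l_less)
qed

section \<open>Counting edges and relations; the Betti numbers\<close>

lemma card_P: "card P = card E"
proof -
  have "bij_betw (\<lambda>(i, j). {i, j}) P E"
    unfolding bij_betw_def
  proof
    show "inj_on (\<lambda>(i, j). {i, j}) P"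
      by (auto simp: inj_on_def doubleton_eq_iff P_def)
    have "e \<in> (\<lambda>(i, j). {i, j}) ` P" if e: "e \<in> E" for e
    proof -
      obtain i j where ij: "e = {i, j}" "i \<noteq> j"
        using simple e unfolding simple_graph_def by (auto simp: card_2_iff)
      then consider "i < j" | "j < i" by fastforce
      then show ?thesis
      proof cases
        case 1
        then show ?thesis using ij e by (intro image_eqI[of _ _ "(i, j)"]) (auto simp: P_def)
      next
        case 2
        then show ?thesis using ij e by (intro image_eqI[of _ _ "(j, i)"]) (auto simp: P_def insert_commute)
      qed
    qed
    then show "(\<lambda>(i, j). {i, j}) ` P = E" by (auto simp: P_def)
  qed
  then show ?thesis by (rule bij_betw_same_card)
qed

text \<open>A triangle is a sorted triple, and its least and its middle vertex each determine it, so
  the X and Y relations are two disjoint copies of the set of triangles.\<close>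

lemma card_relations: "card relations = 2 * card (triangles E)"
proof -
  define T where "T = {(i, j, k). tri i j k}"
  have "bij_betw (\<lambda>(i, j, k). {i, j, k}) T (triangles E)"
    unfolding bij_betw_def
  proof
    show "inj_on (\<lambda>(i, j, k). {i, j, k}) T"
    proof (rule inj_onI)
      fix x y assume xy: "x \<in> T" "y \<in> T" "(\<lambda>(i, j, k). {i, j, k}) x = (\<lambda>(i, j, k). {i, j, k}) y"
      obtain i j k where x: "x = (i, j, k)" by (cases x)
      obtain i' j' k' where y: "y = (i', j', k')" by (cases y)
      have t: "tri i j k" "tri i' j' k'" and eq: "{i, j, k} = {i', j', k'}" using xy x y by (auto simp: T_def)
      have "Min {i, j, k} = i" using tri_less[OF t(1)] by (intro Min_eqI) auto
      moreover have "Min {i', j', k'} = i'" using tri_less[OF t(2)] by (intro Min_eqI) auto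
      ultimately have "i = i'" using eq by simp
      then show "x = y" using tri_min_unique[of i j k j' k'] t x y by simp
    qed
    have "S \<in> (\<lambda>(i, j, k). {i, j, k}) ` T" if S: "S \<in> triangles E" for S
    proof -
      have c: "card S = 3" "is_clique E S" using S by (auto simp: triangles_def)
      then have fin: "finite S" by (metis card.infinite zero_neq_numeral)
      define xs where "xs = sorted_list_of_set S"
      have "length xs = 3" using c by (simp add: xs_def)
      then obtain i j k where xs: "xs = [i, j, k]" by (auto simp: numeral_3_eq_3 length_Suc_conv)
      have "sorted xs" "distinct xs" "set xs = S" using fin by (simp_all add: xs_def)
      then have ijk: "i < j" "j < k" "S = {i, j, k}" unfolding xs by auto
      have "tri i j k"
        using c(2) ijk unfolding is_clique_def tri_def P_def by auto
      then show ?thesis using ijk(3) by (intro image_eqI[of _ _ "(i, j, k)"]) (auto simp: T_def)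
    qed
    moreover have "{i, j, k} \<in> triangles E" if "tri i j k" for i j k
    proof -
      have less: "i < j" "j < k" using tri_less[OF that] by auto
      then have "i \<noteq> j" "i \<noteq> k" "j \<noteq> k" by auto
      then have "card {i, j, k} = 3" by simp
      moreover have "is_clique E {i, j, k}"
        using that P_edge unfolding is_clique_def tri_def by (auto simp: insert_commute)
      ultimately show ?thesis by (simp add: triangles_def)
    qed
    ultimately show "(\<lambda>(i, j, k). {i, j, k}) ` T = triangles E" by (auto simp: T_def)
  qed
  then have T: "card T = card (triangles E)" by (rule bij_betw_same_card)
  define A where "A = (\<lambda>(i, j, k). X i) ` T"
  define B where "B = (\<lambda>(i, j, k). Y j) ` T"
  have "relations = A \<union> B" by (force simp: relations_def A_def B_def T_def)
  moreover have "A \<inter> B = {}" by (auto simp: A_def B_def)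
  ultimately have "card relations = card A + card B" by (simp add: card_Un_disjoint)
  moreover have "inj_on (\<lambda>(i, j, k). X i) T" using tri_min_unique by (auto simp: inj_on_def T_def)
  then have "card A = card T" unfolding A_def by (rule card_image)
  moreover have "inj_on (\<lambda>(i, j, k). Y j) T" using tri_mid_unique by (auto simp: inj_on_def T_def)
  then have "card B = card T" unfolding B_def by (rule card_image)
  ultimately show ?thesis using T by simp
qed

lemma binomial_edge_ideal_eq: "binomial_edge_ideal E = R.span (f (1::'k::field) ` P)"
proof -
  have "{xvar i * yvar j - xvar j * yvar i | i j. {i, j} \<in> E \<and> i < j} = f (1::'k) ` P"
    by (force simp: f_pair P_def xvar_def yvar_def pvar_def)
  then show ?thesis by (simp add: binomial_edge_ideal_def ideal_gen_eq)
qed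

lemma f_0: "f (0::'k::field) = (\<lambda>e. single (u e) 1)"
  by (rule ext) (auto simp: f_def u_def pvar_eq mult_single)

text \<open>The two values of \<delta> share edges, relations and \<open>\<kappa>\<close>, so both
  strands are counted by the same index set.\<close>

theorem betti_numbers:
  fixes J :: "('n var, 'k::field) mpoly set"
  assumes J: "J = binomial_edge_ideal E"
  defines "N m i \<equiv> if i \<le> m then (2 * card (triangles E) choose i) * ((card E + (m - i) - 1) choose (m - i)) else 0"
  shows "ideal_betti i (2 * int m + int i) (ideal_power J m) = N m i"
    and "ideal_betti i (2 * int m + int i) (ideal_power (initial_ideal_lex J) m) = N m i"
proof -
  interpret S1: strand_data P u "f (1::'k)" relations \<kappa> "l (1::'k)" by (rule strand_data) simp
  interpret S0: strand_data P u "f (0::'k)" relations \<kappa> "l (0::'k)" by (rule strand_data) simp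
  have N: "N m i = (if i \<le> m then (card relations choose i) * card (multisets_of_size P (m - i)) else 0)"
    using card_multisets_of_size[OF S1.finite_P] by (simp add: N_def card_relations card_P)
  have "lowest J 2 (S1.W 1)" unfolding J binomial_edge_ideal_eq by (rule S1.lowest_generated)
  from S1.lowest_betti[OF S1.lowest_power[OF this]]
  show "ideal_betti i (2 * int m + int i) (ideal_power J m) = N m i" unfolding N S1.card_index .
  \<comment> \<open>The initial ideal is analysed with the binomials, but its lowest component is
    spanned by the monomials \<open>f 0\<close>; from here on the powers belong to the second
    interpretation.\<close>
  have "lowest (initial_ideal_lex J) 2 (kv.span (f (0::'k) ` P))"
    unfolding J binomial_edge_ideal_eq f_0 by (rule S1.lowest_initial)
  then have "lowest (initial_ideal_lex J) 2 (S0.W 1)" unfolding S0.W_1 .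
  from S0.lowest_betti[OF S0.lowest_power[OF this]]
  show "ideal_betti i (2 * int m + int i) (ideal_power (initial_ideal_lex J) m) = N m i" unfolding N S0.card_index .
qed

end

theorem theorem3p6:
  fixes E :: "'n::{finite, linorder} set set"
    and J :: "('n var, 'k::field) mpoly set"
    and e t m i :: nat
  assumes "simple_graph E"
    and "closed_labeled E"
    and "K4_free E"
    and "e = card E"
    and "t = card (triangles E)"
    and "J = binomial_edge_ideal E"
    and "m \<ge> 1"
  shows "ideal_betti i (2 * int m + int i) (ideal_power J m)
           = ideal_betti i (2 * int m + int i) (ideal_power (initial_ideal_lex J) m)
         \<and> of_nat (ideal_betti i (2 * int m + int i) (ideal_power (initial_ideal_lex J) m))
           = binom (int e + int m - int i - 1) (int m - int i) * binom (2 * int t) (int i)"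
proof -
  interpret closed_K4_free E using assms(1-3) by unfold_locales
  note betti = betti_numbers[OF assms(6), of i m]
  have two_t: "binom (2 * int t) (int i) = of_nat ((2 * t) choose i)"
    using binom_of_nat[of "2 * t" i] by simp
  have "of_nat (if i \<le> m then (2 * card (triangles E) choose i) * ((card E + (m - i) - 1) choose (m - i)) else 0)
      = binom (int e + int m - int i - 1) (int m - int i) * binom (2 * int t) (int i)"
  proof (cases "i \<le> m")
    case True
    \<comment> \<open>For e = 0 and i = m the upper argument is -1, where subtraction on
      \<open>nat\<close> would differ. With e = 0 and i > 0 there are no triangles, so the factor
      with 2t makes both sides 0; otherwise m \<ge> 1 keeps the argument nonnegative.\<close>
    show ?thesis
    proof (cases "e = 0 \<and> i > 0")
      case True
      then have "E = {}" using assms(4) by simp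
      then have "triangles E = {}" by (auto simp: triangles_def is_clique_def card_Suc_eq numeral_3_eq_3)
      then show ?thesis using True assms(5) two_t by simp
    next
      case False
      have le: "1 \<le> e + (m - i)" using False assms(7) by auto
      have "int e + int m - int i - 1 = int (e + (m - i) - 1)" using le True by simp
      then have "binom (int e + int m - int i - 1) (int m - int i) = of_nat ((e + (m - i) - 1) choose (m - i))"
        using binom_of_nat[of "e + (m - i) - 1" "m - i"] True by (simp add: of_nat_diff)
      then show ?thesis using two_t True assms(4,5) by simp
    qed
  next
    case False
    then show ?thesis by (simp add: binom_def)
  qed
  then show ?thesis using betti by simp
qed

end
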